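(* Let $(U,\Sigma,\mu)$ be a $\sigma$-finite measure space with a full ordered core $\mathcal A$. If $X$ is a u.r.i. space over $U$, then $X\!\!\downarrow=(X'')^o$, with identical norms. If $X$ also has the Fatou property, then $X\!\!\downarrow=X^o$.
   Context: Functions equal $\mu$-a.e. are identified. $L(\Sigma)$ is the set of $\Sigma$-measurable functions $U\to[-\infty,\infty]$. An ordered core of $(U,\Sigma,\mu)$ is a subset $\mathcal A\subseteq\Sigma$, totally ordered by inclusion, containing $\emptyset$, whose members all have finite $\mu$-measure. It is $\sigma$-bounded if $\bigcup\mathcal A=\bigcup\mathcal A_0$ for some countable $\mathcal A_0\subseteq\mathcal A$, and full if it is $\sigma$-bounded and $\bigcup\mathcal A=U$. $\sigma(\mathcal A)$ is the $\sigma$-ring generated by $\mathcal A$ (a $\sigma$-algebra on $U$ when $\mathcal A$ is full). Write $u\le_{\mathcal A}v$ if for all $A\in\mathcal A$, $v\in A$ implies $u\in A$. $L^\downarrow(\mathcal A)$ is the set of core decreasing functions: $\sigma(\mathcal A)$-measurable $f:U\to[0,\infty]$ with $f(u)\ge f(v)$ whenever $u\le_{\mathcal A}v$. A Banach function space over $U$ is a real Banach space $X\subseteq L(\Sigma)$ such that if $f\in L(\Sigma)$, $g\in X$ and $|f|\le g$ $\mu$-a.e., then $f\in X$ and $\|f\|_X=\||f|\|_X\le\|g\|_X$. It has the Fatou property if whenever $0\le f_n\in X$, $f_n\uparrow f$ $\mu$-a.e. and $\lim\|f_n\|_X<\infty$, then $f\in X$ and $\|f_n\|_X\uparrow\|f\|_X$.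 The associate space $X'$ is the set of $g\in L(\Sigma)$ with $\|g\|_{X'}=\sup_{\|f\|_X\le1}\int_U|fg|\,d\mu<\infty$; $X''=(X')'$. The rearrangement of $f$ is $f^*(t)=\inf\{\delta>0:\mu(\{|f|>\delta\})\le t\}$, $t>0$. $X$ is universally rearrangement invariant (u.r.i.) if it is a Banach function space over $U$ such that $f\in L(\Sigma)$, $g\in X$ and $\int_0^tf^*\le\int_0^tg^*$ for all $t>0$ imply $f\in X$ and $\|f\|_X\le\|g\|_X$. It is assumed that $X$ is nontrivial; then $X$ and $X'$ contain all characteristic functions of sets of finite measure. The down space $X\!\!\downarrow$ is the set of $f\in L(\Sigma)$ with $\|f\|_{X\!\downarrow}=\sup\{\int_U|f|g\,d\mu:g\in X'\cap L^\downarrow(\mathcal A),\ \|g\|_{X'}\le1\}<\infty$. A level function of $f\in L(\Sigma)$ is an $f^o\in L^\downarrow(\mathcal A)$ such that for all $g\in L^\downarrow(\mathcal A)$, $$\int_Uf^og\,d\mu=\sup\Big\{\int_U|f|h\,d\mu:h\in L^\downarrow(\mathcal A),\ \int_Ah\,d\mu\le\int_Ag\,d\mu\text{ for all }A\in\mathcal A\Big\}.$$ For a Banach function space $X$, $X^o$ is the set of $f\in L(\Sigma)$ having a level function $f^o$ in $X$, with $\|f\|_{X^o}=\|f^o\|_X$. *)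

theory Defs
  imports "HOL-Analysis.Analysis"
begin

section \<open>Ordered cores and core decreasing functions\<close>

definition ordered_core :: "'a measure \<Rightarrow> 'a set set \<Rightarrow> bool" where
  "ordered_core M \<A> \<longleftrightarrow>
     \<A> \<subseteq> sets M \<and>
     (\<forall>A\<in>\<A>. \<forall>B\<in>\<A>. A \<subseteq> B \<or> B \<subseteq> A) \<and>
     {} \<in> \<A> \<and>
     (\<forall>A\<in>\<A>. emeasure M A < \<infinity>)"

definition sigma_bounded :: "'a set set \<Rightarrow> bool" where
  "sigma_bounded \<A> \<longleftrightarrow> (\<exists>\<A>\<^sub>0. \<A>\<^sub>0 \<subseteq> \<A> \<and> countable \<A>\<^sub>0 \<and> \<Union>\<A> = \<Union>\<A>\<^sub>0)"

definition full_ordered_core :: "'a measure \<Rightarrow> 'a set set \<Rightarrow> bool" where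
  "full_ordered_core M \<A> \<longleftrightarrow> ordered_core M \<A> \<and> sigma_bounded \<A> \<and> \<Union>\<A> = space M"

inductive_set sigma_ring :: "'a set set \<Rightarrow> 'a set set" for \<A> :: "'a set set" where
  Empty: "{} \<in> sigma_ring \<A>"
| Basic: "A \<in> \<A> \<Longrightarrow> A \<in> sigma_ring \<A>"
| Diff: "A \<in> sigma_ring \<A> \<Longrightarrow> B \<in> sigma_ring \<A> \<Longrightarrow> A - B \<in> sigma_ring \<A>"
| Union: "(\<And>n::nat. F n \<in> sigma_ring \<A>) \<Longrightarrow> (\<Union>n. F n) \<in> sigma_ring \<A>"

definition core_le :: "'a set set \<Rightarrow> 'a \<Rightarrow> 'a \<Rightarrow> bool" where
  "core_le \<A> u v \<longleftrightarrow> (\<forall>A\<in>\<A>. v \<in> A \<longrightarrow> u \<in> A)"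

text \<open>
  Functions from the underlying set to the extended reals are total functions of type
  \<^typ>\<open>'a \<Rightarrow> ereal\<close>; their values outside \<^term>\<open>space M\<close> never matter. Measurability with respect
  to the sigma-ring is stated through preimages of Borel sets; it is only used for full cores,
  where the sigma-ring is a sigma-algebra on \<^term>\<open>space M\<close> (see the lemmas below).
\<close>

definition core_decreasing :: "'a measure \<Rightarrow> 'a set set \<Rightarrow> ('a \<Rightarrow> ereal) set" where
  "core_decreasing M \<A> = {f.
     (\<forall>B\<in>sets borel. f -` B \<inter> space M \<in> sigma_ring \<A>) \<and>
     (\<forall>u\<in>space M. 0 \<le> f u) \<and>
     (\<forall>u\<in>space M. \<forall>v\<in>space M. core_le \<A> u v \<longrightarrow> f v \<le> f u)}"

lemma sigma_ring_full:
  assumes "full_ordered_core M \<A>"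
  shows "sigma_ring \<A> = sigma_sets (space M) \<A>"
proof
  have sub: "\<A> \<subseteq> Pow (space M)"
    using assms by (auto simp: full_ordered_core_def)
  interpret sigma_algebra "space M" "sigma_sets (space M) \<A>"
    by (rule sigma_algebra_sigma_sets[OF sub])
  show "sigma_ring \<A> \<subseteq> sigma_sets (space M) \<A>"
  proof
    fix A assume "A \<in> sigma_ring \<A>"
    then show "A \<in> sigma_sets (space M) \<A>"
      by (induction rule: sigma_ring.induct) auto
  qed
  obtain \<A>\<^sub>0 where \<A>\<^sub>0: "\<A>\<^sub>0 \<subseteq> \<A>" "countable \<A>\<^sub>0" "\<Union>\<A>\<^sub>0 = space M"
    using assms unfolding full_ordered_core_def sigma_bounded_def by metis
  have U: "space M \<in> sigma_ring \<A>"
  proof (cases "\<A>\<^sub>0 = {}")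
    case True
    then show ?thesis using \<A>\<^sub>0(3) sigma_ring.Empty[of \<A>] by auto
  next
    case False
    have "(\<Union>n. from_nat_into \<A>\<^sub>0 n) \<in> sigma_ring \<A>"
      using from_nat_into[OF False] \<A>\<^sub>0(1)
      by (intro sigma_ring.Union sigma_ring.Basic) auto
    then show ?thesis
      using range_from_nat_into[OF False \<A>\<^sub>0(2)] \<A>\<^sub>0(3) by simp
  qed
  show "sigma_sets (space M) \<A> \<subseteq> sigma_ring \<A>"
  proof
    fix A assume "A \<in> sigma_sets (space M) \<A>"
    then show "A \<in> sigma_ring \<A>"
      by (induction rule: sigma_sets.induct)
        (auto intro: sigma_ring.Empty sigma_ring.Basic sigma_ring.Diff[OF U] sigma_ring.Union)
  qed
qed

lemma core_decreasing_full:
  assumes "full_ordered_core M \<A>"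
  shows "f \<in> core_decreasing M \<A> \<longleftrightarrow>
     f \<in> borel_measurable (sigma (space M) \<A>) \<and>
     (\<forall>u\<in>space M. 0 \<le> f u) \<and>
     (\<forall>u\<in>space M. \<forall>v\<in>space M. core_le \<A> u v \<longrightarrow> f v \<le> f u)"
proof -
  have "\<A> \<subseteq> Pow (space M)"
    using assms by (auto simp: full_ordered_core_def)
  then show ?thesis
    by (simp add: core_decreasing_def sigma_ring_full[OF assms] measurable_def
        space_measure_of sets_measure_of)
qed


section \<open>Function spaces\<close>

text \<open>
  A space of measurable functions is given by its set of elements and its norm. The norm is total
  and takes values in the extended nonnegative reals; only its values on the carrier are
  meaningful, and there they are finite.
\<close>

record 'a fun_space =
  fs_carrier :: "('a \<Rightarrow> ereal) set"
  fs_norm :: "('a \<Rightarrow> ereal) \<Rightarrow> ennreal"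

definition same_space :: "'a fun_space \<Rightarrow> 'a fun_space \<Rightarrow> bool" where
  "same_space X Y \<longleftrightarrow>
     fs_carrier X = fs_carrier Y \<and> (\<forall>f\<in>fs_carrier X. fs_norm X f = fs_norm Y f)"

text \<open>
  The elements are functions rather than classes of functions modulo equality almost everywhere,
  so carrier and norm are required to respect that equality. The vector space operations are
  pointwise; elements are finite almost everywhere, since otherwise \<open>f - f = 0\<close> fails.
\<close>

definition real_banach_space :: "'a measure \<Rightarrow> 'a fun_space \<Rightarrow> bool" where
  "real_banach_space M X \<longleftrightarrow>
     fs_carrier X \<subseteq> borel_measurable M \<and>
     (\<forall>f\<in>fs_carrier X. \<forall>g\<in>borel_measurable M. (AE x in M. f x = g x) \<longrightarrow>
        g \<in> fs_carrier X \<and> fs_norm X g = fs_norm X f) \<and>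
     (\<forall>f\<in>fs_carrier X. AE x in M. \<bar>f x\<bar> \<noteq> \<infinity>) \<and>
     (\<lambda>x. 0) \<in> fs_carrier X \<and>
     (\<forall>f\<in>fs_carrier X. fs_norm X f < \<infinity> \<and> (fs_norm X f = 0 \<longleftrightarrow> (AE x in M. f x = 0))) \<and>
     (\<forall>f\<in>fs_carrier X. \<forall>g\<in>fs_carrier X.
        (\<lambda>x. f x + g x) \<in> fs_carrier X \<and>
        fs_norm X (\<lambda>x. f x + g x) \<le> fs_norm X f + fs_norm X g) \<and>
     (\<forall>c::real. \<forall>f\<in>fs_carrier X.
        (\<lambda>x. ereal c * f x) \<in> fs_carrier X \<and>
        fs_norm X (\<lambda>x. ereal c * f x) = ennreal \<bar>c\<bar> * fs_norm X f) \<and>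
     (\<forall>F :: nat \<Rightarrow> 'a \<Rightarrow> ereal. (\<forall>n. F n \<in> fs_carrier X) \<and>
        (\<forall>e>0. \<exists>k. \<forall>m\<ge>k. \<forall>n\<ge>k. fs_norm X (\<lambda>x. F m x - F n x) < e) \<longrightarrow>
        (\<exists>f\<in>fs_carrier X. (\<lambda>n. fs_norm X (\<lambda>x. F n x - f x)) \<longlonglongrightarrow> 0))"

definition banach_function_space :: "'a measure \<Rightarrow> 'a fun_space \<Rightarrow> bool" where
  "banach_function_space M X \<longleftrightarrow>
     real_banach_space M X \<and>
     (\<forall>f\<in>borel_measurable M. \<forall>g\<in>fs_carrier X. (AE x in M. \<bar>f x\<bar> \<le> g x) \<longrightarrow>
        f \<in> fs_carrier X \<and>
        fs_norm X f = fs_norm X (\<lambda>x. \<bar>f x\<bar>) \<and>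
        fs_norm X (\<lambda>x. \<bar>f x\<bar>) \<le> fs_norm X g)"

definition fatou_property :: "'a measure \<Rightarrow> 'a fun_space \<Rightarrow> bool" where
  "fatou_property M X \<longleftrightarrow>
     (\<forall>(F :: nat \<Rightarrow> 'a \<Rightarrow> ereal) f l.
        (\<forall>n. F n \<in> fs_carrier X \<and> (AE x in M. 0 \<le> F n x)) \<and>
        f \<in> borel_measurable M \<and>
        (AE x in M. incseq (\<lambda>n. F n x) \<and> (\<lambda>n. F n x) \<longlonglongrightarrow> f x) \<and>
        (\<lambda>n. fs_norm X (F n)) \<longlonglongrightarrow> l \<and> l < \<infinity> \<longrightarrow>
        f \<in> fs_carrier X \<and>
        incseq (\<lambda>n. fs_norm X (F n)) \<and> (\<lambda>n. fs_norm X (F n)) \<longlonglongrightarrow> fs_norm X f)"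

definition associate_norm :: "'a measure \<Rightarrow> 'a fun_space \<Rightarrow> ('a \<Rightarrow> ereal) \<Rightarrow> ennreal" where
  "associate_norm M X g =
     (SUP f \<in> {f \<in> fs_carrier X. fs_norm X f \<le> 1}. \<integral>\<^sup>+x. e2ennreal \<bar>f x * g x\<bar> \<partial>M)"

definition associate_space :: "'a measure \<Rightarrow> 'a fun_space \<Rightarrow> 'a fun_space" where
  "associate_space M X =
     \<lparr>fs_carrier = {g \<in> borel_measurable M. associate_norm M X g < \<infinity>},
      fs_norm = associate_norm M X\<rparr>"

definition rearrangement :: "'a measure \<Rightarrow> ('a \<Rightarrow> ereal) \<Rightarrow> real \<Rightarrow> ennreal" where
  "rearrangement M f t =
     Inf {ennreal \<delta> | \<delta>. 0 < \<delta> \<and> emeasure M {x \<in> space M. ereal \<delta> < \<bar>f x\<bar>} \<le> ennreal t}"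

definition uri_space :: "'a measure \<Rightarrow> 'a fun_space \<Rightarrow> bool" where
  "uri_space M X \<longleftrightarrow>
     banach_function_space M X \<and>
     (\<forall>f\<in>borel_measurable M. \<forall>g\<in>fs_carrier X.
        (\<forall>t>0. (\<integral>\<^sup>+s\<in>{0<..<t}. rearrangement M f s \<partial>lborel)
                 \<le> (\<integral>\<^sup>+s\<in>{0<..<t}. rearrangement M g s \<partial>lborel)) \<longrightarrow>
        f \<in> fs_carrier X \<and> fs_norm X f \<le> fs_norm X g)"

definition nontrivial_space :: "'a measure \<Rightarrow> 'a fun_space \<Rightarrow> bool" where
  "nontrivial_space M X \<longleftrightarrow> (\<exists>f\<in>fs_carrier X. \<not> (AE x in M. f x = 0))"


section \<open>Down spaces and level functions\<close>

definition down_norm ::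
  "'a measure \<Rightarrow> 'a set set \<Rightarrow> 'a fun_space \<Rightarrow> ('a \<Rightarrow> ereal) \<Rightarrow> ennreal" where
  "down_norm M \<A> X f =
     (SUP g \<in> {g \<in> fs_carrier (associate_space M X) \<inter> core_decreasing M \<A>.
                fs_norm (associate_space M X) g \<le> 1}.
        \<integral>\<^sup>+x. e2ennreal (\<bar>f x\<bar> * g x) \<partial>M)"

definition down_space :: "'a measure \<Rightarrow> 'a set set \<Rightarrow> 'a fun_space \<Rightarrow> 'a fun_space" where
  "down_space M \<A> X =
     \<lparr>fs_carrier = {f \<in> borel_measurable M. down_norm M \<A> X f < \<infinity>},
      fs_norm = down_norm M \<A> X\<rparr>"

definition is_level_function ::
  "'a measure \<Rightarrow> 'a set set \<Rightarrow> ('a \<Rightarrow> ereal) \<Rightarrow> ('a \<Rightarrow> ereal) \<Rightarrow> bool" where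
  "is_level_function M \<A> f fo \<longleftrightarrow>
     fo \<in> core_decreasing M \<A> \<and>
     (\<forall>g\<in>core_decreasing M \<A>.
        (\<integral>\<^sup>+x. e2ennreal (fo x * g x) \<partial>M) =
        (SUP h \<in> {h \<in> core_decreasing M \<A>. \<forall>A\<in>\<A>.
                   (\<integral>\<^sup>+x\<in>A. e2ennreal (h x) \<partial>M) \<le> (\<integral>\<^sup>+x\<in>A. e2ennreal (g x) \<partial>M)}.
           \<integral>\<^sup>+x. e2ennreal (\<bar>f x\<bar> * h x) \<partial>M))"

text \<open>
  Level functions need not be unique when they are not integrable over the core sets. Those that
  lie in the space are unique almost everywhere once the associate space contains the indicators of
  the core sets, so the norm below is that of any level function lying in the space.
\<close>

definition level_space :: "'a measure \<Rightarrow> 'a set set \<Rightarrow> 'a fun_space \<Rightarrow> 'a fun_space" where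
  "level_space M \<A> X =
     \<lparr>fs_carrier = {f \<in> borel_measurable M. \<exists>fo\<in>fs_carrier X. is_level_function M \<A> f fo},
      fs_norm = (\<lambda>f. THE r. \<exists>fo\<in>fs_carrier X. is_level_function M \<A> f fo \<and> r = fs_norm X fo)\<rparr>"

end

theory Submission
  imports Defs
begin

text \<open>
  The down norm tests \<open>\<bar>f\<bar>\<close> against the core decreasing part of the unit ball of the associate
  space only. The theorem says that one may instead test one decreasing function, the level function
  of \<open>f\<close>, against the whole ball.

  The level function \<open>F\<close> of \<open>f \<ge> 0\<close> is the derivative of the least concave majorant of
  \<open>A \<mapsto> \<integral>\<^sub>A f\<close>, read as a function of the measure of \<open>A\<close>. It is built here from its level sets: the
  set \<open>{F \<ge> l}\<close> maximizes \<open>\<integral>\<^sub>D (f - l)\<close> among the down sets \<open>D\<close>, that is, the measurable sets closed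
  downwards in the order of the core. Maximality has two consequences, collected in
  \<open>level_majorant\<close>. Beyond \<open>{F \<ge> l}\<close> the density of \<open>f\<close> on any piece of the chain that follows is at
  most \<open>l\<close>, which gives \<open>\<integral>\<^sub>D f \<le> \<integral>\<^sub>D F\<close> for all \<open>D\<close>. Inside \<open>{F \<ge> l}\<close> the density of \<open>f\<close> on any final
  piece is at least \<open>l\<close>, so \<open>F\<close> is an increasing limit of step functions that lie below averages
  \<open>T f\<close> of \<open>f\<close> over the steps of finite chains.

  The first property yields \<open>\<integral> f w \<le> \<integral> F w\<close> for decreasing \<open>w\<close>, by the layer cake formula. The
  second one, since averaging is self-adjoint, bounds \<open>\<integral> F w\<close> by the supremum of \<open>\<integral> f (T w)\<close>; when
  \<open>w\<close> is decreasing, \<open>T w\<close> is again decreasing and its integrals over core sets do not exceed those of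
  \<open>w\<close>. Both together say that \<open>F\<close> is a level function.

  Averaging contracts \<open>X\<close>: by Jensen's inequality \<open>\<integral> (T f - c)\<^sub>+ \<le> \<integral> (f - c)\<^sub>+\<close> for every
  \<open>c \<ge> 0\<close>, which implies the domination of rearrangements in the definition of universal
  rearrangement invariance. By self-adjointness it contracts \<open>X'\<close>, and therefore so does passing from
  \<open>w\<close> to its level majorant \<open>W\<close>. If now \<open>G\<close> is any level function of \<open>f\<close> and \<open>w\<close> lies in the unit
  ball of \<open>X'\<close>, then \<open>\<integral> G w \<le> \<integral> G W = \<integral> F W\<close>, because both level functions pair in the same way
  with the decreasing \<open>W\<close>, and \<open>\<integral> F W\<close> is at most the supremum of \<open>\<integral> f (T W)\<close>, which the down norm
  of \<open>f\<close> bounds. The opposite inequality is immediate from the definitions, and so the norm of every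
  level function in \<open>X''\<close> is the down norm of \<open>f\<close>.

  For the second part one needs \<open>X'' = X\<close> under the Fatou property. Averaging reduces the norming
  functional of a step function to the span of finitely many indicators, where a finite-dimensional
  Hahn-Banach theorem suffices.
\<close>

section \<open>Layer cakes and rearrangements\<close>

lemma nn_integral_lborel_above_below:
  assumes "0 \<le> c"
  shows "(\<integral>\<^sup>+y. indicator {y. ennreal y < W} y * indicator {c<..} y \<partial>lborel) = W - ennreal c"
proof (cases W)
  case (real r)
  have eq: "{y. ennreal y < W} \<inter> {c<..} = {c<..<r}"
    using real assms by (auto simp: ennreal_less_iff)
  have "(\<integral>\<^sup>+y. indicator {y. ennreal y < W} y * indicator {c<..} y \<partial>lborel)
      = (\<integral>\<^sup>+y. indicator {c<..<r} y \<partial>lborel)"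
    by (intro nn_integral_cong) (simp add: eq flip: indicator_inter_arith)
  also have "\<dots> = W - ennreal c"
    using real assms by (cases "c \<le> r") (auto simp: ennreal_minus ennreal_neg)
  finally show ?thesis .
next
  case top
  have "emeasure lborel {c<..} = \<infinity>"
  proof (rule ccontr)
    assume "emeasure lborel {c<..} \<noteq> \<infinity>"
    then obtain r where r: "0 \<le> r" "emeasure lborel {c<..} = ennreal r"
      by (cases "emeasure lborel {c<..}") auto
    have "ennreal (r + 1) = emeasure lborel {c<..c + (r + 1)}" using r by simp
    also have "\<dots> \<le> emeasure lborel {c<..}" by (intro emeasure_mono) auto
    finally show False using r by (simp add: ennreal_le_iff del: ennreal_plus)
  qed
  then show ?thesis using top by (simp add: ennreal_top_minus)
qed

text \<open>
  Tonelli's theorem applied to the region below the graph of \<open>w\<close> and above the height \<open>c\<close>. The weight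
  \<open>f\<close> is kept as a factor, because a density \<open>f\<close> need not give a \<open>\<sigma>\<close>-finite measure.
\<close>

lemma (in sigma_finite_measure) nn_integral_layer_cake:
  fixes f w :: "'a \<Rightarrow> ennreal"
  assumes [measurable]: "f \<in> borel_measurable M" "w \<in> borel_measurable M" and c: "0 \<le> c"
  shows "(\<integral>\<^sup>+x. f x * (w x - ennreal c) \<partial>M)
       = (\<integral>\<^sup>+y. (\<integral>\<^sup>+x. f x * indicator {x. ennreal y < w x} x \<partial>M) * indicator {c<..} y \<partial>lborel)"
proof -
  interpret pair_sigma_finite M lborel ..
  have "(\<integral>\<^sup>+x. f x * (w x - ennreal c) \<partial>M)
      = (\<integral>\<^sup>+x. \<integral>\<^sup>+y. f x * (indicator {y. ennreal y < w x} y * indicator {c<..} y) \<partial>lborel \<partial>M)"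
    by (subst nn_integral_cmult) (simp_all add: nn_integral_lborel_above_below[OF c])
  also have "\<dots> = (\<integral>\<^sup>+x. \<integral>\<^sup>+y. f x * indicator {x. ennreal y < w x} x * indicator {c<..} y \<partial>lborel \<partial>M)"
    by (intro nn_integral_cong) (auto simp: indicator_def)
  also have "\<dots> = (\<integral>\<^sup>+y. \<integral>\<^sup>+x. f x * indicator {x. ennreal y < w x} x * indicator {c<..} y \<partial>M \<partial>lborel)"
    by (rule Fubini'[symmetric]) measurable
  also have "\<dots> = (\<integral>\<^sup>+y. (\<integral>\<^sup>+x. f x * indicator {x. ennreal y < w x} x \<partial>M) * indicator {c<..} y \<partial>lborel)"
    by (intro nn_integral_cong nn_integral_multc) measurable
  finally show ?thesis .
qed

definition distribution :: "'a measure \<Rightarrow> ('a \<Rightarrow> ereal) \<Rightarrow> real \<Rightarrow> ennreal" where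
  "distribution M f y = emeasure M {x \<in> space M. ereal y < \<bar>f x\<bar>}"

lemma distribution_antimono:
  assumes [measurable]: "f \<in> borel_measurable M" and "y \<le> z"
  shows "distribution M f z \<le> distribution M f y"
  unfolding distribution_def using assms(2)
  by (intro emeasure_mono) (auto intro: le_less_trans[of "ereal y" "ereal z"])

text \<open>
  The rearrangement is the generalized inverse of the distribution function. The implication from right
  to left needs the distribution function to be continuous from the right.
\<close>

lemma less_rearrangement_iff:
  assumes [measurable]: "f \<in> borel_measurable M" and y: "0 \<le> y"
  shows "ennreal y < rearrangement M f s \<longleftrightarrow> ennreal s < distribution M f y"
proof
  assume *: "ennreal y < rearrangement M f s"
  show "ennreal s < distribution M f y"
  proof (rule ccontr)
    assume "\<not> ennreal s < distribution M f y"
    then have le: "distribution M f \<delta> \<le> ennreal s" if "y < \<delta>" for \<delta>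
      using distribution_antimono[OF assms(1), of y \<delta>] that by simp
    have "rearrangement M f s \<le> ennreal y + ennreal e" if "0 < e" for e
    proof -
      have "rearrangement M f s \<le> ennreal (y + e)"
        unfolding rearrangement_def
        using le[of "y + e"] that y by (intro Inf_lower CollectI exI[of _ "y + e"]) (simp add: distribution_def)
      then show ?thesis using y that by simp
    qed
    then have "rearrangement M f s \<le> ennreal y"
      by (rule ennreal_le_epsilon)
    then show False using * by simp
  qed
next
  assume *: "ennreal s < distribution M f y"
  \<comment> \<open>right continuity: the superlevel set at \<open>y\<close> is the union of those at \<open>y + 1 / Suc n\<close>\<close>
  define S where "S n = {x \<in> space M. ereal (y + 1 / Suc n) < \<bar>f x\<bar>}" for n :: nat
  have "incseq S"
    unfolding S_def incseq_def
  proof safe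
    fix m n :: nat and x assume "m \<le> n" "ereal (y + 1 / Suc m) < \<bar>f x\<bar>"
    moreover from this have "ereal (y + 1 / Suc n) \<le> ereal (y + 1 / Suc m)" by (simp add: frac_le)
    ultimately show "ereal (y + 1 / Suc n) < \<bar>f x\<bar>" using order.strict_trans1 by blast
  qed
  moreover have "S n \<in> sets M" for n
    unfolding S_def by measurable
  ultimately have "(SUP n. emeasure M (S n)) = emeasure M (\<Union>n. S n)"
    by (intro SUP_emeasure_incseq) auto
  also have "(\<Union>n. S n) = {x \<in> space M. ereal y < \<bar>f x\<bar>}"
  proof (intro set_eqI iffI)
    fix x assume x: "x \<in> {x \<in> space M. ereal y < \<bar>f x\<bar>}"
    then obtain z where z: "ereal y < ereal z" "ereal z < \<bar>f x\<bar>"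
      using ereal_dense2 by blast
    then obtain n where "1 / Suc n < z - y"
      using nat_approx_posE[of "z - y"] by auto
    then have "y + 1 / Suc n \<le> z" by simp
    then have "ereal (y + 1 / Suc n) < \<bar>f x\<bar>"
      using z(2) by (meson ereal_less_eq(3) le_less_trans)
    then show "x \<in> (\<Union>n. S n)" using x by (auto simp: S_def)
  next
    fix x assume "x \<in> (\<Union>n. S n)"
    then obtain n where n: "x \<in> space M" "ereal (y + 1 / Suc n) < \<bar>f x\<bar>" by (auto simp: S_def)
    have "ereal y < ereal (y + 1 / Suc n)" by simp
    then show "x \<in> {x \<in> space M. ereal y < \<bar>f x\<bar>}" using n less_trans by blast
  qed
  finally have "ennreal s < (SUP n. emeasure M (S n))"
    using * by (simp add: distribution_def)
  then obtain n where n: "ennreal s < distribution M f (y + 1 / Suc n)"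
    by (auto simp: less_SUP_iff distribution_def S_def)
  have "ennreal (y + 1 / Suc n) \<le> rearrangement M f s"
    unfolding rearrangement_def
  proof (rule Inf_greatest)
    fix d assume "d \<in> {ennreal \<delta> | \<delta>. 0 < \<delta> \<and> emeasure M {x \<in> space M. ereal \<delta> < \<bar>f x\<bar>} \<le> ennreal s}"
    then obtain \<delta> where d: "d = ennreal \<delta>" "distribution M f \<delta> \<le> ennreal s"
      by (auto simp: distribution_def)
    have "y + 1 / Suc n \<le> \<delta>"
    proof (rule ccontr)
      assume "\<not> ?thesis"
      then have "distribution M f (y + 1 / Suc n) \<le> distribution M f \<delta>"
        by (intro distribution_antimono) auto
      then show False using n d(2) by (meson le_less_trans not_less)
    qed
    then show "ennreal (y + 1 / Suc n) \<le> d" using d by (simp add: ennreal_leI)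
  qed
  moreover have "ennreal y < ennreal (y + 1 / Suc n)"
    using y by (intro ennreal_lessI) (auto intro: add_nonneg_pos)
  ultimately show "ennreal y < rearrangement M f s" by simp
qed

lemma borel_measurable_rearrangement [measurable]:
  assumes "f \<in> borel_measurable M"
  shows "rearrangement M f \<in> borel_measurable borel"
proof (rule borel_measurableI_greater)
  fix c :: ennreal
  show "{s \<in> space borel. c < rearrangement M f s} \<in> sets borel"
  proof (cases c)
    case (real y)
    then have "{s. c < rearrangement M f s} = {s. ennreal s < distribution M f y}"
      using less_rearrangement_iff[OF assms] by auto
    then show ?thesis by simp
  qed simp
qed

text \<open>
  Slicing the region below the rearrangement horizontally instead of vertically
  turns integrals of rearrangements into integrals of distribution functions.
\<close>

lemma nn_integral_rearrangement:
  assumes f: "f \<in> borel_measurable M" and t: "0 < t"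
  shows "(\<integral>\<^sup>+s\<in>{0<..<t}. rearrangement M f s \<partial>lborel)
       = (\<integral>\<^sup>+y\<in>{0<..}. min (ennreal t) (distribution M f y) \<partial>lborel)"
proof -
  let ?S = "\<lambda>y. \<integral>\<^sup>+s. indicator {0<..<t} s * indicator {s. ennreal y < rearrangement M f s} s \<partial>lborel"
  have [measurable]: "rearrangement M f \<in> borel_measurable borel"
    using f by (rule borel_measurable_rearrangement)
  have "(\<integral>\<^sup>+s\<in>{0<..<t}. rearrangement M f s \<partial>lborel)
      = (\<integral>\<^sup>+s. indicator {0<..<t} s * (rearrangement M f s - ennreal 0) \<partial>lborel)"
    by (simp add: mult.commute)
  also have "\<dots> = (\<integral>\<^sup>+y. ?S y * indicator {0<..} y \<partial>lborel)"
    by (rule lborel.nn_integral_layer_cake) auto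
  also have "\<dots> = (\<integral>\<^sup>+y\<in>{0<..}. min (ennreal t) (distribution M f y) \<partial>lborel)"
  proof (rule nn_integral_cong)
    fix y :: real
    have "?S y = min (ennreal t) (distribution M f y)" if "0 < y"
    proof -
      have "?S y
          = (\<integral>\<^sup>+s. indicator {s. ennreal s < min (ennreal t) (distribution M f y)} s * indicator {0<..} s \<partial>lborel)"
        using that t
        by (intro nn_integral_cong) (auto simp: indicator_def less_rearrangement_iff[OF f] ennreal_less_iff)
      then show ?thesis using nn_integral_lborel_above_below[of 0 "min (ennreal t) (distribution M f y)"] by (simp del: min_less_iff_conj)
    qed
    then show "?S y * indicator {0<..} y = min (ennreal t) (distribution M f y) * indicator {0<..} y"
      by (auto simp: indicator_def)
  qed
  finally show ?thesis .
qed

abbreviation excess :: "'a measure \<Rightarrow> ('a \<Rightarrow> ereal) \<Rightarrow> real \<Rightarrow> ennreal" where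
  "excess M f c \<equiv> \<integral>\<^sup>+x. e2ennreal \<bar>f x\<bar> - ennreal c \<partial>M"

lemma (in sigma_finite_measure) nn_integral_excess:
  assumes [measurable]: "f \<in> borel_measurable M" and c: "0 \<le> c"
  shows "excess M f c = (\<integral>\<^sup>+y\<in>{c<..}. distribution M f y \<partial>lborel)"
proof -
  let ?S = "\<lambda>y. \<integral>\<^sup>+x. 1 * indicator {x. ennreal y < e2ennreal \<bar>f x\<bar>} x \<partial>M"
  have "excess M f c = (\<integral>\<^sup>+y. ?S y * indicator {c<..} y \<partial>lborel)"
    using nn_integral_layer_cake[of "\<lambda>_. 1" "\<lambda>x. e2ennreal \<bar>f x\<bar>" c] c by simp
  also have "\<dots> = (\<integral>\<^sup>+y\<in>{c<..}. distribution M f y \<partial>lborel)"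
  proof (rule nn_integral_cong)
    fix y :: real
    have "?S y = distribution M f y" if "c < y"
    proof -
      have iff: "ennreal y < e2ennreal \<bar>f x\<bar> \<longleftrightarrow> ereal y < \<bar>f x\<bar>" for x
        using that c by (cases "\<bar>f x\<bar>") (auto simp: ennreal_less_iff)
      have "?S y = (\<integral>\<^sup>+x. indicator {x \<in> space M. ereal y < \<bar>f x\<bar>} x \<partial>M)"
        by (intro nn_integral_cong) (auto simp: indicator_def iff)
      then show ?thesis by (simp add: distribution_def)
    qed
    then show "?S y * indicator {c<..} y = distribution M f y * indicator {c<..} y"
      by (auto simp: indicator_def)
  qed
  finally show ?thesis .
qed

text \<open>
  The formula behind this is \<open>\<integral>\<^sub>0\<^sup>t f\<^sup>* = inf\<^sub>c (c t + \<integral> (\<bar>f\<bar> - c)\<^sub>+)\<close>. Every \<open>c\<close> gives an upper bound for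
  \<open>f\<close>, and for \<open>g\<close> the infimum is attained at \<open>c = g\<^sup>*(t)\<close>, if this is finite. The excess integrals on the right are far
  easier to compare than rearrangements.
\<close>

lemma (in sigma_finite_measure) rearrangement_majorization:
  assumes [measurable]: "f \<in> borel_measurable M" "g \<in> borel_measurable M"
    and le: "\<And>c. 0 \<le> c \<Longrightarrow> excess M f c \<le> excess M g c"
    and t: "0 < t"
  shows "(\<integral>\<^sup>+s\<in>{0<..<t}. rearrangement M f s \<partial>lborel) \<le> (\<integral>\<^sup>+s\<in>{0<..<t}. rearrangement M g s \<partial>lborel)"
proof -
  let ?I = "\<lambda>h S. \<integral>\<^sup>+y\<in>S. h y \<partial>lborel" and ?m = "\<lambda>h y. min (ennreal t) (distribution M h y)"
  have dm[measurable]: "distribution M h \<in> borel_measurable borel" if "h \<in> borel_measurable M" for h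
  proof -
    have [measurable]: "h \<in> borel_measurable M" by (rule that)
    have "distribution M h y = (\<integral>\<^sup>+x. indicator {x. ereal y < \<bar>h x\<bar>} x \<partial>M)" for y
    proof -
      have "(\<integral>\<^sup>+x. indicator {x. ereal y < \<bar>h x\<bar>} x \<partial>M)
          = (\<integral>\<^sup>+x. indicator {x \<in> space M. ereal y < \<bar>h x\<bar>} x \<partial>M)"
        by (intro nn_integral_cong) (simp add: indicator_def)
      then show ?thesis by (simp add: distribution_def)
    qed
    then have "distribution M h = (\<lambda>y. \<integral>\<^sup>+x. indicator {x. ereal y < \<bar>h x\<bar>} x \<partial>M)"
      by (intro ext)
    then show ?thesis by simp
  qed
  have split: "?I h {0<..} = ?I h {0<..c} + ?I h {c<..}"
    if "h \<in> borel_measurable borel" "0 \<le> c" for c and h :: "real \<Rightarrow> ennreal"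
  proof -
    have "{0<..} = {0<..c} \<union> {c<..}" using that by auto
    then show ?thesis using that by (simp add: nn_integral_disjoint_pair disjoint_iff)
  qed
  have "?I (?m f) {0<..} \<le> ?I (?m g) {0<..}"
  proof (cases "rearrangement M g t")
    case top
    have "min (ennreal t) (distribution M g y) = ennreal t" if "0 < y" for y
      using less_rearrangement_iff[OF assms(2), of y t] that top by (simp add: min_def less_imp_le)
    then show ?thesis by (intro nn_integral_mono) (auto simp: indicator_def)
  next
    case (real c)
    \<comment> \<open>at \<open>c = g\<^sup>*(t)\<close> the minimum of \<open>t\<close> and the distribution function switches from \<open>t\<close> to the latter\<close>
    have below: "ennreal t < distribution M g y" if "0 < y" "y < c" for y
      using less_rearrangement_iff[OF assms(2), of y t] that real by (simp add: ennreal_less_iff)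
    have above: "distribution M g y \<le> ennreal t" if "c < y" for y
      using less_rearrangement_iff[OF assms(2), of y t] that real by (simp add: ennreal_less_iff not_less)
    have "?I (?m f) {0<..} = ?I (?m f) {0<..c} + ?I (?m f) {c<..}"
      using real by (intro split) auto
    also have "\<dots> \<le> ?I (?m g) {0<..c} + ?I (distribution M f) {c<..}"
    proof (rule add_mono)
      show "?I (?m f) {0<..c} \<le> ?I (?m g) {0<..c}"
        using AE_lborel_singleton[of c]
        by (intro nn_integral_mono_AE) (auto simp: indicator_def min_def dest: below elim!: eventually_mono)
    qed (auto intro!: nn_integral_mono simp: indicator_def)
    also have "?I (distribution M f) {c<..} \<le> ?I (distribution M g) {c<..}"
      using le[of c] real by (simp add: nn_integral_excess)
    also have "?I (distribution M g) {c<..} = ?I (?m g) {c<..}"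
      by (intro nn_integral_cong) (auto simp: indicator_def min_def dest: above intro: antisym)
    also have "?I (?m g) {0<..c} + ?I (?m g) {c<..} = ?I (?m g) {0<..}"
      using real by (intro split[symmetric]) auto
    finally show ?thesis by (simp add: add_left_mono)
  qed
  then show ?thesis using t by (simp add: nn_integral_rearrangement)
qed

section \<open>Averaging over disjoint blocks\<close>

text \<open>
  On a null set the infimum takes the place of the mean value. Integrals do not see the difference, but
  with this convention the average over any nonempty set of finite measure lies between the infimum and
  the supremum, so that averages of decreasing functions are decreasing at every point.
\<close>

definition block_avg :: "'a measure \<Rightarrow> ('a \<Rightarrow> ennreal) \<Rightarrow> 'a set \<Rightarrow> ennreal" where
  "block_avg M w B =
     (if emeasure M B = 0 then (INF x\<in>B. w x) else (\<integral>\<^sup>+x\<in>B. w x \<partial>M) / emeasure M B)"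

lemma block_avg_times_emeasure:
  assumes [measurable]: "B \<in> sets M" "w \<in> borel_measurable M" and fin: "emeasure M B < \<infinity>"
  shows "block_avg M w B * emeasure M B = (\<integral>\<^sup>+x\<in>B. w x \<partial>M)"
proof (cases "emeasure M B = 0")
  case True
  then show ?thesis by (simp add: nn_integral_null_set null_setsI)
next
  case False
  then show ?thesis
    using fin by (simp add: block_avg_def ennreal_divide_times)
qed

lemma le_block_avg:
  assumes [measurable]: "B \<in> sets M" "w \<in> borel_measurable M" and fin: "emeasure M B < \<infinity>"
    and le: "\<And>x. x \<in> B \<Longrightarrow> c \<le> w x"
  shows "c \<le> block_avg M w B"
proof (cases "emeasure M B = 0")
  case True
  then show ?thesis using le by (auto simp: block_avg_def intro: INF_greatest)
next
  case False
  have "c = (\<integral>\<^sup>+x\<in>B. c \<partial>M) / emeasure M B"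
    using False fin by (simp add: nn_integral_cmult_indicator ennreal_times_divide[symmetric] less_top)
  also have "\<dots> \<le> (\<integral>\<^sup>+x\<in>B. w x \<partial>M) / emeasure M B"
    using le by (intro divide_right_mono_ennreal nn_integral_mono) (auto simp: indicator_def)
  finally show ?thesis using False by (simp add: block_avg_def)
qed

lemma block_avg_le:
  assumes [measurable]: "B \<in> sets M" "w \<in> borel_measurable M" and fin: "emeasure M B < \<infinity>"
    and le: "\<And>x. x \<in> B \<Longrightarrow> w x \<le> c" and "B \<noteq> {}"
  shows "block_avg M w B \<le> c"
proof (cases "emeasure M B = 0")
  case True
  obtain x where "x \<in> B" using \<open>B \<noteq> {}\<close> by auto
  then show ?thesis using True le[of x] by (auto simp: block_avg_def intro: INF_lower2)
next
  case False
  have "(\<integral>\<^sup>+x\<in>B. w x \<partial>M) / emeasure M B \<le> (\<integral>\<^sup>+x\<in>B. c \<partial>M) / emeasure M B"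
    using le by (intro divide_right_mono_ennreal nn_integral_mono) (auto simp: indicator_def)
  also have "\<dots> = c"
    using False fin by (simp add: nn_integral_cmult_indicator ennreal_times_divide[symmetric] less_top)
  finally show ?thesis using False by (simp add: block_avg_def)
qed

lemma le_diff_add_ennreal: "a \<le> a - c + (c :: ennreal)"
proof (cases "c \<le> a")
  case True
  then show ?thesis by (simp add: diff_add_cancel_ennreal)
next
  case False
  then show ?thesis by (intro add_increasing) auto
qed

lemma block_avg_excess:
  assumes [measurable]: "B \<in> sets M" "w \<in> borel_measurable M" and fin: "emeasure M B < \<infinity>"
  shows "block_avg M w B - ennreal c \<le> block_avg M (\<lambda>x. w x - ennreal c) B"
proof (cases "emeasure M B = 0")
  case True
  then show ?thesis
    by (auto simp: block_avg_def intro!: INF_greatest ennreal_minus_mono INF_lower)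
next
  case False
  have "(\<integral>\<^sup>+x\<in>B. w x \<partial>M) \<le> (\<integral>\<^sup>+x\<in>B. (w x - ennreal c) + ennreal c \<partial>M)"
    by (intro nn_integral_mono mult_right_mono) (simp_all add: le_diff_add_ennreal)
  also have "\<dots> = (\<integral>\<^sup>+x\<in>B. w x - ennreal c \<partial>M) + ennreal c * emeasure M B"
    by (simp add: nn_integral_add nn_integral_cmult_indicator distrib_right)
  finally have "(\<integral>\<^sup>+x\<in>B. w x \<partial>M) / emeasure M B
      \<le> ((\<integral>\<^sup>+x\<in>B. w x - ennreal c \<partial>M) + ennreal c * emeasure M B) / emeasure M B"
    by (rule divide_right_mono_ennreal)
  also have "\<dots> = (\<integral>\<^sup>+x\<in>B. w x - ennreal c \<partial>M) / emeasure M B + ennreal c"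
    using False fin by (simp add: add_divide_distrib_ennreal ennreal_times_divide[symmetric] less_top)
  finally show ?thesis
    using False by (simp add: block_avg_def ennreal_minus_le_iff add.commute)
qed

definition block_family :: "'a measure \<Rightarrow> 'i set \<Rightarrow> ('i \<Rightarrow> 'a set) \<Rightarrow> bool" where
  "block_family M J B \<longleftrightarrow>
     finite J \<and> disjoint_family_on B J \<and> (\<forall>j\<in>J. B j \<in> sets M \<and> emeasure M (B j) < \<infinity>)"

definition averaging ::
  "'a measure \<Rightarrow> 'i set \<Rightarrow> ('i \<Rightarrow> 'a set) \<Rightarrow> ('a \<Rightarrow> ennreal) \<Rightarrow> 'a \<Rightarrow> ennreal" where
  "averaging M J B w x = (\<Sum>j\<in>J. block_avg M w (B j) * indicator (B j) x)"

lemma block_sum_eq: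
  fixes a :: "'i \<Rightarrow> 'b::semiring_1"
  assumes "finite J" "disjoint_family_on B J" "j \<in> J" "x \<in> B j"
  shows "(\<Sum>i\<in>J. a i * indicator (B i) x) = a j"
proof -
  have "(\<Sum>i\<in>J. a i * indicator (B i) x) = (\<Sum>i\<in>{j}. a i * indicator (B i) x)"
    using assms by (intro sum.mono_neutral_right) (auto simp: disjoint_family_on_def indicator_def)
  then show ?thesis using assms by simp
qed

lemma block_sum_eq_0:
  fixes a :: "'i \<Rightarrow> 'b::semiring_1"
  assumes "\<And>j. j \<in> J \<Longrightarrow> x \<notin> B j"
  shows "(\<Sum>i\<in>J. a i * indicator (B i) x) = 0"
  using assms by (intro sum.neutral) auto

lemma borel_measurable_averaging:
  assumes "block_family M J B"
  shows "averaging M J B w \<in> borel_measurable M"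
proof -
  have [measurable]: "j \<in> J \<Longrightarrow> B j \<in> sets M" for j using assms by (auto simp: block_family_def)
  show ?thesis unfolding averaging_def[abs_def] by measurable
qed

lemma nn_integral_mult_averaging:
  assumes J: "block_family M J B" and [measurable]: "k \<in> borel_measurable M"
  shows "(\<integral>\<^sup>+x. k x * averaging M J B w x \<partial>M) = (\<Sum>j\<in>J. block_avg M w (B j) * (\<integral>\<^sup>+x\<in>B j. k x \<partial>M))"
proof -
  have [measurable]: "j \<in> J \<Longrightarrow> B j \<in> sets M" for j using J by (auto simp: block_family_def)
  have "(\<integral>\<^sup>+x. k x * averaging M J B w x \<partial>M)
      = (\<integral>\<^sup>+x. (\<Sum>j\<in>J. block_avg M w (B j) * (k x * indicator (B j) x)) \<partial>M)"
    by (simp add: averaging_def sum_distrib_left mult_ac)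
  also have "\<dots> = (\<Sum>j\<in>J. block_avg M w (B j) * (\<integral>\<^sup>+x\<in>B j. k x \<partial>M))"
    by (subst nn_integral_sum) (auto simp: nn_integral_cmult)
  finally show ?thesis .
qed

lemma averaging_selfadjoint:
  assumes J: "block_family M J B" and [measurable]: "k \<in> borel_measurable M" "w \<in> borel_measurable M"
  shows "(\<integral>\<^sup>+x. k x * averaging M J B w x \<partial>M) = (\<integral>\<^sup>+x. averaging M J B k x * w x \<partial>M)"
proof -
  have "(\<Sum>j\<in>J. block_avg M w (B j) * (\<integral>\<^sup>+x\<in>B j. k x \<partial>M))
      = (\<Sum>j\<in>J. block_avg M k (B j) * (\<integral>\<^sup>+x\<in>B j. w x \<partial>M))"
    using J by (intro sum.cong refl)
      (auto simp: block_family_def mult_ac simp flip: block_avg_times_emeasure)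
  then show ?thesis
    using nn_integral_mult_averaging[OF J, of k w] nn_integral_mult_averaging[OF J, of w k]
    by (simp add: mult.commute)
qed

text \<open>
  Jensen's inequality on every block, followed by the fact that averaging does not increase integrals.
\<close>

lemma averaging_excess:
  assumes J: "block_family M J B" and [measurable]: "w \<in> borel_measurable M"
  shows "(\<integral>\<^sup>+x. averaging M J B w x - ennreal c \<partial>M) \<le> (\<integral>\<^sup>+x. w x - ennreal c \<partial>M)"
proof -
  have fin: "finite J" and dis: "disjoint_family_on B J"
    and B: "\<And>j. j \<in> J \<Longrightarrow> B j \<in> sets M" "\<And>j. j \<in> J \<Longrightarrow> emeasure M (B j) < \<infinity>"
    using J by (auto simp: block_family_def)
  let ?v = "\<lambda>x. w x - ennreal c"
  have "averaging M J B w x - ennreal c \<le> averaging M J B ?v x" for x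
  proof (cases "\<exists>j\<in>J. x \<in> B j")
    case True
    then obtain j where "j \<in> J" "x \<in> B j" by auto
    then show ?thesis
      unfolding averaging_def block_sum_eq[OF fin dis \<open>j \<in> J\<close> \<open>x \<in> B j\<close>]
      by (intro block_avg_excess B) auto
  next
    case False
    then show ?thesis by (simp add: averaging_def block_sum_eq_0)
  qed
  then have "(\<integral>\<^sup>+x. averaging M J B w x - ennreal c \<partial>M) \<le> (\<integral>\<^sup>+x. 1 * averaging M J B ?v x \<partial>M)"
    by (intro nn_integral_mono) simp
  also have "\<dots> = (\<integral>\<^sup>+x. averaging M J B (\<lambda>_. 1) x * ?v x \<partial>M)"
    by (rule averaging_selfadjoint[OF J]) auto
  also have "\<dots> \<le> (\<integral>\<^sup>+x. 1 * ?v x \<partial>M)"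
  proof (intro nn_integral_mono mult_right_mono)
    fix x
    show "averaging M J B (\<lambda>_. 1) x \<le> 1"
    proof (cases "\<exists>j\<in>J. x \<in> B j")
      case True
      then obtain j where "j \<in> J" "x \<in> B j" by auto
      then show ?thesis
        unfolding averaging_def block_sum_eq[OF fin dis \<open>j \<in> J\<close> \<open>x \<in> B j\<close>]
        by (intro block_avg_le B) auto
    next
      case False
      then show ?thesis by (simp add: averaging_def block_sum_eq_0)
    qed
  qed simp
  finally show ?thesis by simp
qed

section \<open>Rearrangement invariant spaces and their associate spaces\<close>

abbreviation abs_pairing :: "'a measure \<Rightarrow> ('a \<Rightarrow> ereal) \<Rightarrow> ('a \<Rightarrow> ennreal) \<Rightarrow> ennreal" where
  "abs_pairing M k w \<equiv> \<integral>\<^sup>+x. e2ennreal \<bar>k x\<bar> * w x \<partial>M"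

text \<open>
  The norm of the associate space, for functions with values in the extended nonnegative reals.
\<close>

definition dual_norm :: "'a measure \<Rightarrow> 'a fun_space \<Rightarrow> ('a \<Rightarrow> ennreal) \<Rightarrow> ennreal" where
  "dual_norm M X w =
     (SUP k \<in> {k \<in> fs_carrier X. fs_norm X k \<le> 1}. abs_pairing M k w)"

lemma e2ennreal_abs_mult: "e2ennreal \<bar>a * b\<bar> = e2ennreal \<bar>a\<bar> * e2ennreal \<bar>b\<bar>"
proof -
  have "\<bar>a\<bar> = enn2ereal (e2ennreal \<bar>a\<bar>)" "\<bar>b\<bar> = enn2ereal (e2ennreal \<bar>b\<bar>)"
    by (simp_all add: enn2ereal_e2ennreal)
  then have "\<bar>a * b\<bar> = enn2ereal (e2ennreal \<bar>a\<bar> * e2ennreal \<bar>b\<bar>)"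
    by (metis ereal_abs_mult times_ennreal.rep_eq)
  then show ?thesis by (simp only: e2ennreal_enn2ereal)
qed

lemma associate_norm_eq_dual_norm:
  "associate_norm M X g = dual_norm M X (\<lambda>x. e2ennreal \<bar>g x\<bar>)"
  by (simp add: associate_norm_def dual_norm_def e2ennreal_abs_mult)

lemma dual_norm_le:
  assumes "\<And>k. k \<in> fs_carrier X \<Longrightarrow> fs_norm X k \<le> 1 \<Longrightarrow> abs_pairing M k w \<le> r"
  shows "dual_norm M X w \<le> r"
  unfolding dual_norm_def using assms by (intro SUP_least) auto

lemma nn_integral_le_dual_norm:
  "k \<in> fs_carrier X \<Longrightarrow> fs_norm X k \<le> 1 \<Longrightarrow> abs_pairing M k w \<le> dual_norm M X w"
  unfolding dual_norm_def by (intro SUP_upper) auto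

lemma dual_norm_cong:
  "(\<And>x. x \<in> space M \<Longrightarrow> v x = w x) \<Longrightarrow> dual_norm M X v = dual_norm M X w"
  unfolding dual_norm_def by (intro SUP_cong refl nn_integral_cong) simp

locale uri_function_space = sigma_finite_measure M for M :: "'a measure" +
  fixes X :: "'a fun_space"
  assumes uri: "uri_space M X" and nontrivial: "nontrivial_space M X"
begin

lemma function_space: "banach_function_space M X"
  using uri by (simp add: uri_space_def)

lemma banach: "real_banach_space M X"
  using function_space by (simp add: banach_function_space_def)

lemma carrier_measurable: "k \<in> fs_carrier X \<Longrightarrow> k \<in> borel_measurable M"
  using banach unfolding real_banach_space_def by (elim conjE) (rule subsetD)

lemma carrier_finite: "k \<in> fs_carrier X \<Longrightarrow> AE x in M. \<bar>k x\<bar> \<noteq> \<infinity>"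
proof -
  have *: "\<forall>f\<in>fs_carrier X. AE x in M. \<bar>f x\<bar> \<noteq> \<infinity>"
    using banach unfolding real_banach_space_def by (elim conjE) assumption
  show "k \<in> fs_carrier X \<Longrightarrow> AE x in M. \<bar>k x\<bar> \<noteq> \<infinity>"
    using bspec[OF *, of k] by simp
qed

lemma norm_finite: "k \<in> fs_carrier X \<Longrightarrow> fs_norm X k < \<infinity>"
  and norm_eq_0_iff: "k \<in> fs_carrier X \<Longrightarrow> fs_norm X k = 0 \<longleftrightarrow> (AE x in M. k x = 0)"
proof -
  have *: "\<forall>f\<in>fs_carrier X. fs_norm X f < \<infinity> \<and> (fs_norm X f = 0 \<longleftrightarrow> (AE x in M. f x = 0))"
    using banach unfolding real_banach_space_def by (elim conjE) assumption
  show "k \<in> fs_carrier X \<Longrightarrow> fs_norm X k < \<infinity>"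
    and "k \<in> fs_carrier X \<Longrightarrow> fs_norm X k = 0 \<longleftrightarrow> (AE x in M. k x = 0)"
    using bspec[OF *, of k] by simp_all
qed

lemma zero_mem: "(\<lambda>x. 0) \<in> fs_carrier X"
  using banach unfolding real_banach_space_def by (elim conjE) assumption

lemma add_mem:
  assumes "k \<in> fs_carrier X" "l \<in> fs_carrier X"
  shows "(\<lambda>x. k x + l x) \<in> fs_carrier X" "fs_norm X (\<lambda>x. k x + l x) \<le> fs_norm X k + fs_norm X l"
proof -
  have *: "\<forall>f\<in>fs_carrier X. \<forall>g\<in>fs_carrier X. (\<lambda>x. f x + g x) \<in> fs_carrier X \<and>
        fs_norm X (\<lambda>x. f x + g x) \<le> fs_norm X f + fs_norm X g"
    using banach unfolding real_banach_space_def by (elim conjE) assumption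
  show "(\<lambda>x. k x + l x) \<in> fs_carrier X" "fs_norm X (\<lambda>x. k x + l x) \<le> fs_norm X k + fs_norm X l"
    using bspec[OF bspec[OF * assms(1)] assms(2)] by simp_all
qed

lemma scale_mem:
  assumes "k \<in> fs_carrier X"
  shows "(\<lambda>x. ereal c * k x) \<in> fs_carrier X" "fs_norm X (\<lambda>x. ereal c * k x) = ennreal \<bar>c\<bar> * fs_norm X k"
proof -
  have *: "\<forall>c::real. \<forall>f\<in>fs_carrier X. (\<lambda>x. ereal c * f x) \<in> fs_carrier X \<and>
        fs_norm X (\<lambda>x. ereal c * f x) = ennreal \<bar>c\<bar> * fs_norm X f"
    using banach unfolding real_banach_space_def by (elim conjE) assumption
  show "(\<lambda>x. ereal c * k x) \<in> fs_carrier X" "fs_norm X (\<lambda>x. ereal c * k x) = ennreal \<bar>c\<bar> * fs_norm X k"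
    using bspec[OF spec[OF *] assms] by simp_all
qed

text \<open>
  Rearrangement invariance restated for excess integrals, which Jensen's inequality controls.
\<close>

lemma majorized_mem:
  assumes f: "f \<in> borel_measurable M" and k: "k \<in> fs_carrier X"
    and le: "\<And>c. 0 \<le> c \<Longrightarrow> excess M f c \<le> excess M k c"
  shows "f \<in> fs_carrier X" "fs_norm X f \<le> fs_norm X k"
proof -
  have "\<forall>t>0. (\<integral>\<^sup>+s\<in>{0<..<t}. rearrangement M f s \<partial>lborel) \<le> (\<integral>\<^sup>+s\<in>{0<..<t}. rearrangement M k s \<partial>lborel)"
    using rearrangement_majorization[OF f carrier_measurable[OF k] le] by simp
  then show "f \<in> fs_carrier X" "fs_norm X f \<le> fs_norm X k"
    using uri f k unfolding uri_space_def by blast+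
qed

lemma dominated_mem:
  assumes f: "f \<in> borel_measurable M" and k: "k \<in> fs_carrier X" and le: "AE x in M. \<bar>f x\<bar> \<le> \<bar>k x\<bar>"
  shows "f \<in> fs_carrier X" "fs_norm X f \<le> fs_norm X k"
proof -
  have "excess M f c \<le> excess M k c" for c
    using le by (intro nn_integral_mono_AE) (auto elim!: eventually_mono intro!: ennreal_minus_mono e2ennreal_mono)
  then show "f \<in> fs_carrier X" "fs_norm X f \<le> fs_norm X k"
    using majorized_mem[OF f k] by auto
qed

lemma averaging_mem:
  assumes k: "k \<in> fs_carrier X" and J: "block_family M J B"
  defines "T \<equiv> averaging M J B (\<lambda>x. e2ennreal \<bar>k x\<bar>)"
  shows "(\<lambda>x. enn2ereal (T x)) \<in> fs_carrier X" "fs_norm X (\<lambda>x. enn2ereal (T x)) \<le> fs_norm X k"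
proof -
  have [measurable]: "k \<in> borel_measurable M" by (rule carrier_measurable[OF k])
  have [measurable]: "T \<in> borel_measurable M" unfolding T_def by (rule borel_measurable_averaging[OF J])
  have "excess M (\<lambda>x. enn2ereal (T x)) c \<le> excess M k c" for c
    using averaging_excess[OF J, of "\<lambda>x. e2ennreal \<bar>k x\<bar>" c] by (simp add: T_def)
  then show "(\<lambda>x. enn2ereal (T x)) \<in> fs_carrier X" "fs_norm X (\<lambda>x. enn2ereal (T x)) \<le> fs_norm X k"
    using majorized_mem[OF _ k, of "\<lambda>x. enn2ereal (T x)"] by auto
qed

text \<open>
  Self-adjointness moves the averaging onto the element of \<open>X\<close>, where it is a contraction.
\<close>

lemma dual_norm_averaging:
  assumes J: "block_family M J B" and [measurable]: "w \<in> borel_measurable M"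
  shows "dual_norm M X (averaging M J B w) \<le> dual_norm M X w"
proof (rule dual_norm_le)
  fix k assume k: "k \<in> fs_carrier X" "fs_norm X k \<le> 1"
  have [measurable]: "k \<in> borel_measurable M" by (rule carrier_measurable[OF k(1)])
  have "(\<integral>\<^sup>+x. e2ennreal \<bar>k x\<bar> * averaging M J B w x \<partial>M)
      = (\<integral>\<^sup>+x. averaging M J B (\<lambda>x. e2ennreal \<bar>k x\<bar>) x * w x \<partial>M)"
    by (rule averaging_selfadjoint[OF J]) auto
  also have "\<dots> \<le> dual_norm M X w"
    using nn_integral_le_dual_norm[OF averaging_mem(1)[OF k(1) J] order_trans[OF averaging_mem(2)[OF k(1) J] k(2)], where w = w]
    by simp
  finally show "(\<integral>\<^sup>+x. e2ennreal \<bar>k x\<bar> * averaging M J B w x \<partial>M) \<le> dual_norm M X w" .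
qed

lemma nn_integral_le_norm_times_dual_norm:
  assumes k: "k \<in> fs_carrier X" "fs_norm X k \<le> ennreal r" and r: "0 < r" and [measurable]: "w \<in> borel_measurable M"
  shows "abs_pairing M k w \<le> ennreal r * dual_norm M X w"
proof -
  have [measurable]: "k \<in> borel_measurable M" by (rule carrier_measurable[OF k(1)])
  let ?l = "\<lambda>x. ereal (1 / r) * k x"
  have "fs_norm X ?l = ennreal (1 / r) * fs_norm X k"
    using scale_mem(2)[OF k(1), of "1 / r"] r by simp
  also have "\<dots> \<le> ennreal (1 / r) * ennreal r" by (intro mult_left_mono k) simp
  also have "\<dots> = 1" using r by (simp flip: ennreal_mult)
  finally have "abs_pairing M ?l w \<le> dual_norm M X w"
    by (intro nn_integral_le_dual_norm scale_mem k)
  then have "ennreal r * abs_pairing M ?l w \<le> ennreal r * dual_norm M X w"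
    by (rule mult_left_mono) simp
  also have "ennreal r * abs_pairing M ?l w = (\<integral>\<^sup>+x. ennreal r * (e2ennreal \<bar>?l x\<bar> * w x) \<partial>M)"
    by (rule nn_integral_cmult[symmetric]) auto
  also have "\<dots> = abs_pairing M k w"
    using r by (intro nn_integral_cong)
      (simp add: e2ennreal_abs_mult mult.assoc[symmetric] ennreal_mult[symmetric])
  finally show ?thesis .
qed

text \<open>
  A nonzero element of \<open>X\<close> exceeds a positive constant on some set \<open>E\<close> of positive finite measure. A
  multiple of it that is at least \<open>C\<close> on \<open>E\<close> majorizes the indicator of \<open>G\<close> as soon as \<open>C \<ge> 1\<close> and
  \<open>C \<mu>(E) \<ge> \<mu>(G)\<close>.
\<close>

lemma indicator_mem:
  assumes [measurable]: "G \<in> sets M" and fin: "emeasure M G < \<infinity>"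
  shows "(\<lambda>x. enn2ereal (indicator G x)) \<in> fs_carrier X"
proof -
  obtain k where k: "k \<in> fs_carrier X" "\<not> (AE x in M. k x = 0)"
    using nontrivial by (auto simp: nontrivial_space_def)
  have [measurable]: "k \<in> borel_measurable M" by (rule carrier_measurable[OF k(1)])
  define S where "S n = {x \<in> space M. ereal (1 / Suc n) < \<bar>k x\<bar>}" for n :: nat
  have [measurable]: "S n \<in> sets M" for n unfolding S_def by measurable
  have "\<exists>n. emeasure M (S n) \<noteq> 0"
  proof (rule ccontr)
    assume "\<not> ?thesis"
    then have "AE x in M. \<forall>n. x \<notin> S n"
      by (auto simp: AE_all_countable intro!: AE_not_in null_setsI)
    then have "AE x in M. k x = 0"
    proof (rule AE_mp, intro AE_I2 impI)
      fix x assume x: "x \<in> space M" "\<forall>n. x \<notin> S n"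
      show "k x = 0"
      proof (rule ccontr)
        assume "k x \<noteq> 0"
        then have "ereal 0 < \<bar>k x\<bar>" by (cases "k x") auto
        then obtain z where z: "ereal 0 < ereal z" "ereal z < \<bar>k x\<bar>" using ereal_dense2 by blast
        then obtain n where "1 / Suc n < z" using nat_approx_posE[of z] by auto
        then have "ereal (1 / Suc n) < \<bar>k x\<bar>" using z(2) by (meson ereal_less(2) less_ereal.simps(1) less_trans)
        then show False using x by (auto simp: S_def)
      qed
    qed
    then show False using k by simp
  qed
  then obtain n where n: "emeasure M (S n) \<noteq> 0" by auto
  obtain E where E[measurable]: "E \<in> sets M" "E \<subseteq> S n" "emeasure M E < \<infinity>" "emeasure M E > 0"
  proof (cases "emeasure M (S n) = \<infinity>")
    case True
    show ?thesis
      using approx_PInf_emeasure_with_finite[of "S n" 0] True that by auto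
  next
    case False
    then show ?thesis using that[of "S n"] n by (auto simp: less_top zero_less_iff_neq_zero)
  qed
  define e where "e = enn2real (emeasure M E)"
  define h where "h = enn2real (emeasure M G)"
  have e: "emeasure M E = ennreal e" "0 < e"
    using E(3,4) by (auto simp: e_def less_top enn2real_positive_iff)
  have h: "emeasure M G = ennreal h" "0 \<le> h"
    using fin by (auto simp: h_def less_top)
  \<comment> \<open>with this \<open>C\<close>, \<open>(1 - c)\<^sub>+ h \<le> (C - c)\<^sub>+ e\<close> for all \<open>c \<ge> 0\<close>\<close>
  define C where "C = max 1 (h / e)"
  have C: "1 \<le> C" "h \<le> C * e" using e by (auto simp: C_def max_def field_simps)
  let ?l = "\<lambda>x. ereal (C * Suc n) * k x"
  have l: "?l \<in> fs_carrier X" by (rule scale_mem[OF k(1)])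
  show ?thesis
  proof (rule majorized_mem(1)[OF _ l])
    fix c :: real assume c: "0 \<le> c"
    have big: "ennreal C \<le> e2ennreal \<bar>?l x\<bar>" if "x \<in> E" for x
    proof -
      have "ereal (1 / Suc n) \<le> \<bar>k x\<bar>" using that E(2) by (auto simp: S_def)
      then have "e2ennreal (ereal (1 / Suc n)) \<le> e2ennreal \<bar>k x\<bar>" by (rule e2ennreal_mono)
      then have "ennreal (C * Suc n) * ennreal (1 / Suc n) \<le> ennreal (C * Suc n) * e2ennreal \<bar>k x\<bar>"
        by (intro mult_left_mono) auto
      moreover have "ennreal (C * Suc n) * ennreal (1 / Suc n) = ennreal C"
        using C by (subst ennreal_mult[symmetric]) auto
      moreover have "\<bar>C * Suc n\<bar> = C * Suc n" using C by simp
      ultimately show ?thesis by (simp only: e2ennreal_abs_mult abs_ereal.simps e2ennreal_ereal)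
    qed
    have "excess M (\<lambda>x. enn2ereal (indicator G x)) c
        = (\<integral>\<^sup>+x. ennreal (1 - c) * indicator G x \<partial>M)"
      using c by (intro nn_integral_cong) (auto simp: indicator_def simp flip: ennreal_minus)
    also have "\<dots> = ennreal (1 - c) * ennreal h"
      by (simp add: nn_integral_cmult_indicator h)
    also have "\<dots> \<le> ennreal (C - c) * ennreal e"
    proof (cases "c \<le> 1")
      case True
      have "(1 - c) * h \<le> (1 - c) * (C * e)" using C True by (intro mult_left_mono) auto
      also have "\<dots> = (C - c * C) * e" by (simp add: algebra_simps)
      also have "\<dots> \<le> (C - c) * e"
        using c C e mult_left_mono[of 1 C c] by (intro mult_right_mono) auto
      finally show ?thesis using True C h e by (simp flip: ennreal_mult add: ennreal_leI)
    qed (simp add: ennreal_neg)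
    also have "\<dots> = (\<integral>\<^sup>+x. ennreal (C - c) * indicator E x \<partial>M)"
      by (simp add: nn_integral_cmult_indicator e)
    also have "\<dots> \<le> excess M ?l c"
    proof (rule nn_integral_mono)
      fix x
      show "ennreal (C - c) * indicator E x \<le> e2ennreal \<bar>?l x\<bar> - ennreal c"
      proof (cases "x \<in> E")
        case True
        have "ennreal (C - c) = ennreal C - ennreal c" using c by (simp add: ennreal_minus)
        also have "\<dots> \<le> e2ennreal \<bar>?l x\<bar> - ennreal c" by (intro ennreal_minus_mono big True order_refl)
        finally show ?thesis using True by simp
      qed simp
    qed
    finally show "excess M (\<lambda>x. enn2ereal (indicator G x)) c
      \<le> excess M ?l c" .
  qed measurable
qed

text \<open>
  The average of \<open>\<bar>k\<bar>\<close> over \<open>G\<close>, placed on \<open>G\<close>, has norm at most \<open>\<parallel>k\<parallel>\<close>. It is a multiple of the indicator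
  of \<open>G\<close>, whose norm is positive, and this bounds the average.
\<close>

lemma dual_norm_indicator:
  assumes [measurable]: "G \<in> sets M" and fin: "emeasure M G < \<infinity>"
  shows "dual_norm M X (indicator G) < \<infinity>"
proof (cases "emeasure M G = 0")
  case True
  have "dual_norm M X (indicator G) \<le> 0"
    using True by (intro dual_norm_le) (simp add: nn_integral_null_set null_setsI)
  then show ?thesis by (simp add: le_less_trans)
next
  case False
  let ?g = "\<lambda>x. enn2ereal (indicator G x)"
  have g: "?g \<in> fs_carrier X" by (rule indicator_mem) fact+
  have "\<not> (AE x in M. ?g x = 0)"
  proof
    assume "AE x in M. ?g x = 0"
    then have "AE x in M. x \<notin> G"
      by (auto simp: indicator_def one_ennreal.rep_eq elim!: eventually_mono)
    then show False using False by (simp add: AE_iff_measurable[OF _ refl] sets.sets_into_space Int_absorb1 Int_def[symmetric])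
  qed
  then have pos: "fs_norm X ?g \<noteq> 0" using norm_eq_0_iff[OF g] by simp
  have J: "block_family M {()} (\<lambda>_. G)" using fin by (auto simp: block_family_def disjoint_family_on_def)
  have "dual_norm M X (indicator G) \<le> emeasure M G / fs_norm X ?g"
  proof (rule dual_norm_le)
    fix k assume k: "k \<in> fs_carrier X" "fs_norm X k \<le> 1"
    have [measurable]: "k \<in> borel_measurable M" by (rule carrier_measurable[OF k(1)])
    let ?w = "\<lambda>x. e2ennreal \<bar>k x\<bar>"
    let ?a = "block_avg M ?w G"
    have T: "averaging M {()} (\<lambda>_. G) ?w = (\<lambda>x. ?a * indicator G x)" by (simp add: averaging_def fun_eq_iff)
    have mem: "(\<lambda>x. enn2ereal (?a * indicator G x)) \<in> fs_carrier X"
      "fs_norm X (\<lambda>x. enn2ereal (?a * indicator G x)) \<le> 1"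
      using averaging_mem[OF k(1) J] k(2) unfolding T by auto
    have "?a \<noteq> \<infinity>"
    proof
      assume "?a = \<infinity>"
      then have "AE x in M. x \<notin> G"
        using carrier_finite[OF mem(1)] by (auto simp: indicator_def elim!: eventually_mono)
      then show False using False by (simp add: AE_iff_measurable[OF _ refl] sets.sets_into_space Int_absorb1 Int_def[symmetric])
    qed
    then obtain a where a: "?a = ennreal a" "0 \<le> a" by (cases ?a) auto
    have "(\<lambda>x. enn2ereal (?a * indicator G x)) = (\<lambda>x. ereal a * ?g x)"
      using a by (auto simp: fun_eq_iff indicator_def one_ennreal.rep_eq zero_ennreal.rep_eq)
    then have "ennreal a * fs_norm X ?g \<le> 1" using mem(2) scale_mem(2)[OF g, of a] a by simp
    then have "ennreal a \<le> 1 / fs_norm X ?g"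
    proof -
      obtain n where n: "fs_norm X ?g = ennreal n" "0 < n"
        using pos norm_finite[OF g] by (cases "fs_norm X ?g") (auto simp: less_le)
      have "ennreal (a * n) \<le> ennreal 1"
        using \<open>ennreal a * fs_norm X ?g \<le> 1\<close> n a by (simp add: ennreal_mult)
      then have "a \<le> 1 / n" using n by (simp add: field_simps)
      then show ?thesis using n by (simp add: n divide_ennreal ennreal_leI flip: ennreal_1)
    qed
    then have "?a * emeasure M G \<le> 1 / fs_norm X ?g * emeasure M G" by (simp add: a mult_right_mono)
    moreover have "?a * emeasure M G = (\<integral>\<^sup>+x. ?w x * indicator G x \<partial>M)"
      using fin by (intro block_avg_times_emeasure) auto
    ultimately show "(\<integral>\<^sup>+x. ?w x * indicator G x \<partial>M) \<le> emeasure M G / fs_norm X ?g"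
      by (simp add: ennreal_divide_times)
  qed
  also have "\<dots> < \<infinity>" using pos fin by (auto simp: ennreal_divide_eq_top_iff simp flip: less_top)
  finally show ?thesis .
qed

lemma set_integral_finite_if_dual_norm_finite:
  assumes [measurable]: "G \<in> sets M" "w \<in> borel_measurable M" and fin: "emeasure M G < \<infinity>"
    and w: "dual_norm M X w < \<infinity>"
  shows "(\<integral>\<^sup>+x\<in>G. w x \<partial>M) < \<infinity>"
proof -
  let ?g = "\<lambda>x. enn2ereal (indicator G x)"
  have g: "?g \<in> fs_carrier X" by (rule indicator_mem) fact+
  obtain b where b: "fs_norm X ?g = ennreal b" "0 \<le> b" using norm_finite[OF g] by (cases "fs_norm X ?g") auto
  have "abs_pairing M ?g w \<le> ennreal (b + 1) * dual_norm M X w"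
    using b by (intro nn_integral_le_norm_times_dual_norm g) (auto intro: ennreal_leI simp del: ennreal_plus)
  also have "\<dots> < \<infinity>" using w by (simp add: ennreal_mult_less_top del: ennreal_plus)
  finally show ?thesis by (simp add: mult.commute)
qed

end

section \<open>A finite-dimensional Hahn-Banach theorem\<close>

definition sublinear :: "(('i \<Rightarrow> real) \<Rightarrow> real) \<Rightarrow> bool" where
  "sublinear p \<longleftrightarrow>
     (\<forall>a b. p (\<lambda>i. a i + b i) \<le> p a + p b) \<and> (\<forall>c\<ge>0. \<forall>a. p (\<lambda>i. c * a i) = c * p a)"

text \<open>
  The largest sublinear functional below \<open>p\<close> that takes the value \<open>- p s\<close> at \<open>- s\<close>. Such a functional is
  odd along \<open>s\<close>.
\<close>

definition tilt :: "(('i \<Rightarrow> real) \<Rightarrow> real) \<Rightarrow> ('i \<Rightarrow> real) \<Rightarrow> ('i \<Rightarrow> real) \<Rightarrow> real" where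
  "tilt p s a = (INF t\<in>{0..}. p (\<lambda>i. a i + t * s i) - t * p s)"

lemma sublinear_add: "sublinear p \<Longrightarrow> p (\<lambda>i. a i + b i) \<le> p a + p b"
  and sublinear_scale: "sublinear p \<Longrightarrow> 0 \<le> c \<Longrightarrow> p (\<lambda>i. c * a i) = c * p a"
  by (auto simp: sublinear_def)

lemma sublinear_zero: "sublinear p \<Longrightarrow> p (\<lambda>i. 0) = 0"
  using sublinear_scale[of p 0] by simp

lemma sublinear_minus: "sublinear p \<Longrightarrow> - p a \<le> p (\<lambda>i. - a i)"
  using sublinear_add[of p a "\<lambda>i. - a i"] sublinear_zero[of p] by simp

lemma tilt_le_shift:
  assumes p: "sublinear p" and t: "0 \<le> t"
  shows "tilt p s a \<le> p (\<lambda>i. a i + t * s i) - t * p s"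
  unfolding tilt_def
proof (rule cINF_lower)
  show "bdd_below ((\<lambda>t. p (\<lambda>i. a i + t * s i) - t * p s) ` {0..})"
  proof (rule bdd_belowI2[where m = "- p (\<lambda>i. - a i)"])
    fix t :: real assume "t \<in> {0..}"
    then have "t * p s = p (\<lambda>i. t * s i)" using sublinear_scale[OF p] by simp
    also have "\<dots> = p (\<lambda>i. (a i + t * s i) + - a i)" by simp
    also have "\<dots> \<le> p (\<lambda>i. a i + t * s i) + p (\<lambda>i. - a i)" by (rule sublinear_add[OF p])
    finally show "- p (\<lambda>i. - a i) \<le> p (\<lambda>i. a i + t * s i) - t * p s" by simp
  qed
qed (use t in simp)

lemma tilt_greatest:
  assumes "\<And>t. 0 \<le> t \<Longrightarrow> r \<le> p (\<lambda>i. a i + t * s i) - t * p s"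
  shows "r \<le> tilt p s a"
  unfolding tilt_def using assms by (intro cINF_greatest) auto

lemma tilt_le: "sublinear p \<Longrightarrow> tilt p s a \<le> p a"
  using tilt_le_shift[of p 0 s a] by simp

lemma tilt_minus_le: "sublinear p \<Longrightarrow> tilt p s (\<lambda>i. - s i) \<le> - p s"
  using tilt_le_shift[of p 1 s "\<lambda>i. - s i"] sublinear_zero[of p] by simp

lemma sublinear_tilt:
  assumes p: "sublinear p"
  shows "sublinear (tilt p s)"
  unfolding sublinear_def
proof safe
  fix a b
  have *: "tilt p s (\<lambda>i. a i + b i) \<le> (p (\<lambda>i. a i + t * s i) - t * p s) + (p (\<lambda>i. b i + u * s i) - u * p s)"
    if "0 \<le> t" "0 \<le> u" for t u
  proof -
    have "tilt p s (\<lambda>i. a i + b i) \<le> p (\<lambda>i. a i + b i + (t + u) * s i) - (t + u) * p s"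
      using that by (intro tilt_le_shift p) simp
    also have "(\<lambda>i. a i + b i + (t + u) * s i) = (\<lambda>i. (a i + t * s i) + (b i + u * s i))"
      by (simp add: algebra_simps)
    also have "p \<dots> \<le> p (\<lambda>i. a i + t * s i) + p (\<lambda>i. b i + u * s i)" by (rule sublinear_add[OF p])
    finally show ?thesis by (simp add: algebra_simps)
  qed
  have "tilt p s (\<lambda>i. a i + b i) - (p (\<lambda>i. a i + t * s i) - t * p s) \<le> tilt p s b" if "0 \<le> t" for t
    by (rule tilt_greatest) (use *[OF that] in \<open>simp add: algebra_simps\<close>)
  then have "tilt p s (\<lambda>i. a i + b i) - tilt p s b \<le> tilt p s a"
    by (intro tilt_greatest) (simp add: algebra_simps)
  then show "tilt p s (\<lambda>i. a i + b i) \<le> tilt p s a + tilt p s b" by simp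
next
  fix c :: real and a assume c: "0 \<le> c"
  have le: "tilt p s (\<lambda>i. c * a i) \<le> c * tilt p s a" if c: "0 < c" for c a
  proof -
    have "tilt p s (\<lambda>i. c * a i) / c \<le> tilt p s a"
    proof (rule tilt_greatest)
      fix t :: real assume "0 \<le> t"
      then have "tilt p s (\<lambda>i. c * a i) \<le> p (\<lambda>i. c * a i + (c * t) * s i) - (c * t) * p s"
        using c by (intro tilt_le_shift p) simp
      also have "(\<lambda>i. c * a i + (c * t) * s i) = (\<lambda>i. c * (a i + t * s i))" by (simp add: algebra_simps)
      also have "p \<dots> = c * p (\<lambda>i. a i + t * s i)" using c by (intro sublinear_scale p) simp
      finally show "tilt p s (\<lambda>i. c * a i) / c \<le> p (\<lambda>i. a i + t * s i) - t * p s"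
        using c by (simp add: field_simps)
    qed
    then show ?thesis using c by (simp add: field_simps)
  qed
  show "tilt p s (\<lambda>i. c * a i) = c * tilt p s a"
  proof (cases "c = 0")
    case True
    have "tilt p s (\<lambda>i. 0) = 0"
    proof (rule antisym)
      show "tilt p s (\<lambda>i. 0) \<le> 0" using tilt_le[OF p, of s "\<lambda>i. 0"] sublinear_zero[OF p] by simp
      show "0 \<le> tilt p s (\<lambda>i. 0)" by (rule tilt_greatest) (simp add: sublinear_scale[OF p])
    qed
    then show ?thesis using True by simp
  next
    case False
    then have "0 < c" using c by simp
    have "c * tilt p s a = c * tilt p s (\<lambda>i. (1 / c) * (c * a i))" using False by simp
    also have "\<dots> \<le> c * ((1 / c) * tilt p s (\<lambda>i. c * a i))"
      using \<open>0 < c\<close> by (intro mult_left_mono le) auto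
    finally show ?thesis using le[OF \<open>0 < c\<close>, of a] False by simp
  qed
qed

text \<open>
  Tilting makes the functional odd along one more vector. Oddness along a vector survives when the
  functional is lowered further, since a sublinear functional always satisfies \<open>- q v \<le> q (- v)\<close>.
\<close>

lemma exists_odd_minorant:
  assumes "finite V" "sublinear p"
  shows "\<exists>q. sublinear q \<and> (\<forall>a. q a \<le> p a) \<and> (\<forall>v\<in>V. q (\<lambda>i. - v i) \<le> - q v)"
  using assms
proof (induction V rule: finite_induct)
  case empty
  then show ?case by auto
next
  case (insert v V)
  then obtain q where q: "sublinear q" "\<And>a. q a \<le> p a" "\<And>u. u \<in> V \<Longrightarrow> q (\<lambda>i. - u i) \<le> - q u" by auto
  have "tilt q v (\<lambda>i. - u i) \<le> - tilt q v u" if "u \<in> insert v V" for u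
    using that q(3)[of u] tilt_minus_le[OF q(1), of v] tilt_le[OF q(1), of v u]
      tilt_le[OF q(1), of v "\<lambda>i. - u i"] by fastforce
  then show ?case
    using sublinear_tilt[OF q(1), of v] tilt_le[OF q(1), of v] q(2) by (intro exI[of _ "tilt q v"]) (auto intro: order_trans)
qed

text \<open>
  First tilt along \<open>s\<close>, then along all coordinate vectors. A sublinear functional that is odd along a basis
  is linear, and its value at \<open>s\<close> cannot have dropped below \<open>p s\<close>.
\<close>

lemma finite_hahn_banach:
  assumes J: "finite J" and p: "sublinear p" and s: "\<And>i. i \<notin> J \<Longrightarrow> s i = 0"
  obtains l where "\<And>a. (\<And>i. i \<notin> J \<Longrightarrow> a i = 0) \<Longrightarrow> (\<Sum>j\<in>J. a j * l j) \<le> p a"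
    and "p s \<le> (\<Sum>j\<in>J. s j * l j)"
proof -
  define e where "e j = (\<lambda>i. if i = j then 1 else 0 :: real)" for j :: 'a
  obtain q where q: "sublinear q" "\<And>a. q a \<le> tilt p s a" "\<And>j. j \<in> J \<Longrightarrow> q (\<lambda>i. - e j i) \<le> - q (e j)"
    using exists_odd_minorant[OF _ sublinear_tilt[OF p], of "e ` J" s] J by auto
  have single: "q (\<lambda>i. c * e j i) \<le> c * q (e j)" if "j \<in> J" for c j
  proof (cases "0 \<le> c")
    case True
    then show ?thesis by (simp add: sublinear_scale[OF q(1)])
  next
    case False
    have "q (\<lambda>i. c * e j i) = q (\<lambda>i. (- c) * - e j i)" by simp
    also have "\<dots> = (- c) * q (\<lambda>i. - e j i)" using False by (intro sublinear_scale q(1)) simp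
    also have "\<dots> \<le> (- c) * - q (e j)" using False q(3)[OF that] by (intro mult_left_mono) auto
    finally show ?thesis by simp
  qed
  have le: "q a \<le> (\<Sum>j\<in>J. a j * q (e j))" if a: "\<And>i. i \<notin> J \<Longrightarrow> a i = 0" for a
  proof -
    have "q (\<lambda>i. \<Sum>j\<in>K. a j * e j i) \<le> (\<Sum>j\<in>K. a j * q (e j))" if "K \<subseteq> J" "finite K" for K
      using that(2,1)
    proof (induction K rule: finite_induct)
      case empty
      then show ?case by (simp add: sublinear_zero[OF q(1)])
    next
      case (insert j K)
      have "q (\<lambda>i. a j * e j i + (\<Sum>j\<in>K. a j * e j i)) \<le> q (\<lambda>i. a j * e j i) + q (\<lambda>i. \<Sum>j\<in>K. a j * e j i)"
        by (rule sublinear_add[OF q(1)])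
      then show ?case using insert single[of j "a j"] by simp
    qed
    from this[of J] J have "q (\<lambda>i. \<Sum>j\<in>J. a j * e j i) \<le> (\<Sum>j\<in>J. a j * q (e j))" by simp
    moreover have "(\<Sum>j\<in>J. a j * e j i) = a i" for i
      using J a[of i] by (cases "i \<in> J") (auto simp: e_def if_distrib[of "\<lambda>x. _ * x"] cong: if_cong)
    ultimately show ?thesis by simp
  qed
  have ge: "(\<Sum>j\<in>J. a j * q (e j)) \<le> q a" if a: "\<And>i. i \<notin> J \<Longrightarrow> a i = 0" for a
  proof -
    have "q (\<lambda>i. - a i) \<le> - (\<Sum>j\<in>J. a j * q (e j))"
      using le[of "\<lambda>i. - a i"] a by (simp add: sum_negf)
    then show ?thesis using sublinear_minus[OF q(1), of a] by simp
  qed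
  show thesis
  proof (rule that[of "\<lambda>j. q (e j)"])
    fix a :: "'a \<Rightarrow> real" assume "\<And>i. i \<notin> J \<Longrightarrow> a i = 0"
    then show "(\<Sum>j\<in>J. a j * q (e j)) \<le> p a"
      using ge[of a] q(2)[of a] tilt_le[OF p, of s a] by auto
  next
    have "q (\<lambda>i. - s i) \<le> - p s" using q(2)[of "\<lambda>i. - s i"] tilt_minus_le[OF p, of s] by simp
    then show "p s \<le> (\<Sum>j\<in>J. s j * q (e j))"
      using le[of s] s sublinear_minus[OF q(1), of s] by auto
  qed
qed

section \<open>The second associate space under the Fatou property\<close>

context uri_function_space
begin

lemma block_step_mem:
  assumes J: "block_family M J B"
  shows "(\<lambda>x. ereal (\<Sum>j\<in>J. a j * indicator (B j) x)) \<in> fs_carrier X"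
proof -
  have "(\<lambda>x. ereal (\<Sum>j\<in>K. a j * indicator (B j) x)) \<in> fs_carrier X" if "finite K" "K \<subseteq> J" for K
    using that
  proof (induction K rule: finite_induct)
    case empty
    then show ?case using zero_mem by (simp flip: zero_ereal_def)
  next
    case (insert j K)
    have "(\<lambda>x. enn2ereal (indicator (B j) x)) \<in> fs_carrier X"
      using insert J by (intro indicator_mem) (auto simp: block_family_def)
    then have "(\<lambda>x. ereal (a j) * enn2ereal (indicator (B j) x)) \<in> fs_carrier X" by (rule scale_mem)
    also have "(\<lambda>x. ereal (a j) * enn2ereal (indicator (B j) x)) = (\<lambda>x. ereal (a j * indicator (B j) x))"
      by (auto simp: fun_eq_iff indicator_def one_ennreal.rep_eq zero_ennreal.rep_eq simp flip: zero_ereal_def)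
    finally have "(\<lambda>x. ereal (a j * indicator (B j) x) + ereal (\<Sum>j\<in>K. a j * indicator (B j) x)) \<in> fs_carrier X"
      using insert by (intro add_mem) auto
    then show ?case unfolding sum.insert[OF insert(1,2)] by (simp only: plus_ereal.simps)
  qed
  then show ?thesis using J by (auto simp: block_family_def)
qed

text \<open>
  A functional that norms the step function on the span of the indicators of the blocks has the form
  \<open>a \<mapsto> \<Sum>\<^sub>j a\<^sub>j l\<^sub>j\<close>. The step function with values \<open>\<bar>l\<^sub>j\<bar> / \<mu>(B\<^sub>j)\<close> represents it on all of \<open>X\<close>, because
  replacing \<open>\<bar>k\<bar>\<close> by its block averages does not change the pairing and does not increase the norm.
\<close>

lemma norm_block_step_le:
  assumes J: "block_family M J B" and pos: "\<And>j. j \<in> J \<Longrightarrow> emeasure M (B j) \<noteq> 0"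
    and c: "\<And>j. j \<in> J \<Longrightarrow> 0 \<le> c j"
    and bound: "\<And>w. w \<in> borel_measurable M \<Longrightarrow> dual_norm M X w \<le> 1 \<Longrightarrow>
      (\<integral>\<^sup>+x. (\<Sum>j\<in>J. ennreal (c j) * indicator (B j) x) * w x \<partial>M) \<le> r"
  shows "fs_norm X (\<lambda>x. ereal (\<Sum>j\<in>J. c j * indicator (B j) x)) \<le> r"
proof -
  let ?s = "\<lambda>x. \<Sum>j\<in>J. ennreal (c j) * indicator (B j) x"
  have fin: "finite J" and dis: "disjoint_family_on B J"
    and B[measurable]: "\<And>j. j \<in> J \<Longrightarrow> B j \<in> sets M" and Bfin: "\<And>j. j \<in> J \<Longrightarrow> emeasure M (B j) < \<infinity>"
    using J by (auto simp: block_family_def)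
  define S where "S a = (\<lambda>x. ereal (\<Sum>j\<in>J. a j * indicator (B j) x))" for a :: "'b \<Rightarrow> real"
  have S: "S a \<in> fs_carrier X" for a unfolding S_def by (rule block_step_mem[OF J])
  define p where "p a = enn2real (fs_norm X (S a))" for a
  have p: "fs_norm X (S a) = ennreal (p a)" for a using norm_finite[OF S[of a]] by (simp add: p_def less_top)
  have p_nonneg: "0 \<le> p a" for a by (simp add: p_def)
  have "sublinear p"
    unfolding sublinear_def
  proof safe
    fix a b
    have "S (\<lambda>i. a i + b i) = (\<lambda>x. S a x + S b x)" by (simp add: S_def fun_eq_iff distrib_right sum.distrib)
    then have "ennreal (p (\<lambda>i. a i + b i)) \<le> ennreal (p a) + ennreal (p b)"
      using add_mem(2)[OF S[of a] S[of b]] by (simp only: p[symmetric])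
    then show "p (\<lambda>i. a i + b i) \<le> p a + p b"
      using p_nonneg by (simp add: ennreal_plus[symmetric] ennreal_le_iff del: ennreal_plus)
  next
    fix t :: real and a assume t: "0 \<le> t"
    have "S (\<lambda>i. t * a i) = (\<lambda>x. ereal t * S a x)" by (simp add: S_def fun_eq_iff sum_distrib_left mult.assoc)
    then have "ennreal (p (\<lambda>i. t * a i)) = ennreal t * ennreal (p a)"
      using scale_mem(2)[OF S[of a], of t] t by (simp only: p[symmetric] abs_of_nonneg)
    also have "\<dots> = ennreal (t * p a)" using t p_nonneg by (simp add: ennreal_mult)
    finally show "p (\<lambda>i. t * a i) = t * p a" using p_nonneg t by (simp add: ennreal_inj)
  qed
  define s where "s j = (if j \<in> J then c j else 0)" for j
  have Ss: "S s = (\<lambda>x. ereal (\<Sum>j\<in>J. c j * indicator (B j) x))" by (simp add: S_def s_def)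
  obtain l where l: "\<And>a. (\<And>i. i \<notin> J \<Longrightarrow> a i = 0) \<Longrightarrow> (\<Sum>j\<in>J. a j * l j) \<le> p a" "p s \<le> (\<Sum>j\<in>J. s j * l j)"
    using finite_hahn_banach[OF fin \<open>sublinear p\<close>, of s] by (auto simp: s_def)
  define m where "m j = enn2real (emeasure M (B j))" for j
  have m: "emeasure M (B j) = ennreal (m j)" "0 < m j" if "j \<in> J" for j
    using Bfin[OF that] pos[OF that] by (auto simp: m_def less_top enn2real_positive_iff zero_less_iff_neq_zero)
  \<comment> \<open>the density of the functional with respect to the measure\<close>
  define g where "g x = (\<Sum>j\<in>J. ennreal (\<bar>l j\<bar> / m j) * indicator (B j) x)" for x
  have g[measurable]: "g \<in> borel_measurable M" unfolding g_def[abs_def] by measurable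
  have int_g: "(\<integral>\<^sup>+x. w x * g x \<partial>M) = (\<Sum>j\<in>J. ennreal (\<bar>l j\<bar> / m j) * (\<integral>\<^sup>+x\<in>B j. w x \<partial>M))"
    if [measurable]: "w \<in> borel_measurable M" for w
  proof -
    have "(\<integral>\<^sup>+x. w x * g x \<partial>M) = (\<integral>\<^sup>+x. (\<Sum>j\<in>J. ennreal (\<bar>l j\<bar> / m j) * (w x * indicator (B j) x)) \<partial>M)"
      by (simp add: g_def sum_distrib_left mult_ac)
    also have "\<dots> = (\<Sum>j\<in>J. ennreal (\<bar>l j\<bar> / m j) * (\<integral>\<^sup>+x\<in>B j. w x \<partial>M))"
      by (subst nn_integral_sum) (auto simp: nn_integral_cmult)
    finally show ?thesis .
  qed
  have "dual_norm M X g \<le> 1"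
  proof (rule dual_norm_le)
    fix k assume k: "k \<in> fs_carrier X" "fs_norm X k \<le> 1"
    have [measurable]: "k \<in> borel_measurable M" by (rule carrier_measurable[OF k(1)])
    let ?w = "\<lambda>x. e2ennreal \<bar>k x\<bar>"
    have "(\<integral>\<^sup>+x\<in>B j. ?w x \<partial>M) < \<infinity>" if "j \<in> J" for j
      using nn_integral_le_dual_norm[OF k, of M "indicator (B j)"] dual_norm_indicator[OF B[OF that] Bfin[OF that]]
      by (rule le_less_trans)
    then have "\<exists>\<alpha>. \<forall>j\<in>J. 0 \<le> \<alpha> j \<and> (\<integral>\<^sup>+x\<in>B j. ?w x \<partial>M) = ennreal (\<alpha> j)"
      by (intro exI[of _ "\<lambda>j. enn2real (\<integral>\<^sup>+x\<in>B j. ?w x \<partial>M)"]) (auto simp: less_top)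
    then obtain \<alpha> where \<alpha>: "\<And>j. j \<in> J \<Longrightarrow> 0 \<le> \<alpha> j" "\<And>j. j \<in> J \<Longrightarrow> (\<integral>\<^sup>+x\<in>B j. ?w x \<partial>M) = ennreal (\<alpha> j)"
      by auto
    \<comment> \<open>the block averages of \<open>\<bar>k\<bar>\<close>, with signs that align them with the functional\<close>
    define a where "a j = (if j \<in> J then sgn (l j) * (\<alpha> j / m j) else 0)" for j
    let ?T = "averaging M J B ?w"
    have "(\<integral>\<^sup>+x. ?w x * g x \<partial>M) = (\<Sum>j\<in>J. ennreal (\<bar>l j\<bar> / m j * \<alpha> j))"
      unfolding int_g[of ?w, simplified]
    proof (rule sum.cong)
      fix j assume j: "j \<in> J"
      have "0 \<le> \<bar>l j\<bar> / m j" using m[OF j] by simp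
      then show "ennreal (\<bar>l j\<bar> / m j) * (\<integral>\<^sup>+x\<in>B j. ?w x \<partial>M) = ennreal (\<bar>l j\<bar> / m j * \<alpha> j)"
        using \<alpha>[OF j] by (simp only: ennreal_mult)
    qed simp
    also have "\<dots> = ennreal (\<Sum>j\<in>J. \<bar>l j\<bar> / m j * \<alpha> j)"
      using \<alpha> m by (intro sum_ennreal) (auto intro!: mult_nonneg_nonneg divide_nonneg_pos)
    also have "(\<Sum>j\<in>J. \<bar>l j\<bar> / m j * \<alpha> j) = (\<Sum>j\<in>J. a j * l j)"
      by (intro sum.cong) (auto simp: a_def abs_sgn mult_ac)
    also have "ennreal \<dots> \<le> ennreal (p a)" by (intro ennreal_leI l) (simp add: a_def)
    also have "\<dots> \<le> fs_norm X (\<lambda>x. enn2ereal (?T x))"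
      unfolding p[symmetric]
    proof (rule dominated_mem(2)[OF _ averaging_mem(1)[OF k(1) J]])
      show "S a \<in> borel_measurable M" by (rule carrier_measurable[OF S])
      show "AE x in M. \<bar>S a x\<bar> \<le> \<bar>enn2ereal (?T x)\<bar>"
      proof (rule AE_I2)
        fix x
        show "\<bar>S a x\<bar> \<le> \<bar>enn2ereal (?T x)\<bar>"
        proof (cases "\<exists>j\<in>J. x \<in> B j")
          case True
          then obtain j where j: "j \<in> J" "x \<in> B j" by auto
          have "?T x = ennreal (\<alpha> j / m j)"
            unfolding averaging_def block_sum_eq[OF fin dis j]
            using m[OF j(1)] \<alpha>[OF j(1)] by (simp add: block_avg_def divide_ennreal)
          moreover have "S a x = ereal (a j)" unfolding S_def block_sum_eq[OF fin dis j] ..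
          moreover have "\<bar>a j\<bar> \<le> \<alpha> j / m j"
            using j m[OF j(1)] \<alpha>[OF j(1)] by (simp add: a_def abs_mult abs_sgn_eq)
          ultimately show ?thesis using m[OF j(1)] \<alpha>[OF j(1)] by simp
        next
          case False
          then have "S a x = 0" by (simp add: S_def block_sum_eq_0 flip: zero_ereal_def)
          then show ?thesis by simp
        qed
      qed
    qed
    also have "\<dots> \<le> 1" using averaging_mem(2)[OF k(1) J] k(2) by (rule order_trans)
    finally show "(\<integral>\<^sup>+x. ?w x * g x \<partial>M) \<le> 1" .
  qed
  have "fs_norm X (S s) = ennreal (p s)" by (rule p)
  also have "\<dots> \<le> ennreal (\<Sum>j\<in>J. c j * \<bar>l j\<bar>)"
  proof (rule ennreal_leI)
    have "(\<Sum>j\<in>J. s j * l j) \<le> (\<Sum>j\<in>J. c j * \<bar>l j\<bar>)"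
      using c by (intro sum_mono) (auto simp: s_def intro!: mult_left_mono)
    then show "p s \<le> (\<Sum>j\<in>J. c j * \<bar>l j\<bar>)" using l(2) by simp
  qed
  also have "\<dots> = (\<integral>\<^sup>+x. ?s x * g x \<partial>M)"
  proof -
    have "(\<integral>\<^sup>+x. ?s x * g x \<partial>M)
        = (\<Sum>j\<in>J. ennreal (\<bar>l j\<bar> / m j) * (\<integral>\<^sup>+x\<in>B j. ?s x \<partial>M))"
      by (rule int_g) measurable
    also have "\<dots> = (\<Sum>j\<in>J. ennreal (c j * \<bar>l j\<bar>))"
    proof (rule sum.cong)
      fix j assume j: "j \<in> J"
      have "(\<integral>\<^sup>+x\<in>B j. ?s x \<partial>M) = (\<integral>\<^sup>+x. ennreal (c j) * indicator (B j) x \<partial>M)"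
        using block_sum_eq[OF fin dis j, of _ "\<lambda>j. ennreal (c j)"]
        by (intro nn_integral_cong) (auto simp: indicator_def)
      also have "\<dots> = ennreal (c j) * ennreal (m j)" using j by (simp add: nn_integral_cmult_indicator m)
      finally show "ennreal (\<bar>l j\<bar> / m j) * (\<integral>\<^sup>+x\<in>B j. ?s x \<partial>M)
          = ennreal (c j * \<bar>l j\<bar>)"
        using c[OF j] m[OF j] by (simp add: ennreal_mult[symmetric] less_imp_le)
    qed simp
    also have "\<dots> = ennreal (\<Sum>j\<in>J. c j * \<bar>l j\<bar>)" using c by (intro sum_ennreal) auto
    finally show ?thesis ..
  qed
  also have "\<dots> \<le> r" by (rule bound[OF g]) fact
  finally show ?thesis by (simp add: Ss)
qed

text \<open>
  A nonnegative measurable function is the increasing limit of simple functions supported on sets of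
  finite measure. Their norms are controlled by duality, and the Fatou property passes to the limit.
\<close>

lemma fatou_norm_le:
  assumes fatou: "fatou_property M X" and [measurable]: "f \<in> borel_measurable M"
    and bound: "\<And>w. w \<in> borel_measurable M \<Longrightarrow> dual_norm M X w \<le> 1 \<Longrightarrow> (\<integral>\<^sup>+x. f x * w x \<partial>M) \<le> r"
    and r: "r < \<infinity>"
  shows "(\<lambda>x. enn2ereal (f x)) \<in> fs_carrier X" "fs_norm X (\<lambda>x. enn2ereal (f x)) \<le> r"
proof -
  obtain F where F: "\<And>n. simple_function M (F n)" "incseq F" "\<And>n x. F n x < top" "\<And>x. (SUP n. F n x) = f x"
    using borel_measurable_implies_simple_function_sequence'[OF assms(2)] by blast
  obtain A where A: "range A \<subseteq> sets M" "(\<Union>n. A n) = space M" "\<And>n. emeasure M (A n) \<noteq> \<infinity>" "incseq A"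
    using sigma_finite_incseq by blast
  have [measurable]: "A n \<in> sets M" "F n \<in> borel_measurable M" for n
    using A(1) borel_measurable_simple_function[OF F(1)] by auto
  define s where "s n x = F n x * indicator (A n) x" for n x
  have [measurable]: "s n \<in> borel_measurable M" for n unfolding s_def[abs_def] by measurable
  have inc: "incseq (\<lambda>n. s n x)" for x
  proof (rule incseq_SucI)
    fix n
    have "F n x \<le> F (Suc n) x" "A n \<subseteq> A (Suc n)"
      using F(2) A(4) by (auto simp: incseq_Suc_iff le_fun_def)
    then show "s n x \<le> s (Suc n) x"
      unfolding s_def by (intro mult_mono) (auto simp: indicator_def)
  qed
  have lim: "(\<lambda>n. s n x) \<longlonglongrightarrow> f x" if x: "x \<in> space M" for x
  proof -
    obtain N where N: "x \<in> A N" using A(2) x by auto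
    have "(\<lambda>n. F n x) \<longlonglongrightarrow> f x"
      using LIMSEQ_SUP[of "\<lambda>n. F n x"] F(2,4) by (auto simp: incseq_def le_fun_def)
    moreover have "\<forall>\<^sub>F n in sequentially. F n x = s n x"
      using eventually_ge_at_top[of N]
    proof (rule eventually_mono)
      fix n assume "N \<le> n"
      then have "x \<in> A n" using N A(4) by (auto simp: incseq_def)
      then show "F n x = s n x" by (simp add: s_def)
    qed
    ultimately show ?thesis by (rule Lim_transform_eventually)
  qed
  have s_le: "s n x \<le> f x" for n x
    using F(4)[of x] SUP_upper[of n UNIV "\<lambda>n. F n x"] by (auto simp: s_def indicator_def)
  have step: "(\<lambda>x. enn2ereal (s n x)) \<in> fs_carrier X \<and> fs_norm X (\<lambda>x. enn2ereal (s n x)) \<le> r" for n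
  proof -
    define B where "B y = F n -` {y} \<inter> A n" for y
    \<comment> \<open>null blocks are dropped, since the representing density divides by the measure of the block\<close>
    define J where "J = {y \<in> F n ` space M. emeasure M (B y) \<noteq> 0}"
    have B[measurable]: "B y \<in> sets M" for y
    proof -
      have "B y = (F n -` {y} \<inter> space M) \<inter> A n" using sets.sets_into_space[of "A n" M] by (auto simp: B_def)
      then show ?thesis by simp
    qed
    have finR: "finite (F n ` space M)" using F(1) by (simp add: simple_function_def)
    have J: "block_family M J B"
      unfolding block_family_def
    proof (intro conjI ballI)
      show "finite J" using finR by (simp add: J_def)
      show "disjoint_family_on B J" by (auto simp: disjoint_family_on_def B_def)
      fix y
      have "emeasure M (B y) \<le> emeasure M (A n)" by (intro emeasure_mono) (auto simp: B_def)
      then show "emeasure M (B y) < \<infinity>" using A(3)[of n] by (auto simp: less_top top_unique)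
    qed (rule B)
    define c where "c y = enn2real y" for y
    let ?T = "\<lambda>x. \<Sum>y\<in>J. ennreal (c y) * indicator (B y) x"
    have c: "0 \<le> c y" for y by (simp add: c_def)
    have ae: "AE x in M. s n x = ?T x"
    proof -
      have "AE x in M. \<forall>y\<in>F n ` space M - J. x \<notin> B y"
        using finR by (intro AE_finite_allI) (auto simp: J_def intro!: AE_not_in null_setsI)
      then show ?thesis
      proof (rule AE_mp, intro AE_I2 impI)
        fix x assume x: "x \<in> space M" "\<forall>y\<in>F n ` space M - J. x \<notin> B y"
        show "s n x = ?T x"
        proof (cases "x \<in> A n")
          case True
          then have "x \<in> B (F n x)" "F n x \<in> J" using x by (auto simp: B_def)
          then show ?thesis
            using J True F(3)[of n x] block_sum_eq[of J B "F n x" x "\<lambda>y. ennreal (c y)"]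
            by (auto simp: block_family_def s_def c_def)
        next
          case False
          then show ?thesis by (subst block_sum_eq_0) (auto simp: s_def B_def)
        qed
      qed
    qed
    let ?S = "\<lambda>x. ereal (\<Sum>y\<in>J. c y * indicator (B y) x)"
    have S: "?S x = enn2ereal (?T x)" for x
    proof -
      have "?T x = (\<Sum>y\<in>J. ennreal (c y * indicator (B y) x))"
        by (intro sum.cong) (auto simp: indicator_def)
      also have "\<dots> = ennreal (\<Sum>y\<in>J. c y * indicator (B y) x)" using c by (intro sum_ennreal) auto
      finally have "?T x = ennreal (\<Sum>y\<in>J. c y * indicator (B y) x)" .
      moreover have "0 \<le> (\<Sum>y\<in>J. c y * indicator (B y) x)" using c by (intro sum_nonneg) auto
      ultimately show ?thesis by (simp only: enn2ereal_ennreal)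
    qed
    have "fs_norm X ?S \<le> r"
    proof (rule norm_block_step_le[OF J _ c])
      fix w :: "'a \<Rightarrow> ennreal" assume w[measurable]: "w \<in> borel_measurable M" and w1: "dual_norm M X w \<le> 1"
      have "(\<integral>\<^sup>+x. ?T x * w x \<partial>M) \<le> (\<integral>\<^sup>+x. f x * w x \<partial>M)"
      proof (rule nn_integral_mono_AE, rule AE_mp[OF ae], intro AE_I2 impI)
        fix x assume "s n x = ?T x"
        then show "?T x * w x \<le> f x * w x"
          using s_le[of n x] by (intro mult_right_mono) simp_all
      qed
      then show "(\<integral>\<^sup>+x. ?T x * w x \<partial>M) \<le> r"
        using bound[OF w w1] by (rule order_trans)
    qed (simp add: J_def)
    moreover have dom: "AE x in M. \<bar>enn2ereal (s n x)\<bar> \<le> \<bar>?S x\<bar>"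
      by (rule AE_mp[OF ae], intro AE_I2 impI) (simp only: S order_refl)
    have "(\<lambda>x. enn2ereal (s n x)) \<in> borel_measurable M" by measurable
    from dominated_mem[OF this block_step_mem[OF J, of c] dom]
    have "(\<lambda>x. enn2ereal (s n x)) \<in> fs_carrier X" "fs_norm X (\<lambda>x. enn2ereal (s n x)) \<le> fs_norm X ?S" .
    ultimately show ?thesis by (blast intro: order_trans)
  qed
  let ?l = "SUP n. fs_norm X (\<lambda>x. enn2ereal (s n x))"
  have mono: "incseq (\<lambda>n. fs_norm X (\<lambda>x. enn2ereal (s n x)))"
  proof (rule incseq_SucI)
    fix n
    show "fs_norm X (\<lambda>x. enn2ereal (s n x)) \<le> fs_norm X (\<lambda>x. enn2ereal (s (Suc n) x))"
    proof (rule dominated_mem(2))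
      show "AE x in M. \<bar>enn2ereal (s n x)\<bar> \<le> \<bar>enn2ereal (s (Suc n) x)\<bar>"
        using inc by (intro AE_I2) (simp add: incseq_Suc_iff less_eq_ennreal.rep_eq[symmetric])
      show "(\<lambda>x. enn2ereal (s (Suc n) x)) \<in> fs_carrier X" using step by blast
    qed measurable
  qed
  have l: "?l \<le> r" using step by (auto intro: SUP_least)
  have "(\<lambda>x. enn2ereal (f x)) \<in> fs_carrier X \<and> incseq (\<lambda>n. fs_norm X (\<lambda>x. enn2ereal (s n x)))
      \<and> (\<lambda>n. fs_norm X (\<lambda>x. enn2ereal (s n x))) \<longlonglongrightarrow> fs_norm X (\<lambda>x. enn2ereal (f x))"
  proof (rule fatou[unfolded fatou_property_def, rule_format, of "\<lambda>n x. enn2ereal (s n x)" "\<lambda>x. enn2ereal (f x)" ?l], intro conjI allI)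
    show "AE x in M. incseq (\<lambda>n. enn2ereal (s n x)) \<and> (\<lambda>n. enn2ereal (s n x)) \<longlonglongrightarrow> enn2ereal (f x)"
      using inc lim by (intro AE_I2) (auto simp: incseq_def less_eq_ennreal.rep_eq[symmetric])
    show "(\<lambda>n. fs_norm X (\<lambda>x. enn2ereal (s n x))) \<longlonglongrightarrow> ?l" by (rule LIMSEQ_SUP[OF mono])
    show "?l < \<infinity>" using l r by (rule le_less_trans)
  qed (use step in auto)
  then show "(\<lambda>x. enn2ereal (f x)) \<in> fs_carrier X" "fs_norm X (\<lambda>x. enn2ereal (f x)) \<le> r"
    using LIMSEQ_unique[OF _ LIMSEQ_SUP[OF mono]] l by auto
qed

abbreviation bidual_norm :: "('a \<Rightarrow> ereal) \<Rightarrow> ennreal" where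
  "bidual_norm \<equiv> associate_norm M (associate_space M X)"

lemma bidual_norm_eq:
  assumes [measurable]: "f \<in> borel_measurable M"
  shows "bidual_norm f =
    (SUP w \<in> {w \<in> borel_measurable M. dual_norm M X w \<le> 1}. abs_pairing M f w)"
    (is "_ = Sup (?I ` ?W)")
  unfolding associate_norm_def
proof (rule antisym)
  let ?S = "SUP g\<in>{g \<in> fs_carrier (associate_space M X). fs_norm (associate_space M X) g \<le> 1}.
      \<integral>\<^sup>+x. e2ennreal \<bar>g x * f x\<bar> \<partial>M"
  show "?S \<le> Sup (?I ` ?W)"
  proof (rule SUP_least)
    fix g assume "g \<in> {g \<in> fs_carrier (associate_space M X). fs_norm (associate_space M X) g \<le> 1}"
    then have g: "g \<in> borel_measurable M" "dual_norm M X (\<lambda>x. e2ennreal \<bar>g x\<bar>) \<le> 1"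
      by (simp_all add: associate_space_def associate_norm_eq_dual_norm)
    have "(\<lambda>x. e2ennreal \<bar>g x\<bar>) \<in> borel_measurable M" using g(1) by measurable
    then have "(\<lambda>x. e2ennreal \<bar>g x\<bar>) \<in> ?W" using g(2) by simp
    then have "?I (\<lambda>x. e2ennreal \<bar>g x\<bar>) \<le> Sup (?I ` ?W)" by (rule SUP_upper)
    then show "(\<integral>\<^sup>+x. e2ennreal \<bar>g x * f x\<bar> \<partial>M) \<le> Sup (?I ` ?W)"
      by (simp add: e2ennreal_abs_mult mult.commute)
  qed
  show "Sup (?I ` ?W) \<le> ?S"
  proof (rule SUP_least)
    fix w assume w: "w \<in> ?W"
    show "?I w \<le> ?S"
      using w
      by (intro SUP_upper2[of "\<lambda>x. enn2ereal (w x)"])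
        (auto simp: associate_space_def associate_norm_eq_dual_norm e2ennreal_abs_mult mult.commute intro: le_less_trans)
  qed
qed

lemma second_associate_eq:
  assumes "fatou_property M X"
  shows "fs_carrier (associate_space M (associate_space M X)) = fs_carrier X"
    and "f \<in> fs_carrier X \<Longrightarrow> fs_norm (associate_space M (associate_space M X)) f = fs_norm X f"
proof -
  let ?N = "bidual_norm"
  have up: "f \<in> fs_carrier X \<and> fs_norm X f \<le> ?N f" if f[measurable]: "f \<in> borel_measurable M" and fin: "?N f < \<infinity>" for f
  proof -
    have bound: "abs_pairing M f w \<le> ?N f" if "w \<in> borel_measurable M" "dual_norm M X w \<le> 1" for w
      unfolding bidual_norm_eq[OF f] using that by (intro SUP_upper) auto
    have m: "(\<lambda>x. e2ennreal \<bar>f x\<bar>) \<in> borel_measurable M" by measurable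
    have "(\<lambda>x. enn2ereal (e2ennreal \<bar>f x\<bar>)) \<in> fs_carrier X"
      "fs_norm X (\<lambda>x. enn2ereal (e2ennreal \<bar>f x\<bar>)) \<le> ?N f"
      by (rule fatou_norm_le[OF assms m bound fin]; assumption)+
    moreover have "AE x in M. \<bar>f x\<bar> \<le> \<bar>enn2ereal (e2ennreal \<bar>f x\<bar>)\<bar>"
      by (simp add: enn2ereal_e2ennreal)
    ultimately show ?thesis
      using dominated_mem[OF f, of "\<lambda>x. enn2ereal (e2ennreal \<bar>f x\<bar>)"] by (blast intro: order_trans)
  qed
  have down: "?N f \<le> fs_norm X f" if f: "f \<in> fs_carrier X" for f
  proof -
    have [measurable]: "f \<in> borel_measurable M" by (rule carrier_measurable[OF f])
    obtain b where b: "fs_norm X f = ennreal b" "0 \<le> b" using norm_finite[OF f] by (cases "fs_norm X f") auto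
    show ?thesis
      unfolding bidual_norm_eq[OF carrier_measurable[OF f]]
    proof (rule SUP_least)
      fix w assume w: "w \<in> {w \<in> borel_measurable M. dual_norm M X w \<le> 1}"
      have "abs_pairing M f w \<le> ennreal b + ennreal e" if "0 < e" for e
      proof -
        have "abs_pairing M f w \<le> ennreal (b + e) * dual_norm M X w"
          using b w that by (intro nn_integral_le_norm_times_dual_norm f) (auto intro!: ennreal_leI simp del: ennreal_plus)
        also have "\<dots> \<le> ennreal (b + e) * 1" using w by (intro mult_left_mono) auto
        finally show ?thesis using b that by simp
      qed
      then show "abs_pairing M f w \<le> fs_norm X f"
        unfolding b by (rule ennreal_le_epsilon)
    qed
  qed
  have fin: "?N f < \<infinity>" if "f \<in> fs_carrier X" for f
    using down[OF that] norm_finite[OF that] by (rule le_less_trans)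
  show "fs_carrier (associate_space M (associate_space M X)) = fs_carrier X"
    unfolding associate_space_def[of M "associate_space M X"] fun_space.simps
  proof (intro set_eqI iffI CollectI conjI)
    show "f \<in> fs_carrier X" if "f \<in> {g \<in> borel_measurable M. ?N g < \<infinity>}" for f
      using that up[of f] by blast
  qed (simp_all only: fin carrier_measurable)
  show "fs_norm (associate_space M (associate_space M X)) f = fs_norm X f" if "f \<in> fs_carrier X"
    using up[OF carrier_measurable[OF that] fin[OF that]] down[OF that]
    by (simp add: associate_space_def[of M "associate_space M X"])
qed

end

section \<open>Down sets and decreasing functions of a full core\<close>

lemma chain_finite_Union:
  fixes A :: "nat \<Rightarrow> 'a set"
  assumes "\<And>m n. A m \<subseteq> A n \<or> A n \<subseteq> A m"
  shows "\<exists>m\<le>n. (\<Union>k\<le>n. A k) = A m"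
proof (induction n)
  case (Suc n)
  then obtain m where "m \<le> n" "(\<Union>k\<le>n. A k) = A m" by auto
  moreover have "(\<Union>k\<le>Suc n. A k) = (\<Union>k\<le>n. A k) \<union> A (Suc n)" by (auto simp: atMost_Suc)
  ultimately show ?case
    using assms[of m "Suc n"] by (metis Un_absorb1 Un_absorb2 le_SucI order_refl)
qed auto

lemma chain_finite_Inter:
  fixes A :: "nat \<Rightarrow> 'a set"
  assumes "\<And>m n. A m \<subseteq> A n \<or> A n \<subseteq> A m"
  shows "\<exists>m\<le>n. (\<Inter>k\<le>n. A k) = A m"
proof (induction n)
  case (Suc n)
  then obtain m where "m \<le> n" "(\<Inter>k\<le>n. A k) = A m" by auto
  moreover have "(\<Inter>k\<le>Suc n. A k) = (\<Inter>k\<le>n. A k) \<inter> A (Suc n)" by (auto simp: atMost_Suc)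
  ultimately show ?case
    using assms[of m "Suc n"] by (metis Int_absorb1 Int_absorb2 le_SucI order_refl)
qed auto

definition saturated :: "'a set \<Rightarrow> 'a set set \<Rightarrow> 'a set \<Rightarrow> bool" where
  "saturated U \<C> S \<longleftrightarrow> (\<forall>u\<in>U. \<forall>v\<in>U. (\<forall>C\<in>\<C>. u \<in> C \<longleftrightarrow> v \<in> C) \<longrightarrow> (u \<in> S \<longleftrightarrow> v \<in> S))"

lemma saturatedI:
  assumes "\<And>u v. u \<in> U \<Longrightarrow> v \<in> U \<Longrightarrow> (\<And>C. C \<in> \<C> \<Longrightarrow> u \<in> C \<longleftrightarrow> v \<in> C) \<Longrightarrow> u \<in> S \<Longrightarrow> v \<in> S"
  shows "saturated U \<C> S"
  unfolding saturated_def
proof (intro ballI impI iffI)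
  fix u v assume *: "u \<in> U" "v \<in> U" "\<forall>C\<in>\<C>. u \<in> C \<longleftrightarrow> v \<in> C"
  show "u \<in> S \<Longrightarrow> v \<in> S" by (rule assms[of u v]) (use * in simp_all)
  show "v \<in> S \<Longrightarrow> u \<in> S" by (rule assms[of v u]) (use * in simp_all)
qed

lemma saturatedD:
  assumes "saturated U \<C> S" "u \<in> U" "v \<in> U" "\<And>C. C \<in> \<C> \<Longrightarrow> u \<in> C \<longleftrightarrow> v \<in> C"
  shows "u \<in> S \<longleftrightarrow> v \<in> S"
proof -
  have "\<forall>C\<in>\<C>. u \<in> C \<longleftrightarrow> v \<in> C" by (intro ballI assms(4))
  then show ?thesis
    using assms(1)[unfolded saturated_def, rule_format, OF assms(2,3)] by blast
qed

text \<open>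
  The sets saturated by some countable subfamily of \<open>\<A>\<close> form a \<open>\<sigma>\<close>-algebra.
\<close>

lemma sigma_sets_countably_saturated:
  assumes "S \<in> sigma_sets U \<A>"
  shows "\<exists>\<C>. \<C> \<subseteq> \<A> \<and> countable \<C> \<and> saturated U \<C> S"
  using assms
proof (induction rule: sigma_sets.induct)
  case (Basic a)
  have "saturated U {a} a" by (simp add: saturated_def)
  then show ?case using Basic by (intro exI[of _ "{a}"]) simp
next
  case Empty
  show ?case by (intro exI[of _ "{}"]) (simp add: saturated_def)
next
  case (Compl a)
  then obtain \<C> where \<C>: "\<C> \<subseteq> \<A>" "countable \<C>" "saturated U \<C> a" by blast
  have "saturated U \<C> (U - a)"
  proof (rule saturatedI)
    fix u v assume uv: "u \<in> U" "v \<in> U" "\<And>C. C \<in> \<C> \<Longrightarrow> u \<in> C \<longleftrightarrow> v \<in> C" and u: "u \<in> U - a"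
    show "v \<in> U - a" using saturatedD[OF \<C>(3) uv] u uv(2) by blast
  qed
  then show ?case using \<C> by blast
next
  case (Union a)
  have "\<forall>n. \<exists>\<C>. \<C> \<subseteq> \<A> \<and> countable \<C> \<and> saturated U \<C> (a n)" using Union.IH by blast
  from choice[OF this] obtain \<C>
    where "\<forall>n. \<C> n \<subseteq> \<A> \<and> countable (\<C> n) \<and> saturated U (\<C> n) (a n)" ..
  then have \<C>: "\<C> n \<subseteq> \<A>" "countable (\<C> n)" "saturated U (\<C> n) (a n)" for n by simp_all
  have "saturated U (\<Union>n. \<C> n) (\<Union>n. a n)"
  proof (rule saturatedI)
    fix u v assume uv: "u \<in> U" "v \<in> U" "\<And>C. C \<in> (\<Union>n. \<C> n) \<Longrightarrow> u \<in> C \<longleftrightarrow> v \<in> C" and u: "u \<in> (\<Union>n. a n)"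
    from u obtain n where "u \<in> a n" by auto
    moreover have "u \<in> a n \<longleftrightarrow> v \<in> a n"
      by (rule saturatedD[OF \<C>(3) uv(1,2)]) (rule uv(3), rule UN_I[OF UNIV_I])
    ultimately have "v \<in> a n" by simp
    then show "v \<in> (\<Union>n. a n)" by auto
  qed
  then show ?case using \<C>(1,2) by (intro exI[of _ "\<Union>n. \<C> n"]) auto
qed

locale full_core = sigma_finite_measure M for M :: "'a measure" +
  fixes \<A> :: "'a set set"
  assumes full: "full_ordered_core M \<A>"
begin

text \<open>
  These are the superlevel sets of core decreasing functions. Like the core itself they form a chain, but
  in addition they are closed under countable unions and intersections.
\<close>

definition down_sets :: "'a set set" where
  "down_sets = {D \<in> sigma_sets (space M) \<A>. \<forall>u\<in>space M. \<forall>v\<in>D. core_le \<A> u v \<longrightarrow> u \<in> D}"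

definition decreasing :: "('a \<Rightarrow> ennreal) set" where
  "decreasing = {w. \<forall>c. {x \<in> space M. c < w x} \<in> down_sets}"

lemma core_sets: "\<A> \<subseteq> sets M"
  and core_chain: "A \<in> \<A> \<Longrightarrow> B \<in> \<A> \<Longrightarrow> A \<subseteq> B \<or> B \<subseteq> A"
  and core_empty: "{} \<in> \<A>"
  and core_finite: "A \<in> \<A> \<Longrightarrow> emeasure M A < \<infinity>"
  using full by (auto simp: full_ordered_core_def ordered_core_def)

lemma core_subset_space: "A \<in> \<A> \<Longrightarrow> A \<subseteq> space M"
  using core_sets sets.sets_into_space by blast

lemma sigma_sets_core: "sigma_sets (space M) \<A> \<subseteq> sets M"
  using core_sets by (rule sets.sigma_sets_subset)

lemma core_le_total: "core_le \<A> u v \<or> core_le \<A> v u"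
  unfolding core_le_def using core_chain by blast

lemma down_set_sets [measurable]: "D \<in> down_sets \<Longrightarrow> D \<in> sets M"
  using sigma_sets_core by (auto simp: down_sets_def)

lemma down_set_subset_space: "D \<in> down_sets \<Longrightarrow> D \<subseteq> space M"
  using down_set_sets sets.sets_into_space by blast

lemma down_setD: "D \<in> down_sets \<Longrightarrow> v \<in> D \<Longrightarrow> u \<in> space M \<Longrightarrow> core_le \<A> u v \<Longrightarrow> u \<in> D"
  by (auto simp: down_sets_def)

lemma core_down_set: "A \<in> \<A> \<Longrightarrow> A \<in> down_sets"
  by (auto simp: down_sets_def core_le_def intro: sigma_sets.Basic)

lemma down_sets_chain:
  assumes "D \<in> down_sets" "E \<in> down_sets"
  shows "D \<subseteq> E \<or> E \<subseteq> D"
proof (rule ccontr)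
  assume "\<not> ?thesis"
  then obtain u v where "u \<in> D" "u \<notin> E" "v \<in> E" "v \<notin> D" by auto
  then show False
    using assms down_setD down_set_subset_space core_le_total[of u v] by blast
qed

lemma down_sets_empty: "{} \<in> down_sets"
  by (rule core_down_set[OF core_empty])

lemma down_sets_UN:
  assumes "\<And>n::nat. D n \<in> down_sets"
  shows "(\<Union>n. D n) \<in> down_sets"
  using assms by (fastforce simp: down_sets_def intro: sigma_sets.Union)

lemma down_sets_INT:
  assumes "\<And>n::nat. D n \<in> down_sets"
  shows "(\<Inter>n. D n) \<in> down_sets"
proof -
  have "\<A> \<subseteq> Pow (space M)" using core_subset_space by auto
  then have "(\<Inter>n. D n) \<in> sigma_sets (space M) \<A>"
    using assms by (intro sigma_sets_Inter) (auto simp: down_sets_def)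
  moreover have "u \<in> (\<Inter>n. D n)" if "u \<in> space M" "v \<in> (\<Inter>n. D n)" "core_le \<A> u v" for u v
    using that down_setD[OF assms] by blast
  ultimately show ?thesis unfolding down_sets_def by blast
qed

lemma down_sets_Int: "D \<in> down_sets \<Longrightarrow> E \<in> down_sets \<Longrightarrow> D \<inter> E \<in> down_sets"
  using down_sets_chain[of D E] by (auto simp: Int_absorb1 Int_absorb2)

lemma core_exhaustion:
  obtains E where "\<And>n::nat. E n \<in> \<A>" "incseq E" "(\<Union>n. E n) = space M"
proof -
  obtain \<A>\<^sub>0 where \<A>\<^sub>0: "\<A>\<^sub>0 \<subseteq> \<A>" "countable \<A>\<^sub>0" "\<Union>\<A>\<^sub>0 = space M"
    using full unfolding full_ordered_core_def sigma_bounded_def by metis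
  \<comment> \<open>the empty set is added so that there is a sequence to enumerate even when the subfamily is empty\<close>
  let ?B = "from_nat_into (insert {} \<A>\<^sub>0)"
  have range: "range ?B = insert {} \<A>\<^sub>0" using \<A>\<^sub>0 by (intro range_from_nat_into) auto
  have B: "?B n \<in> \<A>" for n using from_nat_into[of "insert {} \<A>\<^sub>0" n] \<A>\<^sub>0(1) core_empty by auto
  show thesis
  proof (rule that[of "\<lambda>n. \<Union>k\<le>n. ?B k"])
    show "(\<Union>k\<le>n. ?B k) \<in> \<A>" for n
      using chain_finite_Union[of ?B n, OF core_chain[OF B B]] B by auto
    show "incseq (\<lambda>n. \<Union>k\<le>n. ?B k)" by (rule incseq_SucI) (auto simp: atMost_Suc)
    have "(\<Union>n. \<Union>k\<le>n. ?B k) = \<Union>(range ?B)" by auto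
    then show "(\<Union>n. \<Union>k\<le>n. ?B k) = space M" using \<A>\<^sub>0(3) range by simp
  qed
qed

text \<open>
  Let \<open>\<C>\<close> be a countable subfamily of the core that saturates \<open>D\<close> and covers the space. If \<open>D\<close> were neither the union of
  the members of \<open>\<C>\<close> that it contains nor the intersection of those that contain it, then a point left
  out by that union and a point of the intersection outside \<open>D\<close> would belong to the same members of
  \<open>\<C>\<close>, while only one of them is in \<open>D\<close>.
\<close>

lemma down_set_cases:
  assumes D: "D \<in> down_sets"
  obtains (inc) A where "\<And>n::nat. A n \<in> \<A>" "incseq A" "D = (\<Union>n. A n)"
  | (dec) A where "\<And>n::nat. A n \<in> \<A>" "decseq A" "D = (\<Inter>n. A n)"
proof -
  obtain E where E: "\<And>n. E n \<in> \<A>" "incseq E" "(\<Union>n. E n) = space M" using core_exhaustion by metis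
  have "D \<in> sigma_sets (space M) \<A>" using D by (simp add: down_sets_def)
  from sigma_sets_countably_saturated[OF this]
  obtain \<C> where \<C>: "\<C> \<subseteq> \<A>" "countable \<C>" "saturated (space M) \<C> D" by blast
  define \<B> where "\<B> = insert {} (\<C> \<union> range E)"
  have \<B>: "\<B> \<subseteq> \<A>" "countable \<B>" using \<C> E core_empty by (auto simp: \<B>_def)
  define \<I> where "\<I> = {C \<in> \<B>. C \<subseteq> D}"
  define \<O> where "\<O> = {C \<in> \<B>. D \<subseteq> C}"
  have cmp: "C \<in> \<I> \<or> C \<in> \<O>" if "C \<in> \<B>" for C
    using down_sets_chain[OF D core_down_set[of C]] that \<B> by (auto simp: \<I>_def \<O>_def)
  have inc_case: thesis if "D = \<Union>\<I>"
  proof -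
    let ?B = "from_nat_into \<I>"
    have "{} \<in> \<I>" by (auto simp: \<I>_def \<B>_def)
    moreover have "countable \<I>" using \<B>(2) by (auto simp: \<I>_def)
    ultimately have range: "range ?B = \<I>" by (intro range_from_nat_into) auto
    have "?B n \<in> \<I>" for n using from_nat_into[of \<I> n] \<open>{} \<in> \<I>\<close> by auto
    then have B: "?B n \<in> \<A>" for n using \<B>(1) unfolding \<I>_def by blast
    show thesis
    proof (rule inc[of "\<lambda>n. \<Union>k\<le>n. ?B k"])
      show "(\<Union>k\<le>n. ?B k) \<in> \<A>" for n
        using chain_finite_Union[of ?B n, OF core_chain[OF B B]] B by auto
      show "incseq (\<lambda>n. \<Union>k\<le>n. ?B k)" by (rule incseq_SucI) (auto simp: atMost_Suc)
      have "(\<Union>n. \<Union>k\<le>n. ?B k) = \<Union>(range ?B)" by auto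
      then show "D = (\<Union>n. \<Union>k\<le>n. ?B k)" using that range by simp
    qed
  qed
  show thesis
  proof (cases "D = \<Union>\<I>")
    case True
    then show thesis by (rule inc_case)
  next
    case False
    then obtain u where u: "u \<in> D" "\<And>C. C \<in> \<I> \<Longrightarrow> u \<notin> C" by (auto simp: \<I>_def)
    have "u \<in> space M" using u D down_set_subset_space by auto
    then obtain m where "u \<in> E m" using E(3) by auto
    then have "E m \<in> \<O>" using cmp[of "E m"] u(2) by (auto simp: \<B>_def)
    have "D = \<Inter>\<O>"
    proof (rule ccontr)
      assume "D \<noteq> \<Inter>\<O>"
      then obtain v where v: "v \<notin> D" "\<And>C. C \<in> \<O> \<Longrightarrow> v \<in> C" by (auto simp: \<O>_def)
      have "v \<in> space M" using v(2)[OF \<open>E m \<in> \<O>\<close>] core_subset_space[OF E(1)] by auto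
      moreover have "u \<in> C \<longleftrightarrow> v \<in> C" if "C \<in> \<C>" for C
        using cmp[of C] that u v by (auto simp: \<B>_def \<I>_def \<O>_def)
      ultimately show False using saturatedD[OF \<C>(3) \<open>u \<in> space M\<close>] u(1) v(1) by blast
    qed
    let ?B = "from_nat_into \<O>"
    have "countable \<O>" using \<B>(2) by (auto simp: \<O>_def)
    then have range: "range ?B = \<O>" using \<open>E m \<in> \<O>\<close> by (intro range_from_nat_into) auto
    have "?B n \<in> \<O>" for n using from_nat_into[of \<O> n] \<open>E m \<in> \<O>\<close> by auto
    then have B: "?B n \<in> \<A>" for n using \<B>(1) unfolding \<O>_def by blast
    show thesis
    proof (rule dec[of "\<lambda>n. \<Inter>k\<le>n. ?B k"])
      show "(\<Inter>k\<le>n. ?B k) \<in> \<A>" for n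
        using chain_finite_Inter[of ?B n, OF core_chain[OF B B]] B by auto
      show "decseq (\<lambda>n. \<Inter>k\<le>n. ?B k)" unfolding decseq_Suc_iff by (auto simp: atMost_Suc)
      have "(\<Inter>n. \<Inter>k\<le>n. ?B k) = \<Inter>(range ?B)" by auto
      then show "D = (\<Inter>n. \<Inter>k\<le>n. ?B k)" using \<open>D = \<Inter>\<O>\<close> range by simp
    qed
  qed
qed

lemma decreasing_superlevel: "w \<in> decreasing \<Longrightarrow> {x \<in> space M. c < w x} \<in> down_sets"
  by (simp add: decreasing_def)

lemma decreasing_measurable [measurable_dest]: "w \<in> decreasing \<Longrightarrow> w \<in> borel_measurable M"
  by (rule borel_measurableI_greater) (intro down_set_sets decreasing_superlevel)

lemma decreasingD:
  assumes "w \<in> decreasing" "core_le \<A> u v" "u \<in> space M" "v \<in> space M"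
  shows "w v \<le> w u"
  using down_setD[OF decreasing_superlevel[OF assms(1), of "w u"], of v u] assms by (auto simp: not_less[symmetric])

lemma decreasing_outside:
  assumes w: "w \<in> decreasing" and D: "D \<in> down_sets" and "u \<in> D" "v \<in> space M - D"
  shows "w v \<le> w u"
proof -
  have "\<not> core_le \<A> v u" using assms(3,4) down_setD[OF D] by auto
  then show ?thesis
    using core_le_total[of u v] assms down_set_subset_space[OF D] by (intro decreasingD[OF w]) auto
qed

lemma scaled_indicator_decreasing:
  assumes D: "D \<in> down_sets"
  shows "(\<lambda>x. a * indicator D x) \<in> decreasing"
proof -
  have "{x \<in> space M. c < a * indicator D x} \<in> down_sets" for c
  proof (cases "c < a")
    case True
    then have "{x \<in> space M. c < a * indicator D x} = D"
      using down_set_subset_space[OF D] by (auto simp: indicator_def split: if_splits)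
    then show ?thesis using D by simp
  next
    case False
    then have "{x \<in> space M. c < a * indicator D x} = {}" by (auto simp: indicator_def)
    then show ?thesis using down_sets_empty by (simp only:)
  qed
  then show ?thesis by (simp add: decreasing_def)
qed

lemma core_decreasing_imp_decreasing:
  assumes g: "g \<in> core_decreasing M \<A>"
  shows "(\<lambda>x. e2ennreal (g x)) \<in> decreasing"
proof -
  have m: "g \<in> borel_measurable (sigma (space M) \<A>)"
    and mono: "\<And>u v. u \<in> space M \<Longrightarrow> v \<in> space M \<Longrightarrow> core_le \<A> u v \<Longrightarrow> g v \<le> g u"
    using g core_decreasing_full[OF full] by auto
  have sub: "\<A> \<subseteq> Pow (space M)" using core_subset_space by auto
  have "(\<lambda>x. e2ennreal (g x)) \<in> borel_measurable (sigma (space M) \<A>)" using m by measurable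
  then have "{x \<in> space (sigma (space M) \<A>). c < e2ennreal (g x)} \<in> sets (sigma (space M) \<A>)" for c
    by measurable
  then have "{x \<in> space M. c < e2ennreal (g x)} \<in> sigma_sets (space M) \<A>" for c
    using sub by (simp add: sets_measure_of space_measure_of)
  then show ?thesis
    using mono e2ennreal_mono by (auto simp: decreasing_def down_sets_def intro: less_le_trans)
qed

lemma decreasing_imp_core_decreasing:
  assumes w: "w \<in> decreasing"
  shows "(\<lambda>x. enn2ereal (w x)) \<in> core_decreasing M \<A>"
proof -
  have sub: "\<A> \<subseteq> Pow (space M)" using core_subset_space by auto
  have "w \<in> borel_measurable (sigma (space M) \<A>)"
    using sub decreasing_superlevel[OF w]
    by (intro borel_measurableI_greater) (simp add: sets_measure_of space_measure_of down_sets_def)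
  then have "(\<lambda>x. enn2ereal (w x)) \<in> borel_measurable (sigma (space M) \<A>)" by measurable
  then show ?thesis
    using decreasingD[OF w] by (simp add: core_decreasing_full[OF full] less_eq_ennreal.rep_eq[symmetric])
qed

lemma set_nn_integral_eq_density:
  "f \<in> borel_measurable M \<Longrightarrow> A \<in> sets M \<Longrightarrow> (\<integral>\<^sup>+x\<in>A. f x \<partial>M) = emeasure (density M f) A"
  by (simp add: emeasure_density)

lemma set_nn_integral_mono_set: "A \<subseteq> B \<Longrightarrow> (\<integral>\<^sup>+x\<in>A. f x \<partial>M) \<le> (\<integral>\<^sup>+x\<in>B. f x \<partial>M)"
  by (intro nn_integral_mono mult_left_mono) (auto simp: indicator_def)

lemma set_nn_integral_INC:
  assumes "f \<in> borel_measurable M" "\<And>n. A n \<in> sets M" "incseq A"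
  shows "(\<integral>\<^sup>+x\<in>(\<Union>n. A n). f x \<partial>M) = (SUP n. \<integral>\<^sup>+x\<in>A n. f x \<partial>M)"
  using assms by (simp add: set_nn_integral_eq_density SUP_emeasure_incseq image_subset_iff)

text \<open>
  Down sets are monotone limits of core sets. Increasing limits are harmless. For a decreasing limit the
  integrals of \<open>w\<close> over core sets may all be infinite; but outside \<open>D\<close> the function \<open>w\<close> is at most
  its infimum \<open>c\<close> over \<open>D\<close>, which leaves an error \<open>c \<mu>(A\<^sub>n - D)\<close> tending to zero unless \<open>c = \<infinity>\<close>.
\<close>

lemma core_integral_le_imp_down_set_integral_le:
  assumes [measurable]: "h \<in> borel_measurable M" and w: "w \<in> decreasing"
    and le: "\<And>A. A \<in> \<A> \<Longrightarrow> (\<integral>\<^sup>+x\<in>A. h x \<partial>M) \<le> (\<integral>\<^sup>+x\<in>A. w x \<partial>M)"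
    and D: "D \<in> down_sets"
  shows "(\<integral>\<^sup>+x\<in>D. h x \<partial>M) \<le> (\<integral>\<^sup>+x\<in>D. w x \<partial>M)"
proof -
  let ?I = "\<lambda>h A. \<integral>\<^sup>+x\<in>A. h x \<partial>M"
  have [measurable]: "w \<in> borel_measurable M" "D \<in> sets M" using w D by auto
  from D show ?thesis
  proof (cases rule: down_set_cases)
    case (inc A)
    have [measurable]: "A n \<in> sets M" for n using inc(1) core_sets by auto
    show ?thesis
      unfolding inc(3) using inc(1,2) le by (simp add: set_nn_integral_INC SUP_mono')
  next
    case (dec A)
    have A[measurable]: "A n \<in> sets M" for n using dec(1) core_sets by auto
    show ?thesis
    proof (cases "D = {}")
      case False
      define c where "c = (INF x\<in>D. w x)"
      have out: "w y \<le> c" if "y \<in> space M - D" for y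
        unfolding c_def using decreasing_outside[OF w D _ that] by (rule INF_greatest)
      have inn: "c \<le> w x" if "x \<in> D" for x unfolding c_def using that by (rule INF_lower)
      show ?thesis
      proof (cases "c = \<infinity>")
        case True
        show ?thesis
        proof (cases "emeasure M D = 0")
          case True
          then show ?thesis by (simp add: nn_integral_null_set null_setsI)
        next
          case False
          have "\<infinity> = (\<integral>\<^sup>+x. \<infinity> * indicator D x \<partial>M)"
            using False by (subst nn_integral_cmult_indicator) (simp_all add: ennreal_top_mult)
          also have "\<dots> \<le> ?I w D"
            using inn True by (intro nn_integral_mono) (auto simp: indicator_def top_unique)
          finally show ?thesis by (simp add: top_unique)
        qed
      next
        case False
        have "?I h D \<le> ?I w D + c * emeasure M (A n - D)" for n
        proof -
          have "D \<subseteq> A n" using dec(3) by auto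
          then have "?I h D \<le> ?I h (A n)" by (rule set_nn_integral_mono_set)
          also have "\<dots> \<le> ?I w (A n)" by (rule le[OF dec(1)])
          also have "\<dots> \<le> (\<integral>\<^sup>+x. w x * indicator D x + c * indicator (A n - D) x \<partial>M)"
            using out by (intro nn_integral_mono) (auto simp: indicator_def)
          also have "\<dots> = ?I w D + c * emeasure M (A n - D)"
            by (simp add: nn_integral_add nn_integral_cmult_indicator)
          finally show ?thesis .
        qed
        moreover have "(\<lambda>n. emeasure M (A n - D)) \<longlonglongrightarrow> 0"
        proof -
          have "(\<lambda>n. emeasure M (A n - D)) \<longlonglongrightarrow> emeasure M (\<Inter>n. A n - D)"
          proof (rule Lim_emeasure_decseq)
            show "decseq (\<lambda>n. A n - D)" using dec(2) by (auto simp: decseq_def)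
            show "emeasure M (A n - D) \<noteq> \<infinity>" for n
              using emeasure_mono[of "A n - D" "A n" M] core_finite[OF dec(1)[of n]] by (auto simp: top_unique)
          qed auto
          also have "(\<Inter>n. A n - D) = {}" using dec(3) by auto
          finally show ?thesis by simp
        qed
        then have "(\<lambda>n. ?I w D + c * emeasure M (A n - D)) \<longlonglongrightarrow> ?I w D + c * 0"
          using False by (intro tendsto_add tendsto_const ennreal_tendsto_cmult) (auto simp: less_top)
        ultimately show ?thesis by (intro LIMSEQ_le_const[of _ "\<integral>\<^sup>+x\<in>D. w x \<partial>M"]) auto
      qed
    qed simp
  qed
qed

text \<open>
  The layer cake formula reduces \<open>w\<close> to the indicators of its superlevel sets.
\<close>

lemma nn_integral_mult_decreasing_mono:
  assumes f[measurable]: "f \<in> borel_measurable M" and h[measurable]: "h \<in> borel_measurable M" and w: "w \<in> decreasing"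
    and le: "\<And>D. D \<in> down_sets \<Longrightarrow> (\<integral>\<^sup>+x\<in>D. f x \<partial>M) \<le> (\<integral>\<^sup>+x\<in>D. h x \<partial>M)"
  shows "(\<integral>\<^sup>+x. f x * w x \<partial>M) \<le> (\<integral>\<^sup>+x. h x * w x \<partial>M)"
proof -
  have wm: "w \<in> borel_measurable M" by (rule decreasing_measurable[OF w])
  have *: "(\<integral>\<^sup>+x. g x * w x \<partial>M)
      = (\<integral>\<^sup>+y. (\<integral>\<^sup>+x\<in>{x \<in> space M. ennreal y < w x}. g x \<partial>M) * indicator {0<..} y \<partial>lborel)"
    if "g \<in> borel_measurable M" for g
  proof -
    have "(\<integral>\<^sup>+x. g x * indicator {x. ennreal y < w x} x \<partial>M)
        = (\<integral>\<^sup>+x\<in>{x \<in> space M. ennreal y < w x}. g x \<partial>M)" for y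
      by (intro nn_integral_cong) (auto simp: indicator_def)
    then show ?thesis using nn_integral_layer_cake[OF that wm, of 0] by simp
  qed
  show ?thesis
    unfolding *[OF f] *[OF h]
    by (intro nn_integral_mono mult_right_mono le decreasing_superlevel[OF w]) simp
qed

section \<open>Averaging decreasing functions over the steps of a staircase\<close>

text \<open>
  The steps \<open>C i - C (Suc i)\<close> with \<open>i < n\<close> partition \<open>C 0\<close>. They are numbered from the outside to the
  inside, so that a decreasing function increases with the index.
\<close>

definition staircase :: "nat \<Rightarrow> (nat \<Rightarrow> 'a set) \<Rightarrow> bool" where
  "staircase n C \<longleftrightarrow> (\<forall>i. C i \<in> down_sets \<and> emeasure M (C i) < \<infinity>) \<and> decseq C \<and> C n = {}"

abbreviation staircase_averaging :: "nat \<Rightarrow> (nat \<Rightarrow> 'a set) \<Rightarrow> ('a \<Rightarrow> ennreal) \<Rightarrow> 'a \<Rightarrow> ennreal" where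
  "staircase_averaging n C \<equiv> averaging M {..<n} (\<lambda>i. C i - C (Suc i))"

lemma staircaseD:
  assumes "staircase n C"
  shows "C i \<in> down_sets" "emeasure M (C i) < \<infinity>" "i \<le> j \<Longrightarrow> C j \<subseteq> C i" "C n = {}"
  using assms by (auto simp: staircase_def decseq_def)

lemma staircase_block_family:
  assumes C: "staircase n C"
  shows "block_family M {..<n} (\<lambda>i. C i - C (Suc i))"
  unfolding block_family_def
proof (intro conjI ballI)
  show "disjoint_family_on (\<lambda>i. C i - C (Suc i)) {..<n}"
    unfolding disjoint_family_on_def
  proof (intro ballI impI)
    fix i j :: nat assume "i \<noteq> j"
    then have "Suc i \<le> j \<or> Suc j \<le> i" by auto
    then show "(C i - C (Suc i)) \<inter> (C j - C (Suc j)) = {}"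
      using staircaseD(3)[OF C, of "Suc i" j] staircaseD(3)[OF C, of "Suc j" i] by blast
  qed
  fix i
  show "C i - C (Suc i) \<in> sets M" using staircaseD(1)[OF C] by auto
  have "emeasure M (C i - C (Suc i)) \<le> emeasure M (C i)"
    using staircaseD(1)[OF C] by (intro emeasure_mono) auto
  then show "emeasure M (C i - C (Suc i)) < \<infinity>" using staircaseD(2)[OF C, of i] by (rule le_less_trans)
qed simp

lemma staircase_step:
  assumes C: "staircase n C" and x: "x \<in> C i"
  obtains k where "i \<le> k" "k < n" "x \<in> C k - C (Suc k)"
proof -
  have "x \<notin> C n" using staircaseD(4)[OF C] by simp
  then have "\<exists>k\<ge>i. x \<in> C k \<and> x \<notin> C (Suc k)"
  proof (rule contrapos_np)
    assume *: "\<not> (\<exists>k\<ge>i. x \<in> C k \<and> x \<notin> C (Suc k))"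
    have "x \<in> C (i + d)" for d using x * by (induction d) auto
    moreover have "i \<le> n"
      using x staircaseD(3)[OF C, of n i] staircaseD(4)[OF C] by (cases "i \<le> n") auto
    ultimately show "x \<in> C n" by (metis le_add_diff_inverse)
  qed
  then obtain k where k: "i \<le> k" "x \<in> C k" "x \<notin> C (Suc k)" by blast
  have "k < n" using k(2) staircaseD(3)[OF C, of n k] staircaseD(4)[OF C] by (cases "k < n") auto
  then show thesis using that k by blast
qed

lemma block_avg_increasing:
  assumes C: "staircase n C" and w: "w \<in> decreasing" and "i < k" and ne: "C i - C (Suc i) \<noteq> {}"
  shows "block_avg M w (C i - C (Suc i)) \<le> block_avg M w (C k - C (Suc k))"
proof (cases "i < n \<and> k < n")
  case True
  have B: "C i - C (Suc i) \<in> sets M" "emeasure M (C i - C (Suc i)) < \<infinity>"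
    "C k - C (Suc k) \<in> sets M" "emeasure M (C k - C (Suc k)) < \<infinity>"
    using staircase_block_family[OF C] True by (auto simp: block_family_def)
  note wm = decreasing_measurable[OF w]
  show ?thesis
  proof (rule le_block_avg[OF B(3) wm B(4)])
    fix x assume x: "x \<in> C k - C (Suc k)"
    show "block_avg M w (C i - C (Suc i)) \<le> w x"
    proof (rule block_avg_le[OF B(1) wm B(2) _ ne])
      fix y assume y: "y \<in> C i - C (Suc i)"
      have "C k \<subseteq> C (Suc i)" using staircaseD(3)[OF C, of "Suc i" k] \<open>i < k\<close> by auto
      then have "y \<in> space M - C k" using y down_set_subset_space[OF staircaseD(1)[OF C]] by blast
      then show "w y \<le> w x" using x by (intro decreasing_outside[OF w staircaseD(1)[OF C]]) auto
    qed
  qed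
next
  case False
  then have "n \<le> k" using \<open>i < k\<close> by auto
  then have "C k = {}" using staircaseD(3)[OF C, of n k] staircaseD(4)[OF C] by simp
  then show ?thesis by (simp add: block_avg_def)
qed

lemma averaging_decreasing:
  assumes C: "staircase n C" and w: "w \<in> decreasing"
  shows "staircase_averaging n C w \<in> decreasing"
  unfolding decreasing_def
proof (intro CollectI allI)
  fix c :: ennreal
  let ?B = "\<lambda>i. C i - C (Suc i)"
  let ?T = "staircase_averaging n C w"
  have fam: "finite {..<n}" "disjoint_family_on ?B {..<n}"
    using staircase_block_family[OF C] by (auto simp: block_family_def)
  \<comment> \<open>averages grow with the index, so the superlevel set contains \<open>C i\<close> with every step in it; empty steps carry no value\<close>
  define I where "I = {i. i < n \<and> ?B i \<noteq> {} \<and> c < block_avg M w (?B i)}"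
  have val: "?T x = block_avg M w (?B i)" if "i < n" "x \<in> ?B i" for i x
    unfolding averaging_def using block_sum_eq[OF fam, of i x] that by simp
  have "{x \<in> space M. c < ?T x} = (\<Union>i. if i \<in> I then C i else {})"
  proof (intro set_eqI iffI)
    fix x assume x: "x \<in> {x \<in> space M. c < ?T x}"
    have "\<exists>i<n. x \<in> ?B i"
    proof (rule ccontr)
      assume "\<not> ?thesis"
      then have "?T x = 0" unfolding averaging_def by (intro block_sum_eq_0) auto
      then show False using x by simp
    qed
    then obtain i where i: "i < n" "x \<in> ?B i" by auto
    then have "i \<in> I" using val[OF i] x by (auto simp: I_def)
    then show "x \<in> (\<Union>i. if i \<in> I then C i else {})" using i by auto
  next
    fix x assume "x \<in> (\<Union>i. if i \<in> I then C i else {})"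
    then obtain i where i: "i \<in> I" "x \<in> C i" by (auto split: if_splits)
    obtain k where k: "i \<le> k" "k < n" "x \<in> ?B k" using staircase_step[OF C i(2)] by blast
    have "block_avg M w (?B i) \<le> block_avg M w (?B k)"
      using block_avg_increasing[OF C w, of i k] i(1) k(1) by (cases "i = k") (auto simp: I_def)
    then have "c < block_avg M w (?B k)" using i(1) unfolding I_def by (blast intro: less_le_trans)
    then have "c < ?T x" by (simp only: val[OF k(2,3)])
    then show "x \<in> {x \<in> space M. c < ?T x}"
      using down_set_subset_space[OF staircaseD(1)[OF C]] i(2) by blast
  qed
  also have "\<dots> \<in> down_sets"
    using staircaseD(1)[OF C] down_sets_empty by (intro down_sets_UN) simp
  finally show "{x \<in> space M. c < ?T x} \<in> down_sets" .
qed

text \<open>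
  A decreasing function is larger on the initial part of \<open>B\<close> cut off by a down set than on the rest.
\<close>

lemma block_avg_le_initial_block_avg:
  assumes w: "w \<in> decreasing" and D: "D \<in> down_sets" and [measurable]: "B \<in> sets M"
    and fin: "emeasure M B < \<infinity>" and pos: "emeasure M B \<noteq> 0"
  shows "block_avg M w B \<le> block_avg M w (B \<inter> D)"
proof -
  let ?I = "\<lambda>A. \<integral>\<^sup>+x\<in>A. w x \<partial>M"
  have wm[measurable]: "w \<in> borel_measurable M" and [measurable]: "D \<in> sets M"
    using decreasing_measurable[OF w] D by auto
  have f1: "emeasure M (B \<inter> D) < \<infinity>" and f2: "emeasure M (B - D) < \<infinity>"
    using emeasure_mono[of "B \<inter> D" B M] emeasure_mono[of "B - D" B M] fin by (auto intro: le_less_trans)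
  have disj: "(B \<inter> D) \<inter> (B - D) = {}" and split: "(B \<inter> D) \<union> (B - D) = B" by auto
  let ?p = "block_avg M w (B \<inter> D)" and ?q = "block_avg M w (B - D)"
  have "?I (B) = ?I (B \<inter> D) + ?I (B - D)"
    using nn_integral_disjoint_pair[OF wm _ _ disj] by (simp add: split)
  also have "\<dots> = ?p * emeasure M (B \<inter> D) + ?q * emeasure M (B - D)"
    using f1 f2 by (simp add: block_avg_times_emeasure)
  also have "\<dots> \<le> ?p * emeasure M (B \<inter> D) + ?p * emeasure M (B - D)"
  proof (cases "B - D = {}")
    case False
    have "?q \<le> ?p"
    proof (rule le_block_avg[OF _ wm f1])
      fix x assume x: "x \<in> B \<inter> D"
      show "?q \<le> w x"
        using x sets.sets_into_space[OF \<open>B \<in> sets M\<close>]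
        by (intro block_avg_le[OF _ wm f2 _ False] decreasing_outside[OF w D]) auto
    qed simp
    then show ?thesis by (intro add_left_mono mult_right_mono) auto
  next
    case True
    show ?thesis unfolding True by simp
  qed
  also have "\<dots> = ?p * emeasure M B"
    using plus_emeasure[of "B \<inter> D" M "B - D"] disj by (simp add: split flip: distrib_left)
  finally have "?I (B) / emeasure M B \<le> ?p * emeasure M B / emeasure M B"
    by (rule divide_right_mono_ennreal)
  also have "\<dots> = ?p" using pos fin by (simp add: ennreal_times_divide[symmetric] less_top)
  finally show ?thesis using pos by (simp add: block_avg_def)
qed

lemma averaging_down_set_integral_le:
  assumes C: "staircase n C" and w: "w \<in> decreasing" and D: "D \<in> down_sets"
  shows "(\<integral>\<^sup>+x\<in>D. staircase_averaging n C w x \<partial>M) \<le> (\<integral>\<^sup>+x\<in>D. w x \<partial>M)"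
proof -
  let ?I = "\<lambda>h A. \<integral>\<^sup>+x\<in>A. h x \<partial>M"
  let ?B = "\<lambda>i. C i - C (Suc i)"
  have J: "block_family M {..<n} ?B" by (rule staircase_block_family[OF C])
  have wm[measurable]: "w \<in> borel_measurable M" and [measurable]: "D \<in> sets M"
    using decreasing_measurable[OF w] D by auto
  have B[measurable]: "?B i \<in> sets M" for i using staircaseD(1)[OF C] by auto
  have fin: "emeasure M (?B i) < \<infinity>" if "i < n" for i using J that by (auto simp: block_family_def)
  have "(\<integral>\<^sup>+x\<in>D. staircase_averaging n C w x \<partial>M) = (\<Sum>i<n. block_avg M w (?B i) * ?I (indicator D) (?B i))"
    using nn_integral_mult_averaging[OF J, of "indicator D" w] by (simp add: mult.commute)
  also have "\<dots> \<le> (\<Sum>i<n. \<integral>\<^sup>+x\<in>?B i \<inter> D. w x \<partial>M)"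
  proof (rule sum_mono)
    fix i assume i: "i \<in> {..<n}"
    have eq: "?I (indicator D) (?B i) = emeasure M (?B i \<inter> D)"
    proof -
      have "?I (indicator D) (?B i) = (\<integral>\<^sup>+x. indicator (?B i \<inter> D) x \<partial>M)"
        by (intro nn_integral_cong) (simp add: indicator_inter_arith mult.commute)
      then show ?thesis by (simp only: nn_integral_indicator sets.Int B \<open>D \<in> sets M\<close>)
    qed
    have fi: "emeasure M (?B i \<inter> D) < \<infinity>"
      using emeasure_mono[of "?B i \<inter> D" "?B i" M] fin[of i] i by (auto intro: le_less_trans)
    show "block_avg M w (?B i) * ?I (indicator D) (?B i) \<le> ?I w (?B i \<inter> D)"
    proof (cases "emeasure M (?B i) = 0")
      case True
      then have "emeasure M (?B i \<inter> D) = 0"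
        using emeasure_mono[of "?B i \<inter> D" "?B i" M] by simp
      then show ?thesis by (simp add: eq)
    next
      case False
      then have "block_avg M w (?B i) * emeasure M (?B i \<inter> D) \<le> block_avg M w (?B i \<inter> D) * emeasure M (?B i \<inter> D)"
        using fin[of i] i by (intro mult_right_mono block_avg_le_initial_block_avg w D) auto
      also have "\<dots> = ?I w (?B i \<inter> D)" using fi by (intro block_avg_times_emeasure) auto
      finally show ?thesis by (simp only: eq)
    qed
  qed
  also have "\<dots> = (\<integral>\<^sup>+x. (\<Sum>i<n. w x * indicator (?B i \<inter> D) x) \<partial>M)"
    by (subst nn_integral_sum) auto
  also have "\<dots> \<le> (\<integral>\<^sup>+x\<in>D. w x \<partial>M)"
  proof (rule nn_integral_mono)
    fix x
    have "(\<Sum>i<n. w x * indicator (?B i \<inter> D) x) = (\<Sum>i<n. w x * indicator (?B i) x) * indicator D x"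
      by (simp only: sum_distrib_right indicator_inter_arith mult.assoc)
    moreover have "(\<Sum>i<n. w x * indicator (?B i) x) \<le> w x"
    proof (cases "\<exists>i<n. x \<in> ?B i")
      case True
      then obtain i where "i \<in> {..<n}" "x \<in> ?B i" by auto
      then have "(\<Sum>i<n. w x * indicator (?B i) x) = w x"
        using J by (intro block_sum_eq) (auto simp: block_family_def)
      then show ?thesis by (simp only: order_refl)
    next
      case False
      then have "(\<Sum>i<n. w x * indicator (?B i) x) = 0" by (intro block_sum_eq_0) auto
      then show ?thesis by (simp only: zero_le)
    qed
    ultimately show "(\<Sum>i<n. w x * indicator (?B i \<inter> D) x) \<le> w x * indicator D x"
      by (simp only: mult_right_mono zero_le)
  qed
  finally show ?thesis .
qed

section \<open>Sets of maximal excess\<close>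

text \<open>
  The sets \<open>B\<close> at which \<open>\<integral>\<^sub>A (f - l)\<close>, as a function of the down set \<open>A\<close>, reaches a running maximum: no
  smaller down set does better.
\<close>

definition rising :: "('a \<Rightarrow> ennreal) \<Rightarrow> real \<Rightarrow> 'a set set" where
  "rising f l = {B \<in> down_sets. emeasure M B < \<infinity> \<and>
     (\<forall>A\<in>down_sets. ennreal l * emeasure M (B - A) \<le> (\<integral>\<^sup>+x\<in>B - A. f x \<partial>M))}"

lemma risingD:
  assumes "B \<in> rising f l"
  shows "B \<in> down_sets" "emeasure M B < \<infinity>"
    "A \<in> down_sets \<Longrightarrow> ennreal l * emeasure M (B - A) \<le> (\<integral>\<^sup>+x\<in>B - A. f x \<partial>M)"
  using assms by (auto simp: rising_def)

lemma rising_empty: "{} \<in> rising f l"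
  by (simp add: rising_def down_sets_empty)

lemma rising_antimono: "l \<le> l' \<Longrightarrow> B \<in> rising f l' \<Longrightarrow> B \<in> rising f l"
  unfolding rising_def using ennreal_leI[of l l'] by (auto intro: order_trans[OF mult_right_mono])

lemma rising_UN:
  assumes [measurable]: "f \<in> borel_measurable M" and B: "\<And>n::nat. B n \<in> rising f l"
    and fin: "emeasure M (\<Union>n. B n) < \<infinity>"
  shows "(\<Union>n. B n) \<in> rising f l"
  unfolding rising_def
proof (intro CollectI conjI ballI)
  let ?I = "\<lambda>A. \<integral>\<^sup>+x\<in>A. f x \<partial>M"
  show "(\<Union>n. B n) \<in> down_sets" by (intro down_sets_UN risingD(1)[OF B])
  show "emeasure M (\<Union>n. B n) < \<infinity>" by (rule fin)
  fix A assume A: "A \<in> down_sets"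
  define P where "P n = (\<Union>k\<le>n. B k)" for n
  have P: "P n \<in> rising f l" for n
    using chain_finite_Union[of B n, OF down_sets_chain[OF risingD(1)[OF B] risingD(1)[OF B]]] B
    by (auto simp: P_def)
  have [measurable]: "P n \<in> sets M" "A \<in> sets M" for n using risingD(1)[OF P] A by auto
  have "(\<Union>n. B n) - A = (\<Union>n. P n - A)" by (auto simp: P_def)
  also have "emeasure M \<dots> = (SUP n. emeasure M (P n - A))"
  proof (rule SUP_emeasure_incseq[symmetric])
    show "incseq (\<lambda>n. P n - A)" by (rule incseq_SucI) (auto simp: P_def atMost_Suc)
    have "P n - A \<in> sets M" for n by measurable
    then show "range (\<lambda>n. P n - A) \<subseteq> sets M" by blast
  qed
  also have "ennreal l * \<dots> = (SUP n. ennreal l * emeasure M (P n - A))"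
    by (simp add: SUP_mult_left_ennreal)
  also have "\<dots> \<le> ?I ((\<Union>n. B n) - A)"
  proof (rule SUP_least)
    fix n
    have "ennreal l * emeasure M (P n - A) \<le> ?I (P n - A)" by (rule risingD(3)[OF P A])
    also have "\<dots> \<le> ?I ((\<Union>n. B n) - A)"
      by (rule set_nn_integral_mono_set) (auto simp: P_def)
    finally show "ennreal l * emeasure M (P n - A) \<le> ?I ((\<Union>n. B n) - A)" .
  qed
  finally show "ennreal l * emeasure M ((\<Union>n. B n) - A) \<le> ?I ((\<Union>n. B n) - A)" .
qed

text \<open>
  Take sets whose measures approach the supremum of all measures. In a chain they exhaust every other
  member up to a null set.
\<close>

lemma rising_essential_union:
  "\<exists>B::nat \<Rightarrow> 'a set. (\<forall>n. B n \<in> rising f l) \<and> incseq B \<and> (\<forall>A\<in>rising f l. emeasure M (A - (\<Union>n. B n)) = 0)"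
proof -
  obtain m :: "nat \<Rightarrow> ennreal" where m: "range m \<subseteq> emeasure M ` rising f l" "Sup (emeasure M ` rising f l) = Sup (range m)"
    using ennreal_SUP_countable_SUP[of "rising f l" "emeasure M"] rising_empty by blast
  have "\<forall>n. \<exists>B. B \<in> rising f l \<and> m n = emeasure M B" using m(1) by blast
  from choice[OF this] obtain B where "\<forall>n. B n \<in> rising f l \<and> m n = emeasure M (B n)" ..
  then have B: "B n \<in> rising f l" "m n = emeasure M (B n)" for n by simp_all
  have chain: "B m \<subseteq> B n \<or> B n \<subseteq> B m" for m n by (intro down_sets_chain risingD(1)[OF B(1)])
  show ?thesis
  proof (intro exI[of _ "\<lambda>n. \<Union>k\<le>n. B k"] conjI allI ballI)
    show "(\<Union>k\<le>n. B k) \<in> rising f l" for n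
      using chain_finite_Union[of B n, OF chain] B(1) by auto
    show "incseq (\<lambda>n. \<Union>k\<le>n. B k)" by (rule incseq_SucI) (auto simp: atMost_Suc)
    have UB: "(\<Union>n. \<Union>k\<le>n. B k) = (\<Union>n. B n)" by auto
    have UD: "(\<Union>n. B n) \<in> down_sets" by (intro down_sets_UN risingD(1)[OF B(1)])
    fix A assume A: "A \<in> rising f l"
    show "emeasure M (A - (\<Union>n. \<Union>k\<le>n. B k)) = 0"
    proof (cases "A \<subseteq> (\<Union>n. B n)")
      case True
      then have "A - (\<Union>n. B n) = {}" by auto
      then show ?thesis by (simp only: UB emeasure_empty)
    next
      case False
      then have sub: "(\<Union>n. B n) \<subseteq> A" using down_sets_chain[OF UD risingD(1)[OF A]] by auto
      have s: "(\<Union>n. B n) \<in> sets M" "A \<in> sets M" using UD risingD(1)[OF A] by auto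
      have "emeasure M A \<le> Sup (emeasure M ` rising f l)" using A by (rule SUP_upper)
      also have "\<dots> \<le> emeasure M (\<Union>n. B n)"
        unfolding m(2) using s risingD(1)[OF B(1)] by (intro SUP_least) (auto simp: B(2) intro!: emeasure_mono)
      finally have "emeasure M A = emeasure M (\<Union>n. B n)"
        using emeasure_mono[OF sub s(2)] by simp
      then show ?thesis
        unfolding UB using emeasure_Diff[of M "\<Union>n. B n" A] sub s risingD(2)[OF A] by simp
    qed
  qed
qed

text \<open>
  Compactness of the chain. For a maximizing sequence \<open>A\<^sub>n\<close> the upper limit \<open>\<Inter>\<^sub>n \<Union>\<^sub>k A\<^sub>n\<^sub>+\<^sub>k\<close> is a
  maximizer: a finite union of members of a chain is one of them, so finite unions of later members are
  no worse than the worst of these, and \<open>G\<close> is continuous along monotone sequences.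
\<close>

lemma exists_maximal_excess:
  fixes l :: real
  assumes f[measurable]: "f \<in> borel_measurable M"
    and D: "D \<in> down_sets" "emeasure M D < \<infinity>" "(\<integral>\<^sup>+x\<in>D. f x \<partial>M) < \<infinity>"
    and E: "E \<in> down_sets" "E \<subseteq> D"
  defines "G \<equiv> \<lambda>A. measure (density M f) A - l * measure M A"
  shows "\<exists>A\<in>down_sets. E \<subseteq> A \<and> A \<subseteq> D \<and> (\<forall>A'\<in>down_sets. E \<subseteq> A' \<longrightarrow> A' \<subseteq> D \<longrightarrow> G A' \<le> G A)"
proof -
  let ?N = "density M f"
  define K where "K = {A \<in> down_sets. E \<subseteq> A \<and> A \<subseteq> D}"
  have KD: "A \<in> down_sets" "E \<subseteq> A" "A \<subseteq> D" if "A \<in> K" for A using that by (auto simp: K_def)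
  have Ks: "A \<in> sets M" if "A \<in> K" for A using KD(1)[OF that] by auto
  have Dm: "D \<in> sets M" using D by auto
  have finM: "emeasure M A \<noteq> \<infinity>" if "A \<in> K" for A
    using emeasure_mono[OF KD(3)[OF that] Dm] D(2) by (auto simp: top_unique)
  have finN: "emeasure ?N A \<noteq> \<infinity>" if "A \<in> K" for A
    using emeasure_mono[OF KD(3)[OF that], of ?N] Dm D(3) by (auto simp: top_unique emeasure_density)
  have "D \<in> K" using D E by (auto simp: K_def)
  have limI: "(\<lambda>n. G (A n)) \<longlonglongrightarrow> G (\<Union>n. A n)" if "\<And>n::nat. A n \<in> K" "incseq A" "(\<Union>n. A n) \<in> K" for A
    unfolding G_def using that Ks finM finN
    by (intro tendsto_diff tendsto_mult tendsto_const Lim_measure_incseq) auto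
  have limD: "(\<lambda>n. G (A n)) \<longlonglongrightarrow> G (\<Inter>n. A n)" if "\<And>n::nat. A n \<in> K" "decseq A" for A
    unfolding G_def using that Ks finM finN
    by (intro tendsto_diff tendsto_mult tendsto_const Lim_measure_decseq) auto
  have UNK: "(\<Union>n. A n) \<in> K" if "\<And>n::nat. A n \<in> K" for A
  proof -
    have "A n \<in> down_sets" "E \<subseteq> A n" "A n \<subseteq> D" for n using KD[OF that[of n]] by auto
    then show ?thesis using down_sets_UN[of A] unfolding K_def by blast
  qed
  have INK: "(\<Inter>n. A n) \<in> K" if "\<And>n::nat. A n \<in> K" for A
  proof -
    have "A n \<in> down_sets" "E \<subseteq> A n" "A n \<subseteq> D" for n using KD[OF that[of n]] by auto
    then show ?thesis using down_sets_INT[of A] unfolding K_def by blast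
  qed
  have bdd: "bdd_above (G ` K)"
  proof (rule bdd_aboveI2)
    fix A assume A: "A \<in> K"
    have "measure ?N A \<le> measure ?N D"
      using KD(3)[OF A] Dm finN[OF \<open>D \<in> K\<close>] Ks[OF A] by (intro measure_mono_fmeasurable) (auto simp: fmeasurable_def less_top)
    moreover have "measure M A \<le> measure M D"
      using KD(3)[OF A] Dm finM[OF \<open>D \<in> K\<close>] Ks[OF A] by (intro measure_mono_fmeasurable) (auto simp: fmeasurable_def less_top)
    then have "\<bar>l\<bar> * measure M A \<le> \<bar>l\<bar> * measure M D" by (intro mult_left_mono) auto
    moreover have "- l * measure M A \<le> \<bar>l\<bar> * measure M A" by (intro mult_right_mono) auto
    ultimately show "G A \<le> measure ?N D + \<bar>l\<bar> * measure M D" by (simp add: G_def)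
  qed
  define S where "S = (SUP A\<in>K. G A)"
  have "\<exists>A. A \<in> K \<and> S - 1 / Suc n < G A" for n :: nat
    using less_cSUP_iff[OF _ bdd, of "S - 1 / Suc n"] \<open>D \<in> K\<close> by (auto simp: S_def)
  then have "\<forall>n::nat. \<exists>A. A \<in> K \<and> S - 1 / Suc n < G A" by blast
  from choice[OF this] obtain A where "\<forall>n::nat. A n \<in> K \<and> S - 1 / Suc n < G (A n)" ..
  then have A: "A n \<in> K" "S - 1 / Suc n < G (A n)" for n by simp_all
  \<comment> \<open>the intersection of these unions is the upper limit of the maximizing sequence\<close>
  define Q where "Q n = (\<Union>k. A (n + k))" for n
  have QK: "Q n \<in> K" for n unfolding Q_def by (intro UNK A)
  have GQ: "S - 1 / Suc n \<le> G (Q n)" for n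
  proof -
    define P where "P j = (\<Union>k\<le>j. A (n + k))" for j
    have P: "\<exists>k. P j = A (n + k)" for j
      using chain_finite_Union[of "\<lambda>k. A (n + k)" j, OF down_sets_chain[OF KD(1)[OF A(1)] KD(1)[OF A(1)]]]
      by (auto simp: P_def)
    have QP: "Q n = (\<Union>j. P j)" by (auto simp: Q_def P_def)
    have PK: "P j \<in> K" for j using P[of j] A(1) by auto
    have "incseq P" by (rule incseq_SucI) (auto simp: P_def atMost_Suc)
    then have "(\<lambda>j. G (P j)) \<longlonglongrightarrow> G (Q n)" unfolding QP using PK UNK[OF PK] by (intro limI)
    moreover have "S - 1 / Suc n \<le> G (P j)" for j
    proof -
      obtain k where k: "P j = A (n + k)" using P by blast
      have "1 / Suc (n + k) \<le> 1 / Suc n" by (simp add: frac_le)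
      then show ?thesis using A(2)[of "n + k"] k by simp
    qed
    ultimately show ?thesis by (intro LIMSEQ_le_const) auto
  qed
  have "decseq Q"
    unfolding decseq_def
  proof (intro allI impI subsetI)
    fix m n x assume "m \<le> n" "x \<in> Q n"
    then obtain k where "x \<in> A (m + (n - m + k))" by (auto simp: Q_def)
    then show "x \<in> Q m" unfolding Q_def by blast
  qed
  then have "(\<lambda>n. G (Q n)) \<longlonglongrightarrow> G (\<Inter>n. Q n)" using QK by (intro limD)
  moreover have "(\<lambda>n. S - 1 / Suc n) \<longlonglongrightarrow> S - 0"
    by (intro tendsto_diff tendsto_const LIMSEQ_Suc[OF lim_1_over_n])
  ultimately have "S - 0 \<le> G (\<Inter>n. Q n)" using GQ by (intro LIMSEQ_le) auto
  then have "G A' \<le> G (\<Inter>n. Q n)" if "A' \<in> K" for A'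
    using cSUP_upper[OF that bdd] by (simp add: S_def)
  moreover have "(\<Inter>n. Q n) \<in> K" by (intro INK QK)
  ultimately show ?thesis by (intro bexI[of _ "\<Inter>n. Q n"]) (auto simp: K_def)
qed

text \<open>
  A set \<open>A\<close> between \<open>U\<close> and \<open>D\<close> of maximal excess \<open>\<integral>\<^sub>A (f - l)\<close> is rising, and so it exceeds \<open>U\<close> by a null
  set only. Hence \<open>U\<close> itself has maximal excess, and the excess of \<open>D\<close> over \<open>U\<close> cannot be positive.
\<close>

lemma integral_beyond_rising_le:
  assumes f[measurable]: "f \<in> borel_measurable M" and l: "0 \<le> l"
    and D: "D \<in> down_sets" "emeasure M D < \<infinity>" "(\<integral>\<^sup>+x\<in>D. f x \<partial>M) < \<infinity>"
    and U: "U \<in> down_sets" "emeasure M U < \<infinity> \<Longrightarrow> U \<in> rising f l"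
    and ess: "\<And>A. A \<in> rising f l \<Longrightarrow> emeasure M (A - U) = 0"
  shows "(\<integral>\<^sup>+x\<in>D - U. f x \<partial>M) \<le> ennreal l * emeasure M (D - U)"
proof (cases "D \<subseteq> U")
  case True
  then have "D - U = {}" by auto
  show ?thesis unfolding \<open>D - U = {}\<close> by simp
next
  case False
  then have UD: "U \<subseteq> D" using down_sets_chain[OF D(1) U(1)] by auto
  let ?N = "density M f"
  have s[measurable]: "D \<in> sets M" "U \<in> sets M" using D U by auto
  have finM: "emeasure M A < \<infinity>" if "A \<subseteq> D" for A
    using emeasure_mono[OF that s(1)] D(2) by (rule le_less_trans)
  have finN: "emeasure ?N A < \<infinity>" if "A \<subseteq> D" for A
    using emeasure_mono[OF that, of ?N] D(3) by (auto simp: emeasure_density intro: le_less_trans)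
  have Ur: "U \<in> rising f l" by (intro U finM UD)
  define G where "G A = measure ?N A - l * measure M A" for A
  obtain A where A: "A \<in> down_sets" "U \<subseteq> A" "A \<subseteq> D"
    and max: "\<forall>A'\<in>down_sets. U \<subseteq> A' \<longrightarrow> A' \<subseteq> D \<longrightarrow> G A' \<le> G A"
    using exists_maximal_excess[OF f D U(1) UD, of l, folded G_def] by (elim bexE conjE)
  have diff: "measure ?N (S - T) - l * measure M (S - T) = G S - G T"
    if "T \<subseteq> S" "S \<subseteq> D" "T \<in> sets M" "S \<in> sets M" for S T
  proof -
    have "measure ?N (S - T) = measure ?N S - measure ?N T"
      using that finN[of S] by (intro measure_Diff) (auto simp: less_top)
    moreover have "measure M (S - T) = measure M S - measure M T"
      using that finM[of S] by (intro measure_Diff) (auto simp: less_top)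
    ultimately have "measure ?N (S - T) - l * measure M (S - T)
        = measure ?N S - measure ?N T - (l * measure M S - l * measure M T)"
      by (simp only: right_diff_distrib)
    then show ?thesis by (simp add: G_def)
  qed
  have conv: "emeasure ?N S = ennreal (measure ?N S)" "emeasure M S = ennreal (measure M S)" if "S \<subseteq> D" for S
    using finM[OF that] finN[OF that] by (auto simp: emeasure_eq_ennreal_measure less_top)
  have As[measurable]: "A \<in> sets M" using A by auto
  have above: "ennreal l * emeasure M (A - A') \<le> emeasure ?N (A - A')" if A': "A' \<in> down_sets" "U \<subseteq> A'" for A'
  proof -
    have "G (A \<inter> A') \<le> G A" using A A' by (intro max[rule_format] down_sets_Int) auto
    then have "l * measure M (A - A \<inter> A') \<le> measure ?N (A - A \<inter> A')"
      using diff[of "A \<inter> A'" A] A A'(1) by auto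
    then have "ennreal (l * measure M (A - A')) \<le> ennreal (measure ?N (A - A'))"
      by (intro ennreal_leI) (simp add: Diff_Int)
    moreover have "A - A' \<subseteq> D" using A by auto
    ultimately show ?thesis using l by (simp add: conv ennreal_mult)
  qed
  have "A \<in> rising f l"
    unfolding rising_def
  proof (intro CollectI conjI ballI A(1) finM A(3))
    fix A' assume A': "A' \<in> down_sets"
    have [measurable]: "A' \<in> sets M" using A' by auto
    have "ennreal l * emeasure M (A - A') \<le> emeasure ?N (A - A')"
    proof (cases "U \<subseteq> A'")
      case True
      then show ?thesis by (rule above[OF A'])
    next
      case False
      then have "A' \<subseteq> U" using down_sets_chain[OF U(1) A'] by auto
      \<comment> \<open>above \<open>U\<close> maximality applies, below \<open>U\<close> the fact that \<open>U\<close> is rising\<close>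
      then have eq: "A - A' = (A - U) \<union> (U - A')" using A by auto
      have "emeasure M (A - A') = emeasure M (A - U) + emeasure M (U - A')"
        unfolding eq by (intro plus_emeasure[symmetric]) auto
      moreover have "emeasure ?N (A - A') = emeasure ?N (A - U) + emeasure ?N (U - A')"
        unfolding eq by (intro plus_emeasure[symmetric]) auto
      moreover have "ennreal l * emeasure M (U - A') \<le> emeasure ?N (U - A')"
        using risingD(3)[OF Ur A'] by (simp add: emeasure_density)
      ultimately show ?thesis
        using above[OF U(1)] by (simp add: distrib_left add_mono)
    qed
    then show "ennreal l * emeasure M (A - A') \<le> (\<integral>\<^sup>+x\<in>A - A'. f x \<partial>M)" by (simp add: emeasure_density)
  qed
  then have null: "emeasure M (A - U) = 0" by (rule ess)
  then have "emeasure ?N (A - U) = 0" by (simp add: emeasure_density nn_integral_null_set null_setsI)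
  with null have "G A = G U" using diff[of U A] A by (simp add: measure_def)
  moreover have "G D \<le> G A" using D UD by (intro max[rule_format]) auto
  ultimately have "measure ?N (D - U) \<le> l * measure M (D - U)" using diff[of U D] UD by simp
  then have "emeasure ?N (D - U) \<le> ennreal l * emeasure M (D - U)"
    using l conv[of "D - U"] by (simp add: Diff_subset ennreal_mult[symmetric] ennreal_leI)
  then show ?thesis by (simp add: emeasure_density)
qed

section \<open>Construction of the level function\<close>

lemma rising_finite_UN:
  assumes "finite K" "\<And>k. k \<in> K \<Longrightarrow> B k \<in> rising f l"
  shows "(\<Union>k\<in>K. B k) \<in> rising f l"
  using assms
proof (induction K rule: finite_induct)
  case empty
  then show ?case by (simp add: rising_empty)
next
  case (insert k K)
  then have IH: "(\<Union>k\<in>K. B k) \<in> rising f l" and k: "B k \<in> rising f l" by auto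
  have "B k \<subseteq> (\<Union>k\<in>K. B k) \<or> (\<Union>k\<in>K. B k) \<subseteq> B k"
    by (rule down_sets_chain[OF risingD(1)[OF k] risingD(1)[OF IH]])
  then have "(\<Union>k\<in>insert k K. B k) = (\<Union>k\<in>K. B k) \<or> (\<Union>k\<in>insert k K. B k) = B k" by auto
  then show ?case using IH k by (elim disjE) (simp_all only:)
qed

text \<open>
  Let \<open>L\<close> be the increasing list of the values \<open>q k\<close>, and let \<open>C i\<close> be the union of the \<open>B k\<close> with
  \<open>q k \<ge> L ! i\<close>. On the step \<open>C i - C (Suc i)\<close> the supremum is at most \<open>L ! i\<close>, while the mean of \<open>f\<close>
  there is at least \<open>L ! i\<close>, because \<open>C i\<close> is rising.
\<close>

lemma rising_step_le_staircase_averaging: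
  fixes q :: "'i \<Rightarrow> real"
  assumes [measurable]: "f \<in> borel_measurable M" "g \<in> borel_measurable M"
    and K: "finite K" and B: "\<And>k. k \<in> K \<Longrightarrow> B k \<in> rising f (q k)"
  shows "\<exists>n C. staircase n C \<and> (\<integral>\<^sup>+x. (SUP k\<in>K. ennreal (q k) * indicator (B k) x) * g x \<partial>M)
    \<le> (\<integral>\<^sup>+x. f x * staircase_averaging n C g x \<partial>M)"
proof -
  define L where "L = sorted_list_of_set (q ` K)"
  define n where "n = length L"
  have setL: "set L = q ` K" using K by (simp add: L_def)
  have sortedL: "L ! i \<le> L ! j" if "i \<le> j" "j < n" for i j
    using sorted_nth_mono[of L i j] that by (simp add: L_def n_def)
  define C where "C i = (if i < n then \<Union>k\<in>{k \<in> K. L ! i \<le> q k}. B k else {})" for i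
  have Cr: "C i \<in> rising f (L ! i)" if "i < n" for i
    using that K B by (auto simp: C_def intro!: rising_finite_UN intro: rising_antimono)
  have C: "staircase n C"
    unfolding staircase_def
  proof (intro conjI allI)
    show "C i \<in> down_sets" "emeasure M (C i) < \<infinity>" for i
      using risingD(1,2)[OF Cr[of i]] by (cases "i < n"; simp add: C_def down_sets_empty)+
    show "decseq C" unfolding decseq_Suc_iff
    proof (intro allI subsetI)
      fix i x assume "x \<in> C (Suc i)"
      then have "Suc i < n" by (auto simp: C_def split: if_splits)
      then have "L ! i \<le> L ! Suc i" by (intro sortedL) auto
      then show "x \<in> C i" using \<open>x \<in> C (Suc i)\<close> \<open>Suc i < n\<close> by (auto simp: C_def)
    qed
    show "C n = {}" by (simp add: C_def)
  qed
  let ?B = "\<lambda>i. C i - C (Suc i)"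
  let ?I = "\<lambda>h A. \<integral>\<^sup>+x\<in>A. h x \<partial>M"
  let ?t = "\<lambda>x. \<Sum>i<n. ennreal (L ! i) * indicator (?B i) x"
  have J: "block_family M {..<n} ?B" by (rule staircase_block_family[OF C])
  have B'[measurable]: "?B i \<in> sets M" for i using staircaseD(1)[OF C] by auto
  have fin: "emeasure M (?B i) < \<infinity>" if "i < n" for i using J that by (auto simp: block_family_def)
  have le: "(SUP k\<in>K. ennreal (q k) * indicator (B k) x) \<le> ?t x" for x
  proof (rule SUP_least)
    fix k assume k: "k \<in> K"
    show "ennreal (q k) * indicator (B k) x \<le> ?t x"
    proof (cases "x \<in> B k")
      case True
      have "q k \<in> set L" using setL k by auto
      then obtain j where j: "j < n" "L ! j = q k" unfolding n_def in_set_conv_nth by blast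
      have "x \<in> C j" using True k j by (auto simp: C_def)
      then obtain i where i: "j \<le> i" "i < n" "x \<in> ?B i" using staircase_step[OF C] by blast
      have "ennreal (q k) \<le> ennreal (L ! i)" using sortedL[OF i(1,2)] j by (simp add: ennreal_leI)
      moreover have "?t x = ennreal (L ! i)"
        using J i by (intro block_sum_eq) (auto simp: block_family_def)
      ultimately show ?thesis using True by simp
    qed simp
  qed
  have "(\<integral>\<^sup>+x. (SUP k\<in>K. ennreal (q k) * indicator (B k) x) * g x \<partial>M)
      \<le> (\<integral>\<^sup>+x. ?t x * g x \<partial>M)"
    by (intro nn_integral_mono mult_right_mono le) simp
  also have "\<dots> = (\<integral>\<^sup>+x. (\<Sum>i<n. ennreal (L ! i) * (g x * indicator (?B i) x)) \<partial>M)"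
    by (simp only: sum_distrib_left mult_ac)
  also have "\<dots> = (\<Sum>i<n. ennreal (L ! i) * ?I g (?B i))"
    by (subst nn_integral_sum) (auto simp: nn_integral_cmult)
  also have "\<dots> \<le> (\<Sum>i<n. block_avg M g (?B i) * ?I f (?B i))"
  proof (rule sum_mono)
    fix i assume i: "i \<in> {..<n}"
    have "ennreal (L ! i) * ?I g (?B i) = block_avg M g (?B i) * (ennreal (L ! i) * emeasure M (?B i))"
      using fin[of i] i by (subst block_avg_times_emeasure[symmetric]) (auto simp: mult_ac)
    also have "\<dots> \<le> block_avg M g (?B i) * ?I f (?B i)"
      using i by (intro mult_left_mono risingD(3)[OF Cr staircaseD(1)[OF C]]) auto
    finally show "ennreal (L ! i) * ?I g (?B i) \<le> block_avg M g (?B i) * ?I f (?B i)" .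
  qed
  also have "\<dots> = (\<integral>\<^sup>+x. f x * staircase_averaging n C g x \<partial>M)"
    by (rule nn_integral_mult_averaging[OF J, symmetric]) measurable
  finally show ?thesis using C by blast
qed

text \<open>
  The last condition says that \<open>\<integral> F g\<close> is at most the supremum of \<open>\<integral> f (T g)\<close> over all staircase
  averagings \<open>T\<close>. It is required for all measurable \<open>g\<close>: decreasing \<open>g\<close> identify \<open>F\<close> as a level
  function, and arbitrary \<open>g\<close> show that passing from \<open>f\<close> to \<open>F\<close> does not increase the norm of \<open>X'\<close>.
\<close>

definition level_majorant :: "('a \<Rightarrow> ennreal) \<Rightarrow> ('a \<Rightarrow> ennreal) \<Rightarrow> bool" where
  "level_majorant f F \<longleftrightarrow>
     F \<in> decreasing \<and>
     (\<forall>D\<in>down_sets. (\<integral>\<^sup>+x\<in>D. f x \<partial>M) \<le> (\<integral>\<^sup>+x\<in>D. F x \<partial>M)) \<and>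
     (\<forall>g\<in>borel_measurable M. \<forall>r.
        (\<forall>n C. staircase n C \<longrightarrow> (\<integral>\<^sup>+x. f x * staircase_averaging n C g x \<partial>M) \<le> r) \<longrightarrow>
        (\<integral>\<^sup>+x. F x * g x \<partial>M) \<le> r)"

lemma level_majorantD:
  assumes "level_majorant f F"
  shows "F \<in> decreasing"
    and "D \<in> down_sets \<Longrightarrow> (\<integral>\<^sup>+x\<in>D. f x \<partial>M) \<le> (\<integral>\<^sup>+x\<in>D. F x \<partial>M)"
    and "g \<in> borel_measurable M \<Longrightarrow>
      (\<And>n C. staircase n C \<Longrightarrow> (\<integral>\<^sup>+x. f x * staircase_averaging n C g x \<partial>M) \<le> r) \<Longrightarrow>
      (\<integral>\<^sup>+x. F x * g x \<partial>M) \<le> r"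
  using assms by (simp_all add: level_majorant_def)

text \<open>
  \<open>F\<close> is the supremum of \<open>q\<close> on \<open>E\<^sub>q\<close> over the positive rationals \<open>q\<close>, where \<open>E\<^sub>q\<close> is the essential union
  of the sets rising at level \<open>q\<close>. The sets \<open>E\<^sub>q\<close> are nested only up to null sets; the unions \<open>U l\<close> of
  all \<open>E\<^sub>q\<close> with \<open>q \<ge> l\<close> are nested exactly and serve as the level sets of \<open>F\<close>. Cutting \<open>D\<close> along the
  grid of levels \<open>e, 2 e, 3 e, \<dots>\<close> gives \<open>\<integral>\<^sub>D f \<le> \<integral>\<^sub>D F + e \<mu>(D)\<close>. Approximating each \<open>E\<^sub>q\<close> from
  within by rising sets gives the bound by averages.
\<close>

lemma exists_level_majorant:
  assumes f[measurable]: "f \<in> borel_measurable M"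
    and locint: "\<And>D. D \<in> down_sets \<Longrightarrow> emeasure M D < \<infinity> \<Longrightarrow> (\<integral>\<^sup>+x\<in>D. f x \<partial>M) < \<infinity>"
  shows "\<exists>F. level_majorant f F"
proof -
  let ?I = "\<lambda>h A. \<integral>\<^sup>+x\<in>A. h x \<partial>M"
  define Q where "Q = {x \<in> \<rat>. (0::real) < x}"
  define q where "q = from_nat_into Q"
  have "countable Q" unfolding Q_def by (rule countable_subset[OF _ countable_rat]) auto
  moreover have "(1::real) \<in> Q" by (simp add: Q_def)
  ultimately have range: "range q = Q" unfolding q_def by (intro range_from_nat_into) auto
  have q: "0 < q k" for k using range Q_def by blast
  have "\<forall>k. \<exists>B::nat \<Rightarrow> 'a set. (\<forall>n. B n \<in> rising f (q k)) \<and> incseq B \<and>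
      (\<forall>A\<in>rising f (q k). emeasure M (A - (\<Union>n. B n)) = 0)"
    by (intro allI rising_essential_union)
  from choice[OF this] obtain B :: "nat \<Rightarrow> nat \<Rightarrow> 'a set" where
    "\<forall>k. (\<forall>n. B k n \<in> rising f (q k)) \<and> incseq (B k) \<and>
      (\<forall>A\<in>rising f (q k). emeasure M (A - (\<Union>n. B k n)) = 0)" ..
  then have B: "B k n \<in> rising f (q k)" "incseq (B k)"
    "A \<in> rising f (q k) \<Longrightarrow> emeasure M (A - (\<Union>n. B k n)) = 0" for k n A by simp_all
  define E where "E k = (\<Union>n. B k n)" for k
  have E: "E k \<in> down_sets" for k unfolding E_def by (intro down_sets_UN risingD(1)[OF B(1)])
  define F where "F x = (SUP k. ennreal (q k) * indicator (E k) x)" for x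
  have F_dec: "F \<in> decreasing"
    unfolding decreasing_def
  proof (intro CollectI allI)
    fix c
    have "{x \<in> space M. c < F x} = (\<Union>k. {x \<in> space M. c < ennreal (q k) * indicator (E k) x})"
      by (auto simp: F_def less_SUP_iff)
    also have "\<dots> \<in> down_sets"
      by (intro down_sets_UN decreasing_superlevel scaled_indicator_decreasing E)
    finally show "{x \<in> space M. c < F x} \<in> down_sets" .
  qed
  have Fm[measurable]: "F \<in> borel_measurable M" by (rule decreasing_measurable[OF F_dec])
  define U where "U l = (\<Union>k. if l \<le> q k then E k else {})" for l
  have U: "U l \<in> down_sets" for l
    unfolding U_def using E down_sets_empty by (intro down_sets_UN) simp
  have U_antimono: "U l' \<subseteq> U l" if "l \<le> l'" for l l'
    using that by (force simp: U_def split: if_splits)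
  have U_le: "ennreal l \<le> F x" if x: "x \<in> U l" for x l
  proof -
    obtain k where k: "l \<le> q k" "x \<in> E k" using x by (auto simp: U_def split: if_splits)
    have "ennreal l \<le> ennreal (q k) * indicator (E k) x" using k by (simp add: ennreal_leI)
    also have "\<dots> \<le> F x" unfolding F_def by (rule SUP_upper) simp
    finally show ?thesis .
  qed
  have U_rising: "U l \<in> rising f l" if fin: "emeasure M (U l) < \<infinity>" for l
  proof -
    define P where "P j = (if l \<le> q (fst (prod_decode j)) then B (fst (prod_decode j)) (snd (prod_decode j)) else {})" for j
    have P: "P j \<in> rising f l" for j
      using rising_antimono[OF _ B(1)] by (simp add: P_def rising_empty)
    have "U l = (\<Union>j. P j)"
    proof (intro set_eqI iffI)
      fix x assume "x \<in> U l"
      then obtain k n where "l \<le> q k" "x \<in> B k n" by (auto simp: U_def E_def split: if_splits)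
      then have "x \<in> P (prod_encode (k, n))" by (simp add: P_def)
      then show "x \<in> (\<Union>j. P j)" by blast
    next
      fix x assume "x \<in> (\<Union>j. P j)"
      then show "x \<in> U l" by (auto simp: U_def E_def P_def split: if_splits)
    qed
    then show ?thesis using rising_UN[OF f P] fin by simp
  qed
  have U_ess: "emeasure M (A - U l) = 0" if A: "A \<in> rising f l" and l: "l \<in> Q" for A l
  proof -
    obtain k where k: "l = q k" using l range by blast
    have "A - U l \<subseteq> A - E k" by (auto simp: U_def k)
    then have "emeasure M (A - U l) \<le> emeasure M (A - E k)"
      using risingD(1)[OF A] E by (intro emeasure_mono) auto
    then show ?thesis using B(3)[of A k] A by (simp add: E_def k)
  qed
  have beyond: "?I f (D - U l) \<le> ennreal l * emeasure M (D - U l)"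
    if D: "D \<in> down_sets" "emeasure M D < \<infinity>" and l: "l \<in> Q" for D l
    using l by (intro integral_beyond_rising_le[OF f _ D locint[OF D] U U_rising U_ess]) (auto simp: Q_def)
  have finite_case: "?I f D \<le> ?I F D"
    if D: "D \<in> down_sets" "emeasure M D < \<infinity>" for D
  proof -
    have [measurable]: "D \<in> sets M" "U l \<in> sets M" for l using D U by auto
    have grid: "?I f D \<le> ?I F D + ennreal e * emeasure M D" if e: "e \<in> Q" for e
    proof -
      have e0: "0 < e" using e by (simp add: Q_def)
      have eQ: "real (Suc N) * e \<in> Q" for N using e by (auto simp: Q_def)
      let ?h = "\<lambda>x. F x + ennreal e"
      let ?U = "\<lambda>N. U (real (Suc N) * e)"
      have below: "?I f (D - ?U N) \<le> ?I ?h (D - ?U N)" for N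
      proof (induction N)
        case 0
        have "?I f (D - ?U 0) \<le> ennreal e * emeasure M (D - ?U 0)"
          using beyond[OF D eQ[of 0]] by simp
        also have "\<dots> = (\<integral>\<^sup>+x\<in>D - ?U 0. ennreal e \<partial>M)" by (simp add: nn_integral_cmult_indicator)
        also have "\<dots> \<le> ?I ?h (D - ?U 0)" by (intro nn_integral_mono mult_right_mono) auto
        finally show ?case .
      next
        case (Suc N)
        let ?V = "D \<inter> ?U N - ?U (Suc N)"
        have sub: "?U (Suc N) \<subseteq> ?U N" using e0 by (intro U_antimono mult_right_mono) auto
        then have split: "(D - ?U N) \<union> ?V = D - ?U (Suc N)" and disj: "(D - ?U N) \<inter> ?V = {}" by auto
        have VD: "D \<inter> ?U N \<in> down_sets" "emeasure M (D \<inter> ?U N) < \<infinity>"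
          using D U emeasure_mono[of "D \<inter> ?U N" D M] by (auto intro: down_sets_Int le_less_trans)
        have "?I f ?V \<le> ennreal (real (Suc (Suc N)) * e) * emeasure M ?V"
          by (rule beyond[OF VD eQ])
        also have "\<dots> = (\<integral>\<^sup>+x\<in>?V. ennreal (real (Suc (Suc N)) * e) \<partial>M)" 
          by (rule nn_integral_cmult_indicator[symmetric]) measurable
        also have "\<dots> \<le> ?I ?h ?V"
        proof (rule nn_integral_mono)
          fix x
          show "ennreal (real (Suc (Suc N)) * e) * indicator ?V x \<le> ?h x * indicator ?V x"
          proof (cases "x \<in> ?V")
            case True
            have "real (Suc (Suc N)) * e = real (Suc N) * e + e" by (simp add: algebra_simps)
            then have "ennreal (real (Suc (Suc N)) * e) = ennreal (real (Suc N) * e) + ennreal e"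
              using e0 by (simp only: ennreal_plus) simp
            also have "\<dots> \<le> ?h x" using True by (intro add_right_mono U_le) auto
            finally show ?thesis using True by simp
          qed simp
        qed
        finally have V: "?I f ?V \<le> ?I ?h ?V" .
        have add: "?I k (D - ?U (Suc N)) = ?I k (D - ?U N) + ?I k ?V"
          if "k \<in> borel_measurable M" for k
          unfolding split[symmetric] using disj by (intro nn_integral_disjoint_pair that) auto
        have hm: "?h \<in> borel_measurable M" by measurable
        show ?case unfolding add[OF f] add[OF hm] by (intro add_mono Suc V)
      qed
      \<comment> \<open>the part of \<open>D\<close> where \<open>F\<close> is infinite, which the grid never reaches\<close>
      define W where "W = D \<inter> (\<Inter>N. ?U N)"
      have Ws[measurable]: "W \<in> sets M" unfolding W_def by measurable
      have h_int: "?I ?h D = ?I F D + ennreal e * emeasure M D"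
        by (simp add: distrib_right nn_integral_add nn_integral_cmult_indicator)
      have "?I f D \<le> ?I ?h D"
      proof (cases "emeasure M W = 0")
        case True
        have DW: "D - W = (\<Union>N. D - ?U N)" by (auto simp: W_def)
        have inc: "incseq (\<lambda>N. D - ?U N)"
        proof (rule incseq_SucI)
          fix N
          have "?U (Suc N) \<subseteq> ?U N" using e0 by (intro U_antimono mult_right_mono) auto
          then show "D - ?U N \<subseteq> D - ?U (Suc N)" by auto
        qed
        have "AE x in M. x \<notin> W" using True by (intro AE_not_in null_setsI) auto
        then have "?I f D = ?I f (D - W)"
          by (intro nn_integral_cong_AE) (auto simp: indicator_def elim!: eventually_mono)
        also have "\<dots> = (SUP N. \<integral>\<^sup>+x\<in>D - ?U N. f x \<partial>M)"
          unfolding DW by (intro set_nn_integral_INC f inc) auto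
        also have "\<dots> \<le> ?I ?h D"
        proof (rule SUP_least)
          fix N
          have "?I ?h (D - ?U N) \<le> ?I ?h D" by (rule set_nn_integral_mono_set) auto
          with below[of N] show "?I f (D - ?U N) \<le> ?I ?h D" by (rule order_trans)
        qed
        finally show ?thesis .
      next
        case False
        have top: "F x = \<infinity>" if x: "x \<in> W" for x
        proof (rule ccontr)
          assume "F x \<noteq> \<infinity>"
          then obtain a where a: "F x = ennreal a" "0 \<le> a" by (cases "F x") auto
          obtain N where N: "a < real N * e" using reals_Archimedean3[OF e0] by blast
          have "ennreal (real (Suc N) * e) \<le> ennreal a" using U_le[of x "real (Suc N) * e"] x a by (auto simp: W_def)
          then have "real (Suc N) * e \<le> a" using a by (simp add: ennreal_le_iff)
          moreover have "real N * e \<le> real (Suc N) * e" using e0 by (intro mult_right_mono) auto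
          ultimately show False using N by linarith
        qed
        have "\<infinity> = (\<integral>\<^sup>+x. \<infinity> * indicator W x \<partial>M)"
          using False by (subst nn_integral_cmult_indicator) (simp_all add: ennreal_top_mult)
        also have "\<dots> \<le> ?I ?h D"
          using top by (intro nn_integral_mono) (auto simp: indicator_def W_def)
        finally show ?thesis by (simp add: top_unique)
      qed
      then show ?thesis by (simp only: h_int)
    qed
    obtain d where d: "emeasure M D = ennreal d" "0 \<le> d" using D(2) by (cases "emeasure M D") auto
    show ?thesis
    proof (rule ennreal_le_epsilon)
      fix \<epsilon> :: real assume eps: "0 < \<epsilon>"
      obtain e where e: "e \<in> \<rat>" "0 < e" "e < \<epsilon> / (d + 1)"
        using Rats_dense_in_real[of 0 "\<epsilon> / (d + 1)"] eps d by auto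
      have "e * d \<le> e * (d + 1)" using e by (intro mult_left_mono) auto
      also have "\<dots> < \<epsilon>" using e(3) d by (simp add: field_simps)
      finally have "ennreal e * ennreal d \<le> ennreal \<epsilon>"
        using e d by (simp add: ennreal_mult[symmetric] ennreal_leI)
      then have "?I F D + ennreal e * emeasure M D \<le> ?I F D + ennreal \<epsilon>"
        unfolding d by (rule add_left_mono)
      then show "?I f D \<le> ?I F D + ennreal \<epsilon>"
        using grid[of e] e by (auto simp: Q_def intro: order_trans)
    qed
  qed
  have "level_majorant f F"
    unfolding level_majorant_def
  proof (intro conjI ballI allI impI F_dec)
    fix D assume D: "D \<in> down_sets"
    have [measurable]: "D \<in> sets M" using D by auto
    obtain A where A: "\<And>n. A n \<in> \<A>" "incseq A" "(\<Union>n. A n) = space M" using core_exhaustion by blast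
    have As: "D \<inter> A n \<in> down_sets" for n by (intro down_sets_Int D core_down_set A)
    have "D = (\<Union>n. D \<inter> A n)" using A(3) down_set_subset_space[OF D] by auto
    then have "?I f D = (\<integral>\<^sup>+x\<in>(\<Union>n. D \<inter> A n). f x \<partial>M)" by simp
    also have "\<dots> = (SUP n. \<integral>\<^sup>+x\<in>D \<inter> A n. f x \<partial>M)"
      using A(2) As by (intro set_nn_integral_INC f) (auto simp: incseq_def)
    also have "\<dots> \<le> ?I F D"
    proof (rule SUP_least)
      fix n
      have "emeasure M (D \<inter> A n) \<le> emeasure M (A n)"
        using A(1)[of n] core_sets by (intro emeasure_mono) auto
      then have "emeasure M (D \<inter> A n) < \<infinity>" using core_finite[OF A(1)[of n]] by (rule le_less_trans)
      then have "?I f (D \<inter> A n) \<le> ?I F (D \<inter> A n)" by (rule finite_case[OF As])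
      also have "\<dots> \<le> ?I F D" by (rule set_nn_integral_mono_set) auto
      finally show "?I f (D \<inter> A n) \<le> ?I F D" .
    qed
    finally show "?I f D \<le> ?I F D" .
  next
    fix g r assume g[measurable]: "g \<in> borel_measurable M"
      and bound: "\<forall>n C. staircase n C \<longrightarrow> (\<integral>\<^sup>+x. f x * staircase_averaging n C g x \<partial>M) \<le> r"
    define s where "s n x = (SUP k\<in>{..<n}. ennreal (q k) * indicator (B k n) x)" for n x
    have [measurable]: "B k n \<in> sets M" for k n using risingD(1)[OF B(1)] by auto
    have sm[measurable]: "s n \<in> borel_measurable M" for n unfolding s_def[abs_def] by measurable
    have s_inc: "incseq (\<lambda>n x. s n x * g x)"
    proof (rule incseq_SucI, rule le_funI)
      fix n x
      have "s n x \<le> s (Suc n) x"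
        unfolding s_def
      proof (rule SUP_mono)
        fix k assume k: "k \<in> {..<n}"
        have "B k n \<subseteq> B k (Suc n)" using B(2)[of k] by (auto simp: incseq_Suc_iff)
        then have "ennreal (q k) * indicator (B k n) x \<le> ennreal (q k) * indicator (B k (Suc n)) x"
          by (intro mult_left_mono) (auto simp: indicator_def)
        then show "\<exists>m\<in>{..<Suc n}. ennreal (q k) * indicator (B k n) x \<le> ennreal (q m) * indicator (B m (Suc n)) x"
          using k by (intro bexI[of _ k]) auto
      qed
      then show "s n x * g x \<le> s (Suc n) x * g x" by (rule mult_right_mono) simp
    qed
    have F_le: "F x \<le> (SUP n. s n x)" for x
      unfolding F_def
    proof (rule SUP_least)
      fix k
      show "ennreal (q k) * indicator (E k) x \<le> (SUP n. s n x)"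
      proof (cases "x \<in> E k")
        case True
        then obtain n where n: "x \<in> B k n" by (auto simp: E_def)
        let ?n = "max n (Suc k)"
        have "B k n \<subseteq> B k ?n" using B(2)[of k] by (simp add: incseq_def)
        then have "ennreal (q k) * indicator (E k) x \<le> ennreal (q k) * indicator (B k ?n) x"
          using n True by auto
        also have "\<dots> \<le> s ?n x" unfolding s_def by (rule SUP_upper) auto
        also have "\<dots> \<le> (SUP n. s n x)" by (rule SUP_upper) simp
        finally show ?thesis .
      qed simp
    qed
    have "(\<integral>\<^sup>+x. F x * g x \<partial>M) \<le> (\<integral>\<^sup>+x. (SUP n. s n x) * g x \<partial>M)"
      by (intro nn_integral_mono mult_right_mono F_le) simp
    also have "\<dots> = (\<integral>\<^sup>+x. (SUP n. s n x * g x) \<partial>M)"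
      by (simp add: SUP_mult_right_ennreal)
    also have "\<dots> = (SUP n. \<integral>\<^sup>+x. s n x * g x \<partial>M)"
      by (rule nn_integral_monotone_convergence_SUP[OF s_inc]) measurable
    also have "\<dots> \<le> r"
    proof (rule SUP_least)
      fix n
      obtain m C where C: "staircase m C"
        "(\<integral>\<^sup>+x. s n x * g x \<partial>M) \<le> (\<integral>\<^sup>+x. f x * staircase_averaging m C g x \<partial>M)"
        using rising_step_le_staircase_averaging[OF f g, of "{..<n}" "\<lambda>k. B k n" q] B(1) unfolding s_def by blast
      from C(2) bound[rule_format, OF C(1)] show "(\<integral>\<^sup>+x. s n x * g x \<partial>M) \<le> r" by (rule order_trans)
    qed
    finally show "(\<integral>\<^sup>+x. F x * g x \<partial>M) \<le> r" .
  qed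
  then show ?thesis by (intro exI[of "level_majorant f" F])
qed

section \<open>The down space\<close>

text \<open>
  The right-hand side of the definition of a level function, for functions with values in the extended
  nonnegative reals.
\<close>

definition level_pairing :: "('a \<Rightarrow> ereal) \<Rightarrow> ('a \<Rightarrow> ennreal) \<Rightarrow> ennreal" where
  "level_pairing f w =
     (SUP v \<in> {v \<in> decreasing. \<forall>A\<in>\<A>. (\<integral>\<^sup>+x\<in>A. v x \<partial>M) \<le> (\<integral>\<^sup>+x\<in>A. w x \<partial>M)}.
        abs_pairing M f v)"

lemma core_decreasing_nonneg: "g \<in> core_decreasing M \<A> \<Longrightarrow> x \<in> space M \<Longrightarrow> 0 \<le> g x"
  by (simp add: core_decreasing_def)

lemma core_decreasing_measurable:
  assumes g: "g \<in> core_decreasing M \<A>"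
  shows "g \<in> borel_measurable M"
proof (rule measurableI)
  fix B :: "ereal set" assume "B \<in> sets borel"
  then have "g -` B \<inter> space M \<in> sigma_ring \<A>" using g by (simp add: core_decreasing_def)
  then show "g -` B \<inter> space M \<in> sets M" using sigma_sets_core by (auto simp: sigma_ring_full[OF full])
qed simp

lemma nn_integral_mult_core_decreasing:
  assumes "h \<in> core_decreasing M \<A>" "\<And>x. x \<in> space M \<Longrightarrow> 0 \<le> k x"
  shows "(\<integral>\<^sup>+x. e2ennreal (k x * h x) \<partial>M) = (\<integral>\<^sup>+x. e2ennreal (k x) * e2ennreal (h x) \<partial>M)"
proof (rule nn_integral_cong)
  fix x assume x: "x \<in> space M"
  show "e2ennreal (k x * h x) = e2ennreal (k x) * e2ennreal (h x)"
    using e2ennreal_abs_mult[of "k x" "h x"] assms(2)[OF x] core_decreasing_nonneg[OF assms(1) x]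
    by (simp add: zero_le_mult_iff)
qed

lemma is_level_function_iff:
  "is_level_function M \<A> f fo \<longleftrightarrow>
     fo \<in> core_decreasing M \<A> \<and>
     (\<forall>w\<in>decreasing. (\<integral>\<^sup>+x. e2ennreal (fo x) * w x \<partial>M) = level_pairing f w)"
proof -
  have sup: "(SUP h \<in> {h \<in> core_decreasing M \<A>. \<forall>A\<in>\<A>.
        (\<integral>\<^sup>+x\<in>A. e2ennreal (h x) \<partial>M) \<le> (\<integral>\<^sup>+x\<in>A. e2ennreal (g x) \<partial>M)}.
        \<integral>\<^sup>+x. e2ennreal (\<bar>f x\<bar> * h x) \<partial>M) = level_pairing f (\<lambda>x. e2ennreal (g x))" (is "Sup (?I ` ?H) = _") for g
    unfolding level_pairing_def
  proof (rule antisym)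
    let ?J = "\<lambda>v. abs_pairing M f v"
    let ?V = "{v \<in> decreasing. \<forall>A\<in>\<A>. (\<integral>\<^sup>+x\<in>A. v x \<partial>M) \<le> (\<integral>\<^sup>+x\<in>A. e2ennreal (g x) \<partial>M)}"
    have eq: "?I h = ?J (\<lambda>x. e2ennreal (h x))" if "h \<in> core_decreasing M \<A>" for h
      using nn_integral_mult_core_decreasing[OF that, of "\<lambda>x. \<bar>f x\<bar>"] by simp
    show "Sup (?I ` ?H) \<le> Sup (?J ` ?V)"
    proof (rule SUP_least)
      fix h assume h: "h \<in> ?H"
      then have "(\<lambda>x. e2ennreal (h x)) \<in> ?V" using core_decreasing_imp_decreasing by simp
      then have "?J (\<lambda>x. e2ennreal (h x)) \<le> Sup (?J ` ?V)" by (rule SUP_upper)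
      then show "?I h \<le> Sup (?J ` ?V)" using eq h by simp
    qed
    show "Sup (?J ` ?V) \<le> Sup (?I ` ?H)"
    proof (rule SUP_least)
      fix v assume v: "v \<in> ?V"
      let ?h = "\<lambda>x. enn2ereal (v x)"
      have h: "?h \<in> core_decreasing M \<A>" using v decreasing_imp_core_decreasing by simp
      have "?h \<in> ?H" using v h by simp
      then have "?I ?h \<le> Sup (?I ` ?H)" by (rule SUP_upper)
      then show "?J v \<le> Sup (?I ` ?H)" using eq[OF h] by simp
    qed
  qed
  have int: "(\<integral>\<^sup>+x. e2ennreal (fo x * g x) \<partial>M) = (\<integral>\<^sup>+x. e2ennreal (fo x) * e2ennreal (g x) \<partial>M)"
    if "fo \<in> core_decreasing M \<A>" "g \<in> core_decreasing M \<A>" for g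
    using that core_decreasing_nonneg by (intro nn_integral_mult_core_decreasing) auto
  show ?thesis
  proof (intro iffI conjI)
    assume lev: "is_level_function M \<A> f fo"
    then show fo: "fo \<in> core_decreasing M \<A>" by (simp add: is_level_function_def)
    show "\<forall>w\<in>decreasing. (\<integral>\<^sup>+x. e2ennreal (fo x) * w x \<partial>M) = level_pairing f w"
    proof
      fix w assume "w \<in> decreasing"
      then have g: "(\<lambda>x. enn2ereal (w x)) \<in> core_decreasing M \<A>" by (rule decreasing_imp_core_decreasing)
      have "(\<integral>\<^sup>+x. e2ennreal (fo x * enn2ereal (w x)) \<partial>M) = level_pairing f (\<lambda>x. e2ennreal (enn2ereal (w x)))"
        by (rule lev[unfolded is_level_function_def sup, THEN conjunct2, THEN bspec, OF g])
      then show "(\<integral>\<^sup>+x. e2ennreal (fo x) * w x \<partial>M) = level_pairing f w"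
        using int[OF fo g] by simp
    qed
  next
    assume *: "fo \<in> core_decreasing M \<A> \<and>
      (\<forall>w\<in>decreasing. (\<integral>\<^sup>+x. e2ennreal (fo x) * w x \<partial>M) = level_pairing f w)"
    show "is_level_function M \<A> f fo"
      unfolding is_level_function_def sup
    proof (intro conjI ballI)
      show "fo \<in> core_decreasing M \<A>" using * by simp
      fix g assume "g \<in> core_decreasing M \<A>"
      then show "(\<integral>\<^sup>+x. e2ennreal (fo x * g x) \<partial>M) = level_pairing f (\<lambda>x. e2ennreal (g x))"
        using * core_decreasing_imp_decreasing[of g] int[of g] by simp
    qed
  qed
qed

text \<open>
  For \<open>\<le>\<close>, the averages \<open>T w\<close> compete in the supremum. For \<open>\<ge>\<close>, a competitor \<open>v\<close> satisfies
  \<open>\<integral> f v \<le> \<integral> F v \<le> \<integral> F w\<close>, first because \<open>v\<close> is decreasing and then because \<open>F\<close> is.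
\<close>

lemma level_pairing_eq:
  assumes [measurable]: "f \<in> borel_measurable M"
    and F: "level_majorant (\<lambda>x. e2ennreal \<bar>f x\<bar>) F"
    and w: "w \<in> decreasing"
  shows "(\<integral>\<^sup>+x. F x * w x \<partial>M) = level_pairing f w"
proof (rule antisym)
  show "(\<integral>\<^sup>+x. F x * w x \<partial>M) \<le> level_pairing f w"
  proof (rule level_majorantD(3)[OF F decreasing_measurable[OF w]])
    fix n C assume C: "staircase n C"
    show "(\<integral>\<^sup>+x. e2ennreal \<bar>f x\<bar> * staircase_averaging n C w x \<partial>M) \<le> level_pairing f w"
      unfolding level_pairing_def
      using averaging_decreasing[OF C w] averaging_down_set_integral_le[OF C w core_down_set]
      by (intro SUP_upper) simp
  qed
  show "level_pairing f w \<le> (\<integral>\<^sup>+x. F x * w x \<partial>M)"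
    unfolding level_pairing_def
  proof (rule SUP_least)
    fix v assume "v \<in> {v \<in> decreasing. \<forall>A\<in>\<A>. (\<integral>\<^sup>+x\<in>A. v x \<partial>M) \<le> (\<integral>\<^sup>+x\<in>A. w x \<partial>M)}"
    then have v: "v \<in> decreasing" and le: "\<And>A. A \<in> \<A> \<Longrightarrow> (\<integral>\<^sup>+x\<in>A. v x \<partial>M) \<le> (\<integral>\<^sup>+x\<in>A. w x \<partial>M)" by auto
    note m = decreasing_measurable[OF v] decreasing_measurable[OF w] decreasing_measurable[OF level_majorantD(1)[OF F]]
    have "abs_pairing M f v \<le> (\<integral>\<^sup>+x. F x * v x \<partial>M)"
      by (rule nn_integral_mult_decreasing_mono[OF _ m(3) v level_majorantD(2)[OF F]]) measurable
    also have "\<dots> = (\<integral>\<^sup>+x. v x * F x \<partial>M)" by (simp add: mult.commute)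
    also have "\<dots> \<le> (\<integral>\<^sup>+x. w x * F x \<partial>M)"
      by (rule nn_integral_mult_decreasing_mono[OF m(1,2) level_majorantD(1)[OF F] core_integral_le_imp_down_set_integral_le[OF m(1) w le]])
    finally show "abs_pairing M f v \<le> (\<integral>\<^sup>+x. F x * w x \<partial>M)"
      by (simp add: mult.commute)
  qed
qed

end

locale uri_full_core = uri_function_space M X + full_core M \<A> for M :: "'a measure" and X \<A>
begin

lemma down_norm_eq:
  assumes f: "f \<in> borel_measurable M"
  shows "down_norm M \<A> X f =
    (SUP w \<in> {w \<in> decreasing. dual_norm M X w \<le> 1}. abs_pairing M f w)"
    (is "_ = Sup (?J ` ?W)")
proof -
  let ?G = "{g \<in> fs_carrier (associate_space M X) \<inter> core_decreasing M \<A>. fs_norm (associate_space M X) g \<le> 1}"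
  let ?I = "\<lambda>g. \<integral>\<^sup>+x. e2ennreal (\<bar>f x\<bar> * g x) \<partial>M"
  have eq: "?I g = ?J (\<lambda>x. e2ennreal (g x))" if "g \<in> core_decreasing M \<A>" for g
    using nn_integral_mult_core_decreasing[OF that, of "\<lambda>x. \<bar>f x\<bar>"] by simp
  have norm: "associate_norm M X g = dual_norm M X (\<lambda>x. e2ennreal (g x))" if "g \<in> core_decreasing M \<A>" for g
    unfolding associate_norm_eq_dual_norm
    by (intro dual_norm_cong) (simp add: core_decreasing_nonneg[OF that])
  have "Sup (?I ` ?G) = Sup (?J ` ?W)"
  proof (rule antisym)
    show "Sup (?I ` ?G) \<le> Sup (?J ` ?W)"
    proof (rule SUP_least)
      fix g assume "g \<in> ?G"
      then have g: "g \<in> core_decreasing M \<A>" "associate_norm M X g \<le> 1" by (simp_all add: associate_space_def)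
      then have "(\<lambda>x. e2ennreal (g x)) \<in> ?W" using core_decreasing_imp_decreasing norm by simp
      then have "?J (\<lambda>x. e2ennreal (g x)) \<le> Sup (?J ` ?W)" by (rule SUP_upper)
      then show "?I g \<le> Sup (?J ` ?W)" using eq[OF g(1)] by simp
    qed
    show "Sup (?J ` ?W) \<le> Sup (?I ` ?G)"
    proof (rule SUP_least)
      fix w assume w: "w \<in> ?W"
      let ?g = "\<lambda>x. enn2ereal (w x)"
      have g: "?g \<in> core_decreasing M \<A>" using w decreasing_imp_core_decreasing by simp
      have n: "associate_norm M X ?g \<le> 1" using norm[OF g] w by simp
      have "w \<in> borel_measurable M" using w by (intro decreasing_measurable) simp
      then have "?g \<in> borel_measurable M" by measurable
      then have "?g \<in> ?G" using g n by (simp add: associate_space_def le_less_trans)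
      then have "?I ?g \<le> Sup (?I ` ?G)" by (rule SUP_upper)
      then show "?J w \<le> Sup (?I ` ?G)" using eq[OF g] by simp
    qed
  qed
  then show ?thesis by (simp add: down_norm_def)
qed

lemma le_down_norm:
  assumes "f \<in> borel_measurable M" "w \<in> decreasing" "dual_norm M X w \<le> 1"
  shows "abs_pairing M f w \<le> down_norm M \<A> X f"
  unfolding down_norm_eq[OF assms(1)] using assms(2,3) by (intro SUP_upper) simp

text \<open>
  A small multiple of the indicator of \<open>D\<close> is a decreasing function in the unit ball of the associate
  space.
\<close>

lemma set_integral_finite_if_down_norm_finite:
  assumes f[measurable]: "f \<in> borel_measurable M" and fin: "down_norm M \<A> X f < \<infinity>"
    and D: "D \<in> down_sets" "emeasure M D < \<infinity>"
  shows "(\<integral>\<^sup>+x\<in>D. e2ennreal \<bar>f x\<bar> \<partial>M) < \<infinity>"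
proof -
  have [measurable]: "D \<in> sets M" using D by auto
  obtain c where c: "dual_norm M X (indicator D) = ennreal c" "0 \<le> c"
    using dual_norm_indicator[of D] D by (cases "dual_norm M X (indicator D)") auto
  define a where "a = 1 / (c + 1)"
  have a: "0 < a" "a * c \<le> 1" using c by (auto simp: a_def field_simps)
  let ?w = "\<lambda>x. ennreal a * indicator D x"
  have "dual_norm M X ?w \<le> 1"
  proof (rule dual_norm_le)
    fix k assume k: "k \<in> fs_carrier X" "fs_norm X k \<le> 1"
    have [measurable]: "k \<in> borel_measurable M" by (rule carrier_measurable[OF k(1)])
    have "abs_pairing M k ?w = ennreal a * (\<integral>\<^sup>+x. e2ennreal \<bar>k x\<bar> * indicator D x \<partial>M)"
      by (subst nn_integral_cmult[symmetric]) (auto simp: mult_ac)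
    also have "\<dots> \<le> ennreal a * ennreal c"
      unfolding c(1)[symmetric] by (intro mult_left_mono nn_integral_le_dual_norm k) simp
    also have "\<dots> \<le> 1" using a c by (simp add: ennreal_mult[symmetric])
    finally show "abs_pairing M k ?w \<le> 1" .
  qed
  then have "abs_pairing M f ?w \<le> down_norm M \<A> X f"
    by (intro le_down_norm f scaled_indicator_decreasing D)
  also have "abs_pairing M f ?w = ennreal a * (\<integral>\<^sup>+x\<in>D. e2ennreal \<bar>f x\<bar> \<partial>M)"
    by (subst nn_integral_cmult[symmetric]) (auto simp: mult_ac)
  finally have "ennreal a * (\<integral>\<^sup>+x\<in>D. e2ennreal \<bar>f x\<bar> \<partial>M) < \<infinity>" using fin by (rule le_less_trans)
  then show ?thesis using a by (auto simp: ennreal_mult_less_top ennreal_mult_eq_top_iff less_top)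
qed

text \<open>
  Both the level function \<open>F\<close> of \<open>f\<close> and the competitor in the bidual norm are built as level majorants:
  replacing \<open>w\<close> by its majorant \<open>W\<close> costs nothing in the dual norm and makes it decreasing, so that \<open>g\<close>
  may be traded for \<open>F\<close> and then \<open>F\<close> for averages of \<open>f\<close>.
\<close>

lemma down_norm_finite_imp_level_function:
  assumes f: "f \<in> borel_measurable M" and fin: "down_norm M \<A> X f < \<infinity>"
  shows "\<exists>fo. is_level_function M \<A> f fo"
    and "is_level_function M \<A> f g \<Longrightarrow>
      bidual_norm g \<le> down_norm M \<A> X f"
proof -
  let ?f = "\<lambda>x. e2ennreal \<bar>f x\<bar>"
  have fm: "?f \<in> borel_measurable M" using f by measurable
  obtain F where F: "level_majorant ?f F"
    using exists_level_majorant[OF fm set_integral_finite_if_down_norm_finite[OF f fin]] ..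
  have pairing: "(\<integral>\<^sup>+x. F x * w x \<partial>M) = level_pairing f w" if "w \<in> decreasing" for w
    by (rule level_pairing_eq[OF f F that])
  have "is_level_function M \<A> f (\<lambda>x. enn2ereal (F x))"
    using decreasing_imp_core_decreasing[OF level_majorantD(1)[OF F]] pairing by (simp add: is_level_function_iff)
  then show "\<exists>fo. is_level_function M \<A> f fo" by blast
  show "bidual_norm g \<le> down_norm M \<A> X f"
    if lev: "is_level_function M \<A> f g"
  proof -
    from lev have g: "g \<in> core_decreasing M \<A>"
      and g_pairing: "\<And>w. w \<in> decreasing \<Longrightarrow> (\<integral>\<^sup>+x. e2ennreal (g x) * w x \<partial>M) = level_pairing f w"
      by (simp_all add: is_level_function_iff)
    let ?G = "\<lambda>x. e2ennreal (g x)"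
    have G: "?G \<in> decreasing" by (rule core_decreasing_imp_decreasing[OF g])
    have gm: "g \<in> borel_measurable M" by (rule core_decreasing_measurable[OF g])
    show "bidual_norm g \<le> down_norm M \<A> X f"
      unfolding bidual_norm_eq[OF gm]
    proof (rule SUP_least)
      fix w assume "w \<in> {w \<in> borel_measurable M. dual_norm M X w \<le> 1}"
      then have wm: "w \<in> borel_measurable M" and w1: "dual_norm M X w \<le> 1" by auto
      have wfin: "dual_norm M X w < \<infinity>" using w1 by (simp add: le_less_trans)
      obtain W where W: "level_majorant w W"
        using exists_level_majorant[OF wm set_integral_finite_if_dual_norm_finite[OF down_set_sets wm _ wfin]] ..
      note W_dec = level_majorantD(1)[OF W]
      note Wm = decreasing_measurable[OF W_dec]
      have "dual_norm M X W \<le> dual_norm M X w"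
      proof (rule dual_norm_le)
        fix k assume k: "k \<in> fs_carrier X" "fs_norm X k \<le> 1"
        have km: "(\<lambda>x. e2ennreal \<bar>k x\<bar>) \<in> borel_measurable M" using carrier_measurable[OF k(1)] by measurable
        have "(\<integral>\<^sup>+x. W x * e2ennreal \<bar>k x\<bar> \<partial>M) \<le> dual_norm M X w"
        proof (rule level_majorantD(3)[OF W km])
          fix n C assume C: "staircase n C"
          note T = averaging_mem[OF k(1) staircase_block_family[OF C]]
          show "(\<integral>\<^sup>+x. w x * staircase_averaging n C (\<lambda>x. e2ennreal \<bar>k x\<bar>) x \<partial>M) \<le> dual_norm M X w"
            using nn_integral_le_dual_norm[OF T(1) order_trans[OF T(2) k(2)], where w = w]
            by (simp add: mult.commute)
        qed
        then show "abs_pairing M k W \<le> dual_norm M X w" by (simp add: mult.commute)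
      qed
      then have W1: "dual_norm M X W \<le> 1" using w1 by (rule order_trans)
      have "abs_pairing M g w = (\<integral>\<^sup>+x. w x * ?G x \<partial>M)"
        by (intro nn_integral_cong) (simp add: core_decreasing_nonneg[OF g] mult.commute)
      also have "\<dots> \<le> (\<integral>\<^sup>+x. W x * ?G x \<partial>M)"
        by (rule nn_integral_mult_decreasing_mono[OF wm Wm G level_majorantD(2)[OF W]])
      also have "\<dots> = (\<integral>\<^sup>+x. ?G x * W x \<partial>M)" by (simp add: mult.commute)
      also have "\<dots> = (\<integral>\<^sup>+x. F x * W x \<partial>M)" using g_pairing[OF W_dec] pairing[OF W_dec] by simp
      also have "\<dots> \<le> down_norm M \<A> X f"
      proof (rule level_majorantD(3)[OF F Wm])
        fix n C assume C: "staircase n C"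
        show "(\<integral>\<^sup>+x. ?f x * staircase_averaging n C W x \<partial>M) \<le> down_norm M \<A> X f"
          using order_trans[OF dual_norm_averaging[OF staircase_block_family[OF C] Wm] W1]
          by (intro le_down_norm f averaging_decreasing[OF C W_dec])
      qed
      finally show "abs_pairing M g w \<le> down_norm M \<A> X f" .
    qed
  qed
qed

text \<open>
  Every decreasing \<open>w\<close> is admissible in its own level pairing.
\<close>

lemma down_norm_le_norm_level_function:
  assumes f: "f \<in> borel_measurable M" and lev: "is_level_function M \<A> f fo"
    and fom: "fo \<in> borel_measurable M"
  shows "down_norm M \<A> X f \<le> bidual_norm fo"
  unfolding down_norm_eq[OF f]
proof (rule SUP_least)
  fix w assume "w \<in> {w \<in> decreasing. dual_norm M X w \<le> 1}"
  then have w: "w \<in> decreasing" "dual_norm M X w \<le> 1" by auto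
  have fo: "fo \<in> core_decreasing M \<A>" using lev by (simp add: is_level_function_def)
  have "abs_pairing M f w \<le> level_pairing f w"
    unfolding level_pairing_def using w(1) by (intro SUP_upper) simp
  also have "\<dots> = (\<integral>\<^sup>+x. e2ennreal (fo x) * w x \<partial>M)" using lev w(1) by (simp add: is_level_function_iff)
  also have "\<dots> = abs_pairing M fo w"
    by (intro nn_integral_cong) (simp add: core_decreasing_nonneg[OF fo])
  also have "\<dots> \<le> bidual_norm fo"
    unfolding bidual_norm_eq[OF fom]
    using w decreasing_measurable[OF w(1)] by (intro SUP_upper) simp
  finally show "abs_pairing M f w \<le> bidual_norm fo" .
qed

text \<open>
  Stated for any space \<open>Y\<close> that coincides with the second associate space, so that it covers \<open>Y = X\<close>
  under the Fatou property.
\<close>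

lemma down_space_eq_level_space:
  assumes carrier: "fs_carrier Y = fs_carrier (associate_space M (associate_space M X))"
    and norm: "\<And>f. f \<in> fs_carrier Y \<Longrightarrow> fs_norm Y f = bidual_norm f"
  shows "same_space (down_space M \<A> X) (level_space M \<A> Y)"
proof -
  let ?N = "bidual_norm"
  have mem: "g \<in> fs_carrier Y \<longleftrightarrow> g \<in> borel_measurable M \<and> ?N g < \<infinity>" for g
    unfolding carrier by (simp add: associate_space_def[of M "associate_space M X"])
  have to_level: "\<exists>fo\<in>fs_carrier Y. is_level_function M \<A> f fo"
    if f: "f \<in> borel_measurable M" "down_norm M \<A> X f < \<infinity>" for f
  proof -
    obtain fo where fo: "is_level_function M \<A> f fo"
      using down_norm_finite_imp_level_function(1)[OF f] ..
    have "fo \<in> core_decreasing M \<A>" using fo by (simp add: is_level_function_def)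
    then have "fo \<in> borel_measurable M" by (rule core_decreasing_measurable)
    moreover have "?N fo < \<infinity>" 
      using down_norm_finite_imp_level_function(2)[OF f fo] f(2) by (rule le_less_trans)
    ultimately have "fo \<in> fs_carrier Y" by (simp add: mem)
    then show ?thesis using fo by blast
  qed
  have of_level: "down_norm M \<A> X f < \<infinity> \<and> fs_norm Y fo = down_norm M \<A> X f"
    if f: "f \<in> borel_measurable M" and fo: "fo \<in> fs_carrier Y" "is_level_function M \<A> f fo" for f fo
  proof -
    have le: "down_norm M \<A> X f \<le> ?N fo"
      using fo by (intro down_norm_le_norm_level_function f) (simp_all add: mem)
    then have fin: "down_norm M \<A> X f < \<infinity>" using fo(1) by (auto simp: mem intro: le_less_trans)
    have "?N fo \<le> down_norm M \<A> X f"
      by (rule down_norm_finite_imp_level_function(2)[OF f fin fo(2)])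
    then show ?thesis using le fin norm[OF fo(1)] by simp
  qed
  show ?thesis
    unfolding same_space_def
  proof (intro conjI ballI)
    show "fs_carrier (down_space M \<A> X) = fs_carrier (level_space M \<A> Y)"
      using to_level of_level by (auto simp: down_space_def level_space_def)
    fix f assume "f \<in> fs_carrier (down_space M \<A> X)"
    then have f: "f \<in> borel_measurable M" "down_norm M \<A> X f < \<infinity>" by (simp_all add: down_space_def)
    obtain fo where fo: "fo \<in> fs_carrier Y" "is_level_function M \<A> f fo" using to_level[OF f] by blast
    have "(THE r. \<exists>fo\<in>fs_carrier Y. is_level_function M \<A> f fo \<and> r = fs_norm Y fo) = down_norm M \<A> X f"
      using fo of_level[OF f(1)] by (intro the_equality) auto
    then show "fs_norm (down_space M \<A> X) f = fs_norm (level_space M \<A> Y) f"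
      by (simp add: down_space_def level_space_def)
  qed
qed

end

theorem theorem8p2:
  fixes M :: "'a measure" and \<A> :: "'a set set" and X :: "'a fun_space"
  assumes "sigma_finite_measure M"
    and "full_ordered_core M \<A>"
    and "uri_space M X"
    and "nontrivial_space M X"
  shows "same_space (down_space M \<A> X)
           (level_space M \<A> (associate_space M (associate_space M X))) \<and>
         (fatou_property M X \<longrightarrow> same_space (down_space M \<A> X) (level_space M \<A> X))"
proof -
  interpret sigma_finite_measure M by fact
  interpret uri_full_core M X \<A> by unfold_locales fact+
  show ?thesis
  proof (intro conjI impI)
    show "same_space (down_space M \<A> X) (level_space M \<A> (associate_space M (associate_space M X)))"
      by (rule down_space_eq_level_space) (simp_all add: associate_space_def[of M "associate_space M X"])
  next
    assume fatou: "fatou_property M X"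
    show "same_space (down_space M \<A> X) (level_space M \<A> X)"
    proof (rule down_space_eq_level_space)
      show "fs_carrier X = fs_carrier (associate_space M (associate_space M X))"
        by (simp only: second_associate_eq(1)[OF fatou])
      show "fs_norm X f = associate_norm M (associate_space M X) f" if "f \<in> fs_carrier X" for f
        using second_associate_eq(2)[OF fatou that] by (simp add: associate_space_def[of M "associate_space M X"])
    qed
  qed
qed

end
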